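(* Let $\delta>0$ be fixed. There is a constant $C=C(\delta)$ such that the following holds. Let $n\ge 1$, let $r\ge \exp((\ln n)^{1/4})$, and let $A$ be an $n\times n$ symmetric matrix of complex numbers such that every row of $A$ has at least $r$ nonzero entries. Let $L$ be an arbitrary linear form in $n$ variables. Let $x$ be a random vector of length $n$ with entries chosen uniformly and independently from $\{1,-1\}$. Then $$\sup_{c}\ \mathbf{P}\left(x^TAx=L(x)+c\right)\ \le\ C\, r^{-1/2+\delta}.$$ In particular, the bound holds when $L$ is identically $0$.
   Context: Here $L(x)=\sum_i \ell_i x_i$ with arbitrary complex coefficients $\ell_i$, and the supremum is over all complex constants $c$. "Symmetric" means $A^T=A$. *)

theory Defs
  imports "HOL-Probability.Probability" "HOL-Probability.Product_PMF" "Jordan_Normal_Form.Matrix"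
begin

definition random_sign_vec :: "nat \<Rightarrow> complex Matrix.vec pmf" where
  "random_sign_vec n = map_pmf (Matrix.vec n) (Pi_pmf {..<n} 0 (\<lambda>_. pmf_of_set {1, -1}))"

definition row_support :: "complex Matrix.mat \<Rightarrow> nat \<Rightarrow> nat set" where
  "row_support A i = {j. j < dim_col A \<and> A $$ (i, j) \<noteq> 0}"

(* The transpose in x^T A x is the bilinear, not the sesquilinear, one: scalar_prod does not conjugate. *)
definition quadratic_form :: "complex Matrix.mat \<Rightarrow> complex Matrix.vec \<Rightarrow> complex" where
  "quadratic_form A x = scalar_prod x (A *\<^sub>v x)"

definition linear_form :: "complex Matrix.vec \<Rightarrow> complex Matrix.vec \<Rightarrow> complex" where
  "linear_form l x = scalar_prod l x"

end

theory Submission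
  imports Defs
begin

text \<open>
Decoupling. Split the variables as \<open>x = (y, z)\<close> and let \<open>z'\<close> be an independent copy of \<open>z\<close>. By Cauchy--Schwarz,
\<open>P(Q(x) = 0)\<^sup>2\<close> is at most the probability that \<open>Q(y, z) = Q(y, z') = 0\<close>, and the difference of the two
equations is a linear equation in \<open>y\<close>. Now iterate: let \<open>p\<^sub>k\<close> bound the probability that \<open>Q = 0\<close> and \<open>k\<close> robustly
independent linear forms take prescribed values. Keeping the quadratic equation at every step gives
\<open>p\<^sub>k\<^sup>2 \<le> m powr (-k/2) * p\<^bsub>k+1\<^esub>\<close> up to negligible terms, where the factor is the cost of the \<open>k\<close> forms agreeing on
\<open>z\<close> and \<open>z'\<close>. Since \<open>p\<^sub>k \<le> m powr (-k/2)\<close> by a Halasz-type bound, \<open>k\<close> rounds give \<open>p\<^sub>0 \<le> C * m powr (-1/2 + 2 powr (-k-1))\<close>.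

The new forms are independent of the old ones unless \<open>A\<close> is close to a matrix of bounded rank. In that case one passes to a
set of variables on which the off-diagonal part of \<open>A\<close> has bounded rank exactly and still contains a large matching of
nonzero entries. There \<open>Q\<close> is a quadratic polynomial in boundedly many linear forms, and the same recursion, stopped
when the dimension is exhausted, loses nothing in the exponent.
\<close>

section \<open>Probability mass functions\<close>

text \<open>All sizes are powers of two: \<open>decay t\<close> is m powr (-1/2) for m = 2 ^ t, and
  forms are robust when they are independent on each of 2 ^ t disjoint blocks, which is what the
  Halasz-type bound consumes. The exponents of the tower solve 2 * a k = k / 2 + a (k + 1) with a K0
  = K0 / 2, hence a 0 = 1 / 2 - (1 / 2) ^ (K0 + 1). The obstacle in the tower is that variables must
  be set aside for every level in advance, while each new form has to stay independent of the old
  ones on blocks of all later levels. A random colouring with K0 + 1 colours provides this: its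
  requirements are polynomially many in the group size g, each fails with probability exponentially
  small in g, and the count does not involve the number of variables. The price is three factors 2 ^
  e in r = 2 ^ (q * e), harmless in the exponent once q is large compared with 1 / \<delta>. In the
  low rank case the linear relations between rows hold only off small exceptional sets that vary
  with the row. An independent set in the sparse digraph of conflicts makes them exact; a matching
  survives because the rows have many nonzero entries.\<close>

abbreviation prb :: "'a pmf \<Rightarrow> ('a \<Rightarrow> bool) \<Rightarrow> real" where
  "prb p Q \<equiv> measure_pmf.prob p {x. Q x}"

lemma prb_mono:
  assumes "\<And>x. x \<in> set_pmf p \<Longrightarrow> Q x \<Longrightarrow> R x"
  shows "prb p Q \<le> prb p R"
proof -
  have "measure_pmf.prob p {x. Q x} = measure_pmf.prob p ({x. Q x} \<inter> set_pmf p)"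
    by (simp add: measure_Int_set_pmf)
  also have "\<dots> \<le> measure_pmf.prob p {x. R x}"
    by (intro measure_pmf.finite_measure_mono) (use assms in auto)
  finally show ?thesis .
qed

lemma prb_cong:
  assumes "\<And>x. x \<in> set_pmf p \<Longrightarrow> Q x \<longleftrightarrow> R x"
  shows "prb p Q = prb p R"
  using assms by (intro antisym prb_mono) auto

lemma prb_map: "prb (map_pmf f p) Q = prb p (\<lambda>x. Q (f x))"
  by (simp add: vimage_def)

lemma prb_disj: "prb p (\<lambda>x. Q x \<or> R x) \<le> prb p Q + prb p R"
proof -
  have "{x. Q x \<or> R x} = {x. Q x} \<union> {x. R x}" by auto
  then show ?thesis
    using measure_Un_le[of "{x. Q x}" "measure_pmf p" "{x. R x}"] by simp
qed

lemma prb_Bex: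
  assumes "finite I"
  shows "prb p (\<lambda>x. \<exists>i\<in>I. Q i x) \<le> (\<Sum>i\<in>I. prb p (Q i))"
proof -
  have "{x. \<exists>i\<in>I. Q i x} = (\<Union>i\<in>I. {x. Q i x})" by auto
  then show ?thesis
    using measure_pmf.finite_measure_subadditive_finite[OF assms, of "\<lambda>i. {x. Q i x}" p] by simp
qed

lemma integrable_prb: "integrable (measure_pmf p) (\<lambda>x. prb (q x) (Q x))"
  by (rule measure_pmf.integrable_const_bound[where B = 1]) auto

lemma prb_pair:
  "prb (pair_pmf p q) (\<lambda>(x, y). Q x y) = measure_pmf.expectation p (\<lambda>x. prb q (Q x))"
proof -
  have "emeasure (measure_pmf (pair_pmf p q)) {(x, y). Q x y}
        = (\<integral>\<^sup>+ x. emeasure (measure_pmf (map_pmf (\<lambda>y. (x, y)) q)) {(x, y). Q x y} \<partial>measure_pmf p)"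
    unfolding pair_pmf_def by (simp add: map_pmf_def)
  also have "\<dots> = (\<integral>\<^sup>+ x. ennreal (prb q (Q x)) \<partial>measure_pmf p)"
    by (simp add: vimage_def measure_pmf.emeasure_eq_measure)
  also have "\<dots> = ennreal (measure_pmf.expectation p (\<lambda>x. prb q (Q x)))"
    by (intro nn_integral_eq_integral integrable_prb) auto
  finally have "ennreal (prb (pair_pmf p q) (\<lambda>(x, y). Q x y))
      = ennreal (measure_pmf.expectation p (\<lambda>x. prb q (Q x)))"
    by (simp add: measure_pmf.emeasure_eq_measure)
  then show ?thesis
    by (simp add: Bochner_Integration.integral_nonneg)
qed

lemma expectation_le:
  assumes "\<And>x. x \<in> set_pmf p \<Longrightarrow> f x \<le> (B::real)" and "B \<ge> 0"
  shows "measure_pmf.expectation p f \<le> B"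
proof (cases "integrable (measure_pmf p) f")
  case True
  have "measure_pmf.expectation p f \<le> measure_pmf.expectation p (\<lambda>_. B)"
    by (intro integral_mono_AE) (use True assms in \<open>auto simp: AE_measure_pmf_iff\<close>)
  then show ?thesis by simp
next
  case False
  then show ?thesis using assms by (simp add: not_integrable_integral_eq)
qed

lemma prb_pair_le:
  assumes "\<And>x. x \<in> set_pmf p \<Longrightarrow> prb q (Q x) \<le> B" "B \<ge> 0"
  shows "prb (pair_pmf p q) (\<lambda>(x, y). Q x y) \<le> B"
  unfolding prb_pair by (rule expectation_le) (use assms in auto)

lemma prb_pair_swap: "prb (pair_pmf p q) (\<lambda>(x, y). Q x y) = prb (pair_pmf q p) (\<lambda>(y, x). Q x y)"
  by (subst pair_commute_pmf) (simp only: prb_map case_prod_unfold fst_conv snd_conv)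

lemma prb_pair_le':
  assumes "\<And>y. y \<in> set_pmf q \<Longrightarrow> prb p (\<lambda>x. Q x y) \<le> B" "B \<ge> 0"
  shows "prb (pair_pmf p q) (\<lambda>(x, y). Q x y) \<le> B"
  unfolding prb_pair_swap[of p q] by (rule prb_pair_le) (use assms in auto)

lemma prb_pair_split:
  assumes "\<And>x. x \<in> set_pmf p \<Longrightarrow> S x \<Longrightarrow> prb q (Q x) \<le> B" "B \<ge> 0"
  shows "prb (pair_pmf p q) (\<lambda>(x, y). S x \<and> Q x y) \<le> B * prb p S"
proof -
  have "prb (pair_pmf p q) (\<lambda>(x, y). S x \<and> Q x y)
      = measure_pmf.expectation p (\<lambda>x. prb q (\<lambda>y. S x \<and> Q x y))"
    by (rule prb_pair)
  also have "\<dots> \<le> measure_pmf.expectation p (\<lambda>x. B * indicator {x. S x} x)"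
  proof (rule integral_mono_AE)
    show "AE x in measure_pmf p. prb q (\<lambda>y. S x \<and> Q x y) \<le> B * indicator {x. S x} x"
      using assms by (auto simp: AE_measure_pmf_iff indicator_def)
    show "integrable (measure_pmf p) (\<lambda>x. B * indicator {x. S x} x :: real)"
      by (rule measure_pmf.integrable_const_bound[where B = B])
         (use assms in \<open>auto simp: indicator_def\<close>)
  qed (rule integrable_prb)
  also have "\<dots> = B * prb p S" by simp
  finally show ?thesis .
qed

text \<open>For fixed \<open>x\<close> the two events are independent with the same probability f x
  = \<open>prb q (Q x)\<close>, so the right-hand side is the second moment of f; the inequality is
  nonnegativity of the variance.\<close>

lemma prb_decouple:
  "(prb (pair_pmf p q) (\<lambda>(x, y). Q x y))\<^sup>2
    \<le> prb (pair_pmf (pair_pmf q q) p) (\<lambda>((y, y'), x). Q x y \<and> Q x y')"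
proof -
  let ?f = "\<lambda>x. prb q (Q x)"
  have sq: "(prb q (Q x))\<^sup>2 = prb (pair_pmf q q) (\<lambda>(y, y'). Q x y \<and> Q x y')" for x
  proof -
    have "prb (pair_pmf q q) (\<lambda>(y, y'). Q x y \<and> Q x y')
       = measure_pmf.expectation q (\<lambda>y. prb q (\<lambda>y'. Q x y \<and> Q x y'))"
      by (rule prb_pair)
    also have "\<dots> = measure_pmf.expectation q (\<lambda>y. prb q (Q x) * indicator {y. Q x y} y)"
      by (intro Bochner_Integration.integral_cong) (auto simp: indicator_def)
    also have "\<dots> = (prb q (Q x))\<^sup>2"
      by (simp add: power2_eq_square)
    finally show ?thesis by simp
  qed
  have int2: "integrable (measure_pmf p) (\<lambda>x. (?f x)\<^sup>2)"
    unfolding sq by (rule integrable_prb)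
  have "0 \<le> measure_pmf.variance p ?f"
    by (rule measure_pmf.variance_positive)
  also have "\<dots> = measure_pmf.expectation p (\<lambda>x. (?f x)\<^sup>2) - (measure_pmf.expectation p ?f)\<^sup>2"
    by (rule measure_pmf.variance_eq) (use int2 integrable_prb in auto)
  finally have "(measure_pmf.expectation p ?f)\<^sup>2 \<le> measure_pmf.expectation p (\<lambda>x. (?f x)\<^sup>2)"
    by simp
  also have "\<dots> = prb (pair_pmf p (pair_pmf q q)) (\<lambda>(x, z). (case z of (y, y') \<Rightarrow> Q x y \<and> Q x y'))"
    unfolding sq prb_pair by simp
  also have "\<dots> = prb (pair_pmf (pair_pmf q q) p) (\<lambda>((y, y'), x). Q x y \<and> Q x y')"
    by (subst prb_pair_swap) (simp add: case_prod_unfold)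
  finally show ?thesis unfolding prb_pair .
qed

lemma prb_eq_sum:
  assumes "finite R" "set_pmf p \<subseteq> R"
  shows "prb (pair_pmf p q) (\<lambda>(a, b). a = b) = (\<Sum>s\<in>R. pmf p s * pmf q s)"
proof -
  have "prb (pair_pmf p q) (\<lambda>(a, b). a = b)
      = prb (pair_pmf p q) (\<lambda>z. z \<in> (\<lambda>s. (s, s)) ` R)"
    by (rule prb_cong) (use assms in auto)
  also have "\<dots> = sum (pmf (pair_pmf p q)) ((\<lambda>s. (s, s)) ` R)"
    using assms by (simp add: measure_measure_pmf_finite)
  also have "\<dots> = (\<Sum>s\<in>R. pmf p s * pmf q s)"
    by (subst sum.reindex) (auto simp: inj_on_def pmf_pair)
  finally show ?thesis .
qed

text \<open>Termwise AM-GM: a collision probability is a sum of products of point masses, hence at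
  most the mean of the two self-collision probabilities.\<close>

lemma prb_coincide_max_aux:
  assumes "finite (set_pmf p)" "finite (set_pmf q)"
  shows "prb (pair_pmf p q) (\<lambda>(x, y). x = y)
    \<le> max (prb (pair_pmf p p) (\<lambda>(x, x'). x = x'))
          (prb (pair_pmf q q) (\<lambda>(y, y'). y = y'))"
proof -
  define R where "R = set_pmf p \<union> set_pmf q"
  have R: "finite R" "set_pmf p \<subseteq> R" "set_pmf q \<subseteq> R" using assms by (auto simp: R_def)
  have "2 * (\<Sum>s\<in>R. pmf p s * pmf q s) = (\<Sum>s\<in>R. 2 * (pmf p s * pmf q s))"
    by (rule sum_distrib_left)
  also have "\<dots> \<le> (\<Sum>s\<in>R. pmf p s * pmf p s + pmf q s * pmf q s)"
    by (intro sum_mono) (use sum_squares_bound in \<open>simp add: power2_eq_square mult.assoc\<close>)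
  also have "\<dots> = (\<Sum>s\<in>R. pmf p s * pmf p s) + (\<Sum>s\<in>R. pmf q s * pmf q s)"
    by (rule sum.distrib)
  finally show ?thesis
    unfolding prb_eq_sum[OF R(1,2)] prb_eq_sum[OF R(1,3)] by linarith
qed

lemma prb_coincide_max:
  assumes "finite (set_pmf p)" "finite (set_pmf q)"
  shows "prb (pair_pmf p q) (\<lambda>(x, y). f x = g y)
    \<le> max (prb (pair_pmf p p) (\<lambda>(x, x'). f x = f x'))
          (prb (pair_pmf q q) (\<lambda>(y, y'). g y = g y'))"
proof -
  have pull: "prb (pair_pmf (map_pmf h1 p1) (map_pmf h2 p2)) (\<lambda>(x, y). x = y)
      = prb (pair_pmf p1 p2) (\<lambda>(x, y). h1 x = h2 y)" for h1 h2 p1 p2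
    unfolding map_pair[symmetric] prb_map by (simp add: case_prod_unfold)
  show ?thesis
    using prb_coincide_max_aux[of "map_pmf f p" "map_pmf g q"] assms unfolding pull by simp
qed

section \<open>Anticoncentration of vector-valued linear forms\<close>

text \<open>The law of a sum of \<open>2 ^ t\<close> independent signs. Differences appear because the doubling step below compares
a variable with an independent copy of itself.\<close>

primrec rad :: "nat \<Rightarrow> complex pmf" where
  "rad 0 = pmf_of_set {1, -1}"
| "rad (Suc t) = map_pmf (\<lambda>(a, b). a - b) (pair_pmf (rad t) (rad t))"

definition signs :: "nat \<Rightarrow> 'a set \<Rightarrow> ('a \<Rightarrow> complex) pmf" where
  "signs t U = Pi_pmf U 0 (\<lambda>_. rad t)"

lemma finite_set_rad [simp]: "finite (set_pmf (rad t))"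
  by (induction t) auto

lemma finite_set_signs: "finite U \<Longrightarrow> finite (set_pmf (signs t U))"
  unfolding signs_def by (subst set_Pi_pmf) auto

lemma signs_0_values: "finite U \<Longrightarrow> x \<in> set_pmf (signs 0 U) \<Longrightarrow> i \<in> U \<Longrightarrow> x i = 1 \<or> x i = -1"
  unfolding signs_def by (auto simp: set_Pi_pmf PiE_dflt_def)

lemma Pi_pmf_pair:
  assumes "finite U"
  shows "Pi_pmf U (d, d') (\<lambda>x. pair_pmf (p x) (q x))
    = map_pmf (\<lambda>(f, g) x. (f x, g x)) (pair_pmf (Pi_pmf U d p) (Pi_pmf U d' q))"
proof (rule pmf_eqI)
  fix h :: "'a \<Rightarrow> 'b \<times> 'c"
  let ?F = "\<lambda>(f, g) x. (f x, g x) :: 'b \<times> 'c"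
  have inj: "inj (?F :: ('a \<Rightarrow> 'b) \<times> ('a \<Rightarrow> 'c) \<Rightarrow> _)"
    by (auto simp: inj_on_def fun_eq_iff)
  have h: "h = ?F (fst \<circ> h, snd \<circ> h)" by auto
  have "pmf (map_pmf ?F (pair_pmf (Pi_pmf U d p) (Pi_pmf U d' q))) h
      = pmf (pair_pmf (Pi_pmf U d p) (Pi_pmf U d' q)) (fst \<circ> h, snd \<circ> h)"
    by (subst h, rule pmf_map_inj') (rule inj)
  also have "\<dots> = pmf (Pi_pmf U (d, d') (\<lambda>x. pair_pmf (p x) (q x))) h"
  proof -
    have "pmf (pair_pmf (p x) (q x)) (h x) = pmf (p x) (fst (h x)) * pmf (q x) (snd (h x))" for x
      by (metis pmf_pair prod.collapse)
    then show ?thesis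
      using assms by (auto simp: pmf_pair pmf_Pi prod.distrib prod_eq_iff)
  qed
  finally show "pmf (Pi_pmf U (d, d') (\<lambda>x. pair_pmf (p x) (q x))) h
    = pmf (map_pmf ?F (pair_pmf (Pi_pmf U d p) (Pi_pmf U d' q))) h" ..
qed

lemma signs_Suc:
  assumes "finite U"
  shows "signs (Suc t) U = map_pmf (\<lambda>(x, x') i. x i - x' i) (pair_pmf (signs t U) (signs t U))"
proof -
  have "signs (Suc t) U
     = map_pmf ((\<circ>) (\<lambda>(a, b). a - b)) (Pi_pmf U (0, 0) (\<lambda>_. pair_pmf (rad t) (rad t)))"
    unfolding signs_def rad.simps by (rule Pi_pmf_map) (use assms in auto)
  also have "\<dots> = map_pmf (\<lambda>(x, x') i. x i - x' i) (pair_pmf (signs t U) (signs t U))"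
    unfolding signs_def Pi_pmf_pair[OF assms] pmf.map_comp
    by (rule map_pmf_cong) (auto simp: fun_eq_iff)
  finally show ?thesis .
qed

lemma prb_signs_insert:
  assumes "finite U" "i \<notin> U"
  shows "prb (signs t (insert i U)) Q = prb (pair_pmf (signs t U) (rad t)) (\<lambda>(x, a). Q (x(i := a)))"
  unfolding signs_def Pi_pmf_insert[OF assms] prb_map
  by (subst prb_pair_swap[symmetric]) (simp add: case_prod_unfold)

lemma prb_signs_union:
  assumes "finite U" "finite W" "U \<inter> W = {}"
  shows "prb (signs t (U \<union> W)) Q
    = prb (pair_pmf (signs t U) (signs t W)) (\<lambda>(x, y). Q (\<lambda>i. if i \<in> U then x i else y i))"
  unfolding signs_def Pi_pmf_union[OF assms] prb_map by (simp add: case_prod_unfold)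

lemma sum_union_mix:
  fixes a :: "'a \<Rightarrow> 'b::comm_ring"
  assumes "finite U" "finite W" "U \<inter> W = {}"
  shows "(\<Sum>j\<in>U \<union> W. a j * (if j \<in> U then x j else y j)) = (\<Sum>j\<in>U. a j * x j) + (\<Sum>j\<in>W. a j * y j)"
proof -
  have "(\<Sum>j\<in>U \<union> W. a j * (if j \<in> U then x j else y j))
    = (\<Sum>j\<in>U. a j * (if j \<in> U then x j else y j)) + (\<Sum>j\<in>W. a j * (if j \<in> U then x j else y j))"
    by (rule sum.union_disjoint) (use assms in auto)
  also have "(\<Sum>j\<in>W. a j * (if j \<in> U then x j else y j)) = (\<Sum>j\<in>W. a j * y j)"
    by (rule sum.cong) (use assms in auto)
  finally show ?thesis by simp
qed

lemma signs_subset_bound: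
  assumes "finite V" "U \<subseteq> V" "B \<ge> 0"
    and "\<And>y. y \<in> set_pmf (signs t (V - U)) \<Longrightarrow>
          prb (signs t U) (\<lambda>x. Q (\<lambda>i. if i \<in> U then x i else y i)) \<le> B"
  shows "prb (signs t V) Q \<le> B"
proof -
  have "prb (signs t (U \<union> (V - U))) Q
    = prb (pair_pmf (signs t U) (signs t (V - U))) (\<lambda>(x, y). Q (\<lambda>i. if i \<in> U then x i else y i))"
    by (rule prb_signs_union) (use assms in \<open>auto intro: finite_subset\<close>)
  also have "\<dots> \<le> B"
    by (rule prb_pair_le') (use assms in auto)
  finally show ?thesis using assms by (simp add: Un_absorb1 Un_Diff_cancel)
qed

section \<open>Point masses of a sum of \<open>2 ^ t\<close> signs\<close>

definition walk :: "nat \<Rightarrow> complex pmf" where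
  "walk n = map_pmf (\<lambda>k. 2 * of_nat k - of_nat n) (binomial_pmf n (1/2))"

lemma binomial_pmf_add:
  assumes "p \<in> {0..1}"
  shows "binomial_pmf (m + n) p = map_pmf (\<lambda>(a, b). a + b) (pair_pmf (binomial_pmf m p) (binomial_pmf n p))"
proof (induction m)
  case 0
  have "binomial_pmf 0 p = return_pmf 0" using assms by (intro binomial_pmf_0) auto
  then show ?case by (simp add: pair_return_pmf1 pmf.map_comp o_def)
next
  case (Suc m)
  show ?case
    using assms
    by (simp add: binomial_pmf_Suc Suc map_pmf_def pair_pmf_def bind_assoc_pmf bind_return_pmf add.assoc)
qed

lemma walk_add: "map_pmf (\<lambda>(a, b). a + b) (pair_pmf (walk m) (walk n)) = walk (m + n)"
proof -
  have "walk (m + n) = map_pmf (\<lambda>(a, b). (2 * of_nat a - of_nat m) + (2 * of_nat b - of_nat n))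
          (pair_pmf (binomial_pmf m (1/2)) (binomial_pmf n (1/2)))"
    unfolding walk_def
    by (subst binomial_pmf_add) (auto simp: pmf.map_comp o_def algebra_simps case_prod_unfold)
  then show ?thesis
    unfolding walk_def map_pair[symmetric] pmf.map_comp by (simp add: o_def case_prod_unfold)
qed

lemma rad_symmetric: "map_pmf uminus (rad t) = rad t"
proof (cases t)
  case 0
  have "uminus ` {1, -1 :: complex} = {1, -1}" by auto
  then show ?thesis using 0
    by (simp add: map_pmf_of_set_inj)
next
  case (Suc s)
  have "map_pmf uminus (rad (Suc s)) = map_pmf (\<lambda>(a, b). b - a) (pair_pmf (rad s) (rad s))"
    by (simp add: pmf.map_comp o_def case_prod_unfold)
  also have "\<dots> = rad (Suc s)"
    by (subst pair_commute_pmf) (simp add: pmf.map_comp o_def case_prod_unfold)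
  finally show ?thesis using Suc by simp
qed

text \<open>By symmetry a difference of independent copies has the law of a sum, so each step of
  \<open>rad\<close> doubles the number of steps of the walk.\<close>

lemma rad_eq_walk: "rad t = walk (2 ^ t)"
proof (induction t)
  case 0
  have U: "(UNIV :: bool set) = {True, False}" by auto
  have b0: "binomial_pmf 0 (1/2) = return_pmf 0" by (intro binomial_pmf_0) auto
  have "walk 1 = map_pmf (\<lambda>b. if b then 1 else -1) (bernoulli_pmf (1/2))"
    unfolding walk_def
    by (subst One_nat_def, subst binomial_pmf_Suc)
       (auto simp: b0 map_pmf_def bind_assoc_pmf bind_return_pmf intro!: bind_pmf_cong)
  also have "\<dots> = pmf_of_set {1, -1}"
    unfolding bernoulli_pmf_half_conv_pmf_of_set
    by (subst map_pmf_of_set_inj) (auto simp: inj_on_def U insert_commute)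
  finally show ?case by simp
next
  case (Suc t)
  have "rad (Suc t) = map_pmf (\<lambda>(a, b). a - b) (pair_pmf (rad t) (map_pmf uminus (rad t)))"
    by (simp add: rad_symmetric)
  also have "\<dots> = map_pmf (\<lambda>(a, b). a + b) (pair_pmf (rad t) (rad t))"
    by (simp add: pair_map_pmf2 pmf.map_comp o_def case_prod_unfold apsnd_def map_prod_def)
  also have "\<dots> = walk (2 ^ Suc t)"
    unfolding Suc walk_add by (simp add: mult_2)
  finally show ?case .
qed

text \<open>Consecutive central binomial coefficients have ratio 2 * (2m + 1) / (m + 1), and (2m +
  1) * (2m + 3) is at most 4 * (m + 1) * (m + 1). The resulting constant 1 in
  \<open>pmf_rad_le\<close> survives the powers taken in \<open>halasz\<close>.\<close>

lemma central_binomial_sq: "(real ((2 * m) choose m))\<^sup>2 * (2 * real m + 1) \<le> 16 ^ m"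
proof (induction m)
  case (Suc m)
  let ?a = "real ((2 * m) choose m)" and ?b = "real (Suc (2 * m) choose m)"
    and ?c = "real ((2 * Suc m) choose Suc m)"
  have "Suc m * (Suc (Suc (2 * m)) choose Suc m) = Suc (Suc (2 * m)) * (Suc (2 * m) choose m)"
    by (subst Suc_times_binomial_eq) simp
  then have "real (Suc m * (Suc (Suc (2 * m)) choose Suc m)) = real (Suc (Suc (2 * m)) * (Suc (2 * m) choose m))"
    by (rule arg_cong)
  moreover have "2 * Suc m = Suc (Suc (2 * m))" "real (Suc (Suc (2 * m))) = 2 * real (Suc m)" by simp_all
  ultimately have "real (Suc m) * ?c = real (Suc m) * (2 * ?b)"
    by (simp only: of_nat_mult mult.assoc mult.left_commute)
  then have c: "?c = 2 * ?b" by (subst (asm) mult_left_cancel) simp_all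
  have "Suc m * (Suc (2 * m) choose Suc m) = Suc (2 * m) * ((2 * m) choose m)"
    by (subst Suc_times_binomial_eq) simp
  moreover have "Suc (2 * m) choose Suc m = Suc (2 * m) choose m"
    by (subst binomial_symmetric) auto
  ultimately have "Suc m * (Suc (2 * m) choose m) = Suc (2 * m) * ((2 * m) choose m)"
    by (simp only:)
  then have "real (Suc m * (Suc (2 * m) choose m)) = real (Suc (2 * m) * ((2 * m) choose m))"
    by (rule arg_cong)
  then have b: "(real m + 1) * ?b = (2 * real m + 1) * ?a"
    by (simp add: algebra_simps del: binomial_Suc_Suc)
  have "(real m + 1)\<^sup>2 * (?c\<^sup>2 * (2 * real (Suc m) + 1))
      = 4 * ((real m + 1) * ?b)\<^sup>2 * (2 * real m + 3)"
    unfolding c by (simp add: power2_eq_square algebra_simps del: binomial_Suc_Suc)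
  also have "\<dots> = 4 * (2 * real m + 1) * (2 * real m + 3) * (?a\<^sup>2 * (2 * real m + 1))"
    unfolding b by (simp add: power2_eq_square algebra_simps del: binomial_Suc_Suc)
  also have "\<dots> \<le> 4 * (2 * real m + 1) * (2 * real m + 3) * 16 ^ m"
    by (intro mult_left_mono Suc) auto
  also have "\<dots> \<le> 4 * (4 * (real m + 1)\<^sup>2) * 16 ^ m"
    by (intro mult_right_mono) (auto simp: power2_eq_square algebra_simps)
  also have "\<dots> = (real m + 1)\<^sup>2 * 16 ^ Suc m" by simp
  finally show ?case
    by (subst (asm) mult_le_cancel_left_pos) (auto intro: zero_less_power)
qed simp

definition decay :: "nat \<Rightarrow> real" where
  "decay t = sqrt (1 / 2 ^ t)"

lemma decay_nonneg [simp]: "decay t \<ge> 0"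
  and decay_le_1: "decay t \<le> 1"
  by (auto simp: decay_def)

lemma pmf_walk_le: "pmf (walk n) c \<le> real (n choose (n div 2)) / 2 ^ n"
proof (cases "c \<in> range (\<lambda>k::nat. 2 * of_nat k - of_nat n)")
  case True
  then obtain k :: nat where c: "c = 2 * of_nat k - of_nat n" by auto
  have inj: "inj (\<lambda>k::nat. 2 * of_nat k - of_nat n :: complex)" by (auto simp: inj_on_def)
  have "pmf (walk n) c = pmf (binomial_pmf n (1/2)) k"
    unfolding walk_def c by (rule pmf_map_inj'[OF inj])
  also have "\<dots> = real (n choose k) / 2 ^ n"
  proof (cases "k \<le> n")
    case True
    then have "(1/2) ^ k * (1/2) ^ (n - k) = (1/2 :: real) ^ n" by (simp flip: power_add)
    then show ?thesis by (simp add: power_one_over field_simps mult.assoc)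
  qed (simp add: binomial_eq_0)
  also have "\<dots> \<le> real (n choose (n div 2)) / 2 ^ n"
    by (intro divide_right_mono) (simp_all add: binomial_maximum)
  finally show ?thesis .
next
  case False
  have "pmf (walk n) c = 0"
    unfolding walk_def by (rule pmf_map_outside) (use False in auto)
  then show ?thesis by simp
qed

lemma pmf_rad_le: "pmf (rad t) c \<le> decay t"
proof (cases t)
  case 0
  then show ?thesis by (simp add: decay_def pmf_le_1 del: rad.simps)
next
  case (Suc s)
  define m where "m = (2::nat) ^ s"
  have n: "2 ^ t = 2 * m" by (simp add: m_def Suc)
  let ?a = "real ((2 * m) choose m)"
  have "pmf (rad t) c \<le> ?a / 2 ^ (2 * m)"
    unfolding rad_eq_walk n using pmf_walk_le[of "2 * m" c] by simp
  also have "\<dots> = sqrt (?a\<^sup>2 / 16 ^ m)"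
    by (simp add: real_sqrt_divide power_mult real_sqrt_power flip: power_mult_distrib)
  also have "\<dots> \<le> sqrt (1 / 2 ^ t)"
  proof (rule real_sqrt_le_mono)
    have t: "(2::real) ^ t = 2 * real m" by (simp add: m_def Suc)
    have "?a\<^sup>2 * 2 ^ t \<le> ?a\<^sup>2 * (2 * real m + 1)" unfolding t by (intro mult_left_mono) auto
    also have "\<dots> \<le> 16 ^ m" by (rule central_binomial_sq)
    finally show "?a\<^sup>2 / 16 ^ m \<le> 1 / 2 ^ t" by (simp add: field_simps)
  qed
  finally show ?thesis by (simp add: decay_def)
qed

section \<open>Linear independence of rows on a set of columns\<close>

definition indep :: "'k set \<Rightarrow> ('k \<Rightarrow> 'a \<Rightarrow> complex) \<Rightarrow> 'a set \<Rightarrow> bool" where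
  "indep S g B \<longleftrightarrow> (\<forall>\<mu>. (\<forall>j\<in>B. (\<Sum>k\<in>S. \<mu> k * g k j) = 0) \<longrightarrow> (\<forall>k\<in>S. \<mu> k = 0))"

lemma indepD: "indep S g B \<Longrightarrow> (\<And>j. j \<in> B \<Longrightarrow> (\<Sum>k\<in>S. \<mu> k * g k j) = 0) \<Longrightarrow> k \<in> S \<Longrightarrow> \<mu> k = 0"
  unfolding indep_def by blast

lemma indep_subset:
  assumes "indep S g B" "S' \<subseteq> S" "finite S"
  shows "indep S' g B"
  unfolding indep_def
proof (intro allI impI ballI)
  fix \<mu> k assume *: "\<forall>j\<in>B. (\<Sum>k\<in>S'. \<mu> k * g k j) = 0" and "k \<in> S'"
  let ?\<mu> = "\<lambda>k. if k \<in> S' then \<mu> k else 0"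
  have "(\<Sum>k\<in>S. ?\<mu> k * g k j) = (\<Sum>k\<in>S'. \<mu> k * g k j)" for j
    by (rule sum.mono_neutral_cong_right) (use assms in auto)
  then have "?\<mu> k = 0"
    by (intro indepD[OF assms(1), of ?\<mu> k]) (use * \<open>k \<in> S'\<close> assms in auto)
  then show "\<mu> k = 0" using \<open>k \<in> S'\<close> by simp
qed

text \<open>Gaussian elimination: a relation among the cleared rows lifts to one among all rows,
  because the coefficient of row \<open>k\<close> is chosen to cancel column
  \<open>j\<close>.\<close>

lemma indep_pivot:
  assumes "indep (insert k S) g B" "finite S" "k \<notin> S"
  obtains j where "j \<in> B" "g k j \<noteq> 0"
    "indep S (\<lambda>s i. g s i - g s j / g k j * g k i) (B - {j})"
proof -
  have "\<exists>j\<in>B. g k j \<noteq> 0"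
  proof (rule ccontr)
    assume neg: "\<not> (\<exists>j\<in>B. g k j \<noteq> 0)"
    have "(if k = k then 1 else 0 :: complex) = 0"
    proof (rule indepD[OF assms(1), of "\<lambda>s. if s = k then 1 else 0"])
      fix j assume "j \<in> B"
      then show "(\<Sum>s\<in>insert k S. (if s = k then 1 else 0) * g s j) = 0"
        using neg assms(2) by (intro sum.neutral) auto
    qed simp
    then show False by simp
  qed
  then obtain j where j: "j \<in> B" "g k j \<noteq> 0" by blast
  have "indep S (\<lambda>s i. g s i - g s j / g k j * g k i) (B - {j})"
    unfolding indep_def
  proof (intro allI impI ballI)
    fix \<mu> s assume *: "\<forall>i\<in>B - {j}. (\<Sum>s\<in>S. \<mu> s * (g s i - g s j / g k j * g k i)) = 0" and s: "s \<in> S"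
    define \<nu> where "\<nu> = \<mu>(k := - (\<Sum>s\<in>S. \<mu> s * g s j) / g k j)"
    have exp: "(\<Sum>s\<in>insert k S. \<nu> s * g s i) = (\<Sum>s\<in>S. \<mu> s * (g s i - g s j / g k j * g k i))" for i
    proof -
      have "(\<Sum>s\<in>insert k S. \<nu> s * g s i) = \<nu> k * g k i + (\<Sum>s\<in>S. \<nu> s * g s i)"
        using assms by simp
      also have "(\<Sum>s\<in>S. \<nu> s * g s i) = (\<Sum>s\<in>S. \<mu> s * g s i)"
        by (rule sum.cong) (use assms in \<open>auto simp: \<nu>_def\<close>)
      also have "\<nu> k * g k i = - (\<Sum>s\<in>S. \<mu> s * g s j / g k j * g k i)"
        by (simp add: \<nu>_def sum_divide_distrib sum_distrib_right)
      finally show ?thesis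
        by (simp add: right_diff_distrib sum_subtractf mult.assoc)
    qed
    have "\<nu> s = 0"
    proof (rule indepD[OF assms(1)])
      fix i assume i: "i \<in> B"
      show "(\<Sum>s\<in>insert k S. \<nu> s * g s i) = 0"
        unfolding exp using * i j by (cases "i = j") (auto simp: sum.neutral)
    qed (use s in auto)
    then show "\<mu> s = 0" using s assms by (auto simp: \<nu>_def split: if_splits)
  qed
  then show ?thesis using that j by blast
qed

text \<open>Row rank equals column rank: the pivot columns carry an invertible square submatrix.
  Blocks can thus be kept small, which bounds the covers obtained from
  \<open>disjoint_or_cover\<close>.\<close>

lemma indep_shrink:
  assumes "finite S" "indep S g B"
  shows "\<exists>B'\<subseteq>B. finite B' \<and> card B' = card S \<and> indep S g B'"
  using assms
proof (induction S arbitrary: g B rule: finite_induct)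
  case empty
  then show ?case by (intro exI[of _ "{}"]) (auto simp: indep_def)
next
  case (insert k S)
  obtain j where j: "j \<in> B" "g k j \<noteq> 0"
    and ind: "indep S (\<lambda>s i. g s i - g s j / g k j * g k i) (B - {j})"
    using indep_pivot[OF insert.prems insert.hyps] by blast
  obtain B' where B': "B' \<subseteq> B - {j}" "finite B'" "card B' = card S"
    "indep S (\<lambda>s i. g s i - g s j / g k j * g k i) B'"
    using insert.IH[OF ind] by blast
  have "indep (insert k S) g (insert j B')"
    unfolding indep_def
  proof (intro allI impI)
    fix \<mu> assume *: "\<forall>i\<in>insert j B'. (\<Sum>s\<in>insert k S. \<mu> s * g s i) = 0"
    have k: "\<mu> k * g k i = - (\<Sum>s\<in>S. \<mu> s * g s i)" if "i \<in> insert j B'" for i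
      using bspec[OF * that] insert.hyps by (simp add: eq_neg_iff_add_eq_0)
    have muk: "\<mu> k = - (\<Sum>s\<in>S. \<mu> s * g s j) / g k j"
      using k[of j] j by (simp add: field_simps)
    have S: "\<mu> s = 0" if "s \<in> S" for s
    proof (rule indepD[OF B'(4)])
      fix i assume i: "i \<in> B'"
      have "(\<Sum>s\<in>S. \<mu> s * (g s i - g s j / g k j * g k i))
          = (\<Sum>s\<in>S. \<mu> s * g s i) - (\<Sum>s\<in>S. \<mu> s * g s j) / g k j * g k i"
        by (simp add: right_diff_distrib sum_subtractf sum_divide_distrib sum_distrib_right mult.assoc)
      also have "\<dots> = (\<Sum>s\<in>S. \<mu> s * g s i) + \<mu> k * g k i"
        unfolding muk by simp
      also have "\<dots> = 0" using k[of i] i by simp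
      finally show "(\<Sum>s\<in>S. \<mu> s * (g s i - g s j / g k j * g k i)) = 0" .
    qed (rule that)
    moreover have "\<mu> k = 0" unfolding muk by (simp add: S)
    ultimately show "\<forall>s\<in>insert k S. \<mu> s = 0" by simp
  qed
  moreover have "card (insert j B') = card (insert k S)"
    using B' insert.hyps by (auto simp: card_insert_if)
  ultimately show ?case using B' j by (intro exI[of _ "insert j B'"]) auto
qed

text \<open>Row \<open>k\<close> determines the pivot coordinate from the others, at a cost of
  \<open>decay t\<close>; substituting it into the other rows leaves the eliminated system on one
  column less.\<close>

lemma prb_indep_block:
  assumes "finite S" "finite B" "indep S g B"
  shows "prb (signs t B) (\<lambda>x. \<forall>k\<in>S. (\<Sum>j\<in>B. g k j * x j) = c k) \<le> decay t ^ card S"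
  using assms
proof (induction S arbitrary: g B c rule: finite_induct)
  case empty
  then show ?case by simp
next
  case (insert k S)
  obtain j where j: "j \<in> B" "g k j \<noteq> 0"
    and ind: "indep S (\<lambda>s i. g s i - g s j / g k j * g k i) (B - {j})"
    using indep_pivot[OF insert.prems(2) insert.hyps] by blast
  define B' where "B' = B - {j}"
  have B: "B = insert j B'" "j \<notin> B'" "finite B'" using j insert.prems by (auto simp: B'_def)
  let ?g = "\<lambda>s i. g s i - g s j / g k j * g k i"
  let ?c = "\<lambda>s. c s - g s j / g k j * c k"
  have split: "(\<Sum>i\<in>B. g s i * (x(j := a)) i) = g s j * a + (\<Sum>i\<in>B'. g s i * x i)" for s x a
  proof -
    have "(\<Sum>i\<in>B'. g s i * (x(j := a)) i) = (\<Sum>i\<in>B'. g s i * x i)"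
      by (rule sum.cong) (use B in auto)
    then show ?thesis unfolding B(1) using B by simp
  qed
  have "prb (signs t B) (\<lambda>x. \<forall>k\<in>insert k S. (\<Sum>j\<in>B. g k j * x j) = c k)
      = prb (pair_pmf (signs t B') (rad t))
          (\<lambda>(x, a). \<forall>s\<in>insert k S. (\<Sum>i\<in>B. g s i * (x(j := a)) i) = c s)"
    using prb_signs_insert[OF B(3,2), of t "\<lambda>x. \<forall>k\<in>insert k S. (\<Sum>j\<in>B. g k j * x j) = c k"]
    by (simp only: B(1)[symmetric])
  also have "\<dots> \<le> prb (pair_pmf (signs t B') (rad t))
      (\<lambda>(x, a). (\<forall>s\<in>S. (\<Sum>i\<in>B'. ?g s i * x i) = ?c s) \<and> a = (c k - (\<Sum>i\<in>B'. g k i * x i)) / g k j)"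
  proof (rule prb_mono, clarify)
    fix x a assume "\<forall>s\<in>insert k S. (\<Sum>i\<in>B. g s i * (x(j := a)) i) = c s"
    then have *: "g s j * a + (\<Sum>i\<in>B'. g s i * x i) = c s" if "s \<in> insert k S" for s
      using that unfolding split by blast
    have ak: "g k j * a = c k - (\<Sum>i\<in>B'. g k i * x i)" using *[of k] by (simp add: algebra_simps)
    have a: "a = (c k - (\<Sum>i\<in>B'. g k i * x i)) / g k j"
      using ak j by (simp add: field_simps)
    have "(\<Sum>i\<in>B'. ?g s i * x i) = ?c s" if "s \<in> S" for s
    proof -
      have "(\<Sum>i\<in>B'. ?g s i * x i) = (\<Sum>i\<in>B'. g s i * x i) - g s j / g k j * (\<Sum>i\<in>B'. g k i * x i)"
        by (simp add: left_diff_distrib sum_subtractf sum_distrib_left mult.assoc)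
      also have "(\<Sum>i\<in>B'. g k i * x i) = c k - g k j * a" using ak by simp
      also have "(\<Sum>i\<in>B'. g s i * x i) = c s - g s j * a" using *[of s] that by (simp add: algebra_simps)
      finally show ?thesis using j by (simp add: field_simps)
    qed
    then show "(\<forall>s\<in>S. (\<Sum>i\<in>B'. ?g s i * x i) = ?c s) \<and> a = (c k - (\<Sum>i\<in>B'. g k i * x i)) / g k j"
      using a by blast
  qed
  also have "\<dots> \<le> decay t * prb (signs t B') (\<lambda>x. \<forall>s\<in>S. (\<Sum>i\<in>B'. ?g s i * x i) = ?c s)"
    by (rule prb_pair_split) (simp_all add: pmf_rad_le measure_pmf_single)
  also have "\<dots> \<le> decay t * decay t ^ card S"
    by (intro mult_left_mono insert.IH) (use ind[folded B'_def] B(3) in auto)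
  finally show ?case using insert.hyps by simp
qed

section \<open>Halving families of blocks, and the Halasz-type bound\<close>

lemma card_split:
  assumes "finite I" "card I = 2 ^ Suc s"
  obtains I1 I2 where "I = I1 \<union> I2" "I1 \<inter> I2 = {}" "card I1 = 2 ^ s" "card I2 = 2 ^ s"
    "finite I1" "finite I2"
proof -
  obtain I1 where I1: "I1 \<subseteq> I" "card I1 = 2 ^ s"
    using obtain_subset_with_card_n[of "2 ^ s" I] assms(2) by auto
  have "card (I - I1) = 2 ^ s"
    using I1 assms by (subst card_Diff_subset) (auto intro: finite_subset)
  then show ?thesis using that[of I1 "I - I1"] I1 assms by (auto intro: finite_subset)
qed

text \<open>Each step halves the family of blocks and doubles the number of copies of each sign:
\<open>P(X + Y = c) \<le> max (P(X = X')) (P(Y = Y'))\<close>. After \<open>s\<close> steps a single block remains.\<close>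

lemma prb_blocks_le:
  assumes "finite I" "card I = 2 ^ s" "disjoint_family_on B I"
    and "\<And>i. i \<in> I \<Longrightarrow> finite (B i)"
    and "\<And>i c. i \<in> I \<Longrightarrow> prb (signs (t + s) (B i)) (\<lambda>x. \<forall>k\<in>S. (\<Sum>j\<in>B i. g k j * x j) = c k) \<le> \<theta>"
  shows "prb (signs t (\<Union>i\<in>I. B i)) (\<lambda>x. \<forall>k\<in>S. (\<Sum>j\<in>(\<Union>i\<in>I. B i). g k j * x j) = c k) \<le> \<theta>"
  using assms
proof (induction s arbitrary: I t c)
  case 0
  then obtain i where "I = {i}" by (auto simp: card_Suc_eq)
  then show ?case using "0.prems"(5)[of i] by simp
next
  case (Suc s)
  obtain I1 I2 where I: "I = I1 \<union> I2" "I1 \<inter> I2 = {}" "card I1 = 2 ^ s" "card I2 = 2 ^ s"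
    "finite I1" "finite I2"
    using card_split[OF Suc.prems(1,2)] by metis
  define W where "W J = (\<Union>i\<in>J. B i)" for J
  have fin: "finite (W I1)" "finite (W I2)" using I Suc.prems(4) by (auto simp: W_def)
  have disj: "W I1 \<inter> W I2 = {}"
  proof (rule equals0I)
    fix x assume "x \<in> W I1 \<inter> W I2"
    then obtain i1 i2 where "i1 \<in> I1" "i2 \<in> I2" "x \<in> B i1 \<inter> B i2" by (auto simp: W_def)
    moreover from this have "i1 \<noteq> i2" using I(2) by auto
    ultimately show False using disjoint_family_onD[OF Suc.prems(3), of i1 i2] I(1) by auto
  qed
  have WI: "W I = W I1 \<union> W I2" by (auto simp: W_def I(1))
  \<comment> \<open>Values outside \<open>S\<close> are set to 0, so that equality of functions
    expresses equality of all forms and \<open>prb_coincide_max\<close> applies to a single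
    map.\<close>
  define F where "F J x = (\<lambda>k. if k \<in> S then \<Sum>j\<in>W J. g k j * x j else 0)" for J and x :: "'b \<Rightarrow> complex"
  define c' where "c' = (\<lambda>k. if k \<in> S then c k else 0)"
  have IH: "prb (pair_pmf (signs t (W J)) (signs t (W J))) (\<lambda>(x, x'). F J x = F J x') \<le> \<theta>"
    if J: "J = I1 \<or> J = I2" for J
  proof -
    have Jp: "finite J" "card J = 2 ^ s" "J \<subseteq> I" "finite (W J)" using J I fin by auto
    have eq: "F J x = F J x' \<longleftrightarrow> (\<forall>k\<in>S. (\<Sum>j\<in>W J. g k j * (x j - x' j)) = 0)" for x x'
      by (auto simp: F_def fun_eq_iff right_diff_distrib sum_subtractf)
    \<comment> \<open>The difference of two independent copies has the law
      \<open>signs (Suc t)\<close>, and the prescribed values cancel to 0.\<close>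
    have "prb (pair_pmf (signs t (W J)) (signs t (W J))) (\<lambda>(x, x'). F J x = F J x')
        = prb (signs (Suc t) (W J)) (\<lambda>x. \<forall>k\<in>S. (\<Sum>j\<in>W J. g k j * x j) = 0)"
      unfolding signs_Suc[OF Jp(4)] prb_map eq by (simp add: case_prod_unfold)
    also have "\<dots> \<le> \<theta>"
      unfolding W_def
    proof (rule Suc.IH)
      show "disjoint_family_on B J" using Suc.prems(3) Jp(3) by (rule disjoint_family_on_mono[rotated])
      show "prb (signs (Suc t + s) (B i)) (\<lambda>x. \<forall>k\<in>S. (\<Sum>j\<in>B i. g k j * x j) = c k) \<le> \<theta>"
        if "i \<in> J" for i c
        using Suc.prems(5)[of i c] that Jp(3) by auto
    qed (use Jp Suc.prems(4) in auto)
    finally show ?thesis .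
  qed
  have "prb (signs t (W I)) (\<lambda>x. \<forall>k\<in>S. (\<Sum>j\<in>W I. g k j * x j) = c k)
      = prb (pair_pmf (signs t (W I1)) (signs t (W I2))) (\<lambda>(x, y). F I1 x = (\<lambda>k. c' k - F I2 y k))"
    unfolding WI prb_signs_union[OF fin disj] sum_union_mix[OF fin disj]
    by (intro arg_cong[where f = "measure_pmf.prob _"] Collect_cong)
       (auto simp: F_def c'_def fun_eq_iff algebra_simps)
  also have "\<dots> \<le> max (prb (pair_pmf (signs t (W I1)) (signs t (W I1))) (\<lambda>(x, x'). F I1 x = F I1 x'))
     (prb (pair_pmf (signs t (W I2)) (signs t (W I2)))
        (\<lambda>(y, y'). (\<lambda>k. c' k - F I2 y k) = (\<lambda>k. c' k - F I2 y' k)))"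
    by (rule prb_coincide_max) (use fin in \<open>auto intro: finite_set_signs\<close>)
  also have "\<dots> \<le> \<theta>"
    using IH[of I1] IH[of I2] by (simp add: fun_eq_iff)
  finally show ?case unfolding W_def .
qed

text \<open>With the variables outside the blocks frozen, \<open>prb_blocks_le\<close> trades the
  \<open>2 ^ t\<close> blocks for a single one whose coordinates have level \<open>t\<close>; there
  elimination gives a factor \<open>decay t\<close> for each form.\<close>

theorem halasz:
  assumes "finite U" "finite S" "finite I" "card I = 2 ^ t" "disjoint_family_on B I"
    and "\<And>i. i \<in> I \<Longrightarrow> B i \<subseteq> U" "\<And>i. i \<in> I \<Longrightarrow> indep S g (B i)"
  shows "prb (signs 0 U) (\<lambda>x. \<forall>k\<in>S. (\<Sum>j\<in>U. g k j * x j) = c k) \<le> decay t ^ card S"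
proof -
  define W where "W = (\<Union>i\<in>I. B i)"
  have W: "W \<subseteq> U" using assms(6) by (auto simp: W_def)
  have finW: "finite W" using W assms(1) by (rule finite_subset)
  show ?thesis
  proof (rule signs_subset_bound[OF assms(1) W])
    fix y :: "'a \<Rightarrow> complex"
    have sum: "(\<Sum>j\<in>U. g k j * (if j \<in> W then x j else y j))
        = (\<Sum>j\<in>W. g k j * x j) + (\<Sum>j\<in>U - W. g k j * y j)" for x k
      using sum_union_mix[of W "U - W" "g k" x y] finW assms(1) by (simp add: Un_absorb1[OF W])
    have "prb (signs 0 W) (\<lambda>x. \<forall>k\<in>S. (\<Sum>j\<in>U. g k j * (if j \<in> W then x j else y j)) = c k)
        = prb (signs 0 W) (\<lambda>x. \<forall>k\<in>S. (\<Sum>j\<in>W. g k j * x j) = c k - (\<Sum>j\<in>U - W. g k j * y j))"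
      unfolding sum by (simp add: algebra_simps)
    also have "\<dots> \<le> decay t ^ card S"
      unfolding W_def
    proof (rule prb_blocks_le)
      fix i c assume "i \<in> I"
      then show "prb (signs (0 + t) (B i)) (\<lambda>x. \<forall>k\<in>S. (\<Sum>j\<in>B i. g k j * x j) = c k) \<le> decay t ^ card S"
        using prb_indep_block[of S "B i" g t] assms finite_subset[of "B i" U] by simp
    qed (use assms finite_subset[of _ U] in auto)
    finally show "prb (signs 0 W) (\<lambda>x. \<forall>k\<in>S. (\<Sum>j\<in>U. g k j * (if j \<in> W then x j else y j)) = c k)
      \<le> decay t ^ card S" .
  qed simp
qed

section \<open>Quadratic polynomials\<close>

definition lin :: "'k set \<Rightarrow> ('k \<Rightarrow> complex) \<Rightarrow> ('k \<Rightarrow> complex) \<Rightarrow> complex" where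
  "lin G l p = (\<Sum>i\<in>G. l i * p i)"

lemma lin_add: "lin G l (\<lambda>i. p i + p' i) = lin G l p + lin G l p'"
  and lin_diff: "lin G l (\<lambda>i. p i - p' i) = lin G l p - lin G l p'"
  and lin_cmult: "lin G l (\<lambda>i. c * p i) = c * lin G l p"
  by (simp_all add: lin_def distrib_left right_diff_distrib sum.distrib sum_subtractf sum_distrib_left mult.left_commute)

lemma lin_nonzeroD: "lin G l p \<noteq> 0 \<Longrightarrow> \<exists>i\<in>G. l i \<noteq> 0"
  unfolding lin_def by (auto intro!: sum.neutral)

lemma lin_remove:
  assumes "finite G" "s \<in> G"
  shows "lin G l p = l s * p s + lin (G - {s}) l p"
  using assms by (simp add: lin_def sum.remove)

definition aff :: "'k set \<Rightarrow> (('k \<Rightarrow> complex) \<Rightarrow> complex) \<Rightarrow> bool" where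
  "aff G f \<longleftrightarrow> (\<exists>l \<gamma>. f = (\<lambda>p. lin G l p + \<gamma>))"

definition quad :: "'k set \<Rightarrow> (('k \<Rightarrow> complex) \<Rightarrow> complex) \<Rightarrow> bool" where
  "quad G q \<longleftrightarrow> (\<exists>\<beta> l \<gamma>. q = (\<lambda>p. (\<Sum>i\<in>G. \<Sum>j\<in>G. \<beta> i j * (p i * p j)) + lin G l p + \<gamma>))"

lemma affI: "(\<And>p. f p = lin G l p + \<gamma>) \<Longrightarrow> aff G f"
  unfolding aff_def by blast

lemma quadI: "(\<And>p. q p = (\<Sum>i\<in>G. \<Sum>j\<in>G. \<beta> i j * (p i * p j)) + lin G l p + \<gamma>) \<Longrightarrow> quad G q"
  unfolding quad_def by blast

lemma quad_aff: "aff G f \<Longrightarrow> quad G f"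
  unfolding aff_def by (elim exE, rule quadI[where \<beta> = "\<lambda>_ _. 0"]) (simp only:, simp)

lemma quad_const: "quad G (\<lambda>_. \<gamma>)"
  by (rule quad_aff, rule affI[where l = "\<lambda>_. 0" and \<gamma> = \<gamma>]) (simp add: lin_def)

lemma quad_add:
  assumes "quad G f" "quad G g" shows "quad G (\<lambda>p. f p + g p)"
proof -
  obtain \<beta> l \<gamma> where f: "f = (\<lambda>p. (\<Sum>i\<in>G. \<Sum>j\<in>G. \<beta> i j * (p i * p j)) + lin G l p + \<gamma>)"
    using assms(1) unfolding quad_def by blast
  obtain \<beta>' l' \<gamma>' where g: "g = (\<lambda>p. (\<Sum>i\<in>G. \<Sum>j\<in>G. \<beta>' i j * (p i * p j)) + lin G l' p + \<gamma>')"
    using assms(2) unfolding quad_def by blast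
  show ?thesis
    by (rule quadI[where \<beta> = "\<lambda>i j. \<beta> i j + \<beta>' i j" and l = "\<lambda>i. l i + l' i" and \<gamma> = "\<gamma> + \<gamma>'"])
       (simp add: f g lin_def distrib_right sum.distrib)
qed

lemma quad_cmult:
  assumes "quad G f" shows "quad G (\<lambda>p. c * f p)"
proof -
  obtain \<beta> l \<gamma> where f: "f = (\<lambda>p. (\<Sum>i\<in>G. \<Sum>j\<in>G. \<beta> i j * (p i * p j)) + lin G l p + \<gamma>)"
    using assms(1) unfolding quad_def by blast
  show ?thesis
    by (rule quadI[where \<beta> = "\<lambda>i j. c * \<beta> i j" and l = "\<lambda>i. c * l i" and \<gamma> = "c * \<gamma>"])
       (simp add: f lin_def distrib_left sum_distrib_left mult.assoc)
qed

lemma quad_sum: "finite S \<Longrightarrow> (\<And>s. s \<in> S \<Longrightarrow> quad G (f s)) \<Longrightarrow> quad G (\<lambda>p. \<Sum>s\<in>S. f s p)"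
  by (induction S rule: finite_induct) (auto intro: quad_add quad_const)

lemma quad_mult:
  assumes "aff G f" "aff G g" shows "quad G (\<lambda>p. f p * g p)"
proof -
  obtain l \<gamma> where f: "f = (\<lambda>p. lin G l p + \<gamma>)" using assms(1) unfolding aff_def by blast
  obtain l' \<gamma>' where g: "g = (\<lambda>p. lin G l' p + \<gamma>')" using assms(2) unfolding aff_def by blast
  have prod: "lin G l p * lin G l' p = (\<Sum>i\<in>G. \<Sum>j\<in>G. (l i * l' j) * (p i * p j))" for p
    unfolding lin_def sum_product by (intro sum.cong refl) (simp add: mult_ac)
  have "lin G (\<lambda>i. \<gamma>' * l i + \<gamma> * l' i) p = \<gamma>' * lin G l p + \<gamma> * lin G l' p" for p
    unfolding lin_def by (simp add: distrib_right sum.distrib sum_distrib_left mult.assoc)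
  then show ?thesis
    by (intro quadI[where \<beta> = "\<lambda>i j. l i * l' j" and l = "\<lambda>i. \<gamma>' * l i + \<gamma> * l' i" and \<gamma> = "\<gamma> * \<gamma>'"])
       (simp only: f g prod[symmetric], simp add: algebra_simps)
qed

lemma quad_subst:
  assumes "finite G" "quad G q" "\<And>i. i \<in> G \<Longrightarrow> aff H (\<alpha> i)"
  shows "quad H (\<lambda>p. q (\<lambda>i. \<alpha> i p))"
proof -
  obtain \<beta> l \<gamma> where q: "q = (\<lambda>p. (\<Sum>i\<in>G. \<Sum>j\<in>G. \<beta> i j * (p i * p j)) + lin G l p + \<gamma>)"
    using assms(2) unfolding quad_def by blast
  show ?thesis
    unfolding q lin_def
    by (intro quad_add quad_sum quad_cmult quad_mult quad_const assms quad_aff)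
qed

lemma quad_cong_val:
  assumes "quad G q" "\<And>i. i \<in> G \<Longrightarrow> p i = p' i"
  shows "q p = q p'"
proof -
  obtain \<beta> l \<gamma> where q: "q = (\<lambda>p. (\<Sum>i\<in>G. \<Sum>j\<in>G. \<beta> i j * (p i * p j)) + lin G l p + \<gamma>)"
    using assms(1) unfolding quad_def by blast
  show ?thesis unfolding q lin_def
    by (intro arg_cong2[where f = "(+)"] sum.cong refl) (use assms(2) in auto)
qed

lemma aff_coord:
  assumes "finite G" "i \<in> G" shows "aff G (\<lambda>p. p i + c)"
proof (rule affI)
  fix p :: "'a \<Rightarrow> complex"
  have "lin G (\<lambda>j. if j = i then 1 else 0) p = (\<Sum>j\<in>G. if j = i then p j else 0)"
    unfolding lin_def by (rule sum.cong) auto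
  also have "\<dots> = p i" using assms by simp
  finally show "p i + c = lin G (\<lambda>j. if j = i then 1 else 0) p + c" by simp
qed

lemma quad_shift:
  assumes "finite G" "quad G q" shows "quad G (\<lambda>p. q (\<lambda>i. p i + c i))"
  by (rule quad_subst[OF assms]) (rule aff_coord[OF assms(1)])

section \<open>The zero set of one quadratic polynomial\<close>

locale quadratic_polynomial =
  fixes G :: "'k set" and \<beta> :: "'k \<Rightarrow> 'k \<Rightarrow> complex" and l :: "'k \<Rightarrow> complex" and \<gamma> :: complex
  assumes finite_G: "finite G"
begin

definition Q2 :: "('k \<Rightarrow> complex) \<Rightarrow> complex" where
  "Q2 p = (\<Sum>i\<in>G. \<Sum>j\<in>G. \<beta> i j * (p i * p j))"

definition q :: "('k \<Rightarrow> complex) \<Rightarrow> complex" where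
  "q p = Q2 p + lin G l p + \<gamma>"

text \<open>\<open>lin G (grad u) p\<close> is the polar form of the quadratic part;
  \<open>\<beta>\<close> is not assumed symmetric, hence the two terms.\<close>

definition grad :: "('k \<Rightarrow> complex) \<Rightarrow> 'k \<Rightarrow> complex" where
  "grad u j = (\<Sum>i\<in>G. (\<beta> i j + \<beta> j i) * u i)"

lemma lin_grad: "lin G (grad u) p = (\<Sum>i\<in>G. \<Sum>j\<in>G. \<beta> i j * (u i * p j + u j * p i))"
proof -
  have "lin G (grad u) p = (\<Sum>j\<in>G. \<Sum>i\<in>G. (\<beta> i j + \<beta> j i) * u i * p j)"
    by (simp add: lin_def grad_def sum_distrib_right)
  also have "\<dots> = (\<Sum>j\<in>G. \<Sum>i\<in>G. \<beta> i j * (u i * p j)) + (\<Sum>j\<in>G. \<Sum>i\<in>G. \<beta> j i * (u i * p j))"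
    by (simp add: algebra_simps sum.distrib)
  also have "(\<Sum>j\<in>G. \<Sum>i\<in>G. \<beta> i j * (u i * p j)) = (\<Sum>i\<in>G. \<Sum>j\<in>G. \<beta> i j * (u i * p j))"
    by (rule sum.swap)
  finally show ?thesis by (simp add: algebra_simps sum.distrib)
qed

lemma grad_self: "lin G (grad v) v = 2 * Q2 v"
  unfolding lin_grad Q2_def sum_distrib_left by (intro sum.cong refl) (simp add: algebra_simps)

lemma Q2_add: "Q2 (\<lambda>i. p i + c * v i) = Q2 p + c * lin G (grad v) p + c\<^sup>2 * Q2 v"
proof -
  have "\<beta> i j * ((p i + c * v i) * (p j + c * v j))
      = \<beta> i j * (p i * p j) + c * (\<beta> i j * (v i * p j + v j * p i)) + c\<^sup>2 * (\<beta> i j * (v i * v j))" for i j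
    by (simp add: algebra_simps power2_eq_square)
  then show ?thesis
    unfolding lin_grad Q2_def by (simp only: sum.distrib sum_distrib_left)
qed

lemma q_add: "q (\<lambda>i. p i + c * v i) = q p + c * (lin G (grad v) p + lin G l v) + c\<^sup>2 * Q2 v"
  unfolding q_def Q2_add lin_add lin_cmult by (simp add: algebra_simps)

lemma polar: "lin G (grad u) p = q (\<lambda>i. p i + u i) - q p - q u + q (\<lambda>_. 0)"
proof -
  have "q (\<lambda>i. p i + 1 * u i) = q p + lin G (grad u) p + lin G l u + Q2 u"
    unfolding q_add by simp
  moreover have "q u = Q2 u + lin G l u + q (\<lambda>_. 0)"
    by (simp add: q_def Q2_def lin_def)
  ultimately show ?thesis by simp
qed

text \<open>If \<open>q\<close> is constant on a hyperplane \<open>h = c0\<close> with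
  \<open>h = grad u0\<close>, it factors as \<open>\<kappa> + (h - c0) * (\<psi> - a)\<close>. When
  \<open>\<psi>\<close> is a multiple of \<open>h\<close>, zeros of \<open>q\<close> lie on two
  parallel hyperplanes; otherwise \<open>h\<close> and \<open>\<psi>\<close> serve as the two forms
  of the second alternative. An affine \<open>q\<close> falls under the first alternative, and if no
  such hyperplane exists the second one is immediate.\<close>

lemma sections_nonconstant:
  assumes nonconst: "q p0 \<noteq> q p0'"
  shows "(\<exists>\<phi>1 \<phi>2 a1 a2. (\<exists>i\<in>G. \<phi>1 i \<noteq> 0) \<and> (\<exists>i\<in>G. \<phi>2 i \<noteq> 0) \<and>
            (\<forall>p. q p = 0 \<longrightarrow> lin G \<phi>1 p = a1 \<or> lin G \<phi>2 p = a2)) \<or>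
         (\<exists>\<phi>1 \<phi>2. (\<exists>i\<in>G. \<phi>1 i \<noteq> 0) \<and> (\<exists>i\<in>G. \<phi>2 i \<noteq> 0) \<and>
            (\<forall>u. lin G \<phi>1 u \<noteq> 0 \<and> lin G \<phi>2 u \<noteq> 0 \<longrightarrow> (\<exists>i\<in>G. grad u i \<noteq> 0) \<and>
               (\<forall>c. \<exists>p p'. lin G (grad u) p = c \<and> lin G (grad u) p' = c \<and> q p \<noteq> q p')))"
    (is "?A \<or> ?B")
proof (cases "\<exists>u. \<exists>j\<in>G. grad u j \<noteq> 0")
  case False
  have "Q2 v = 0" for v
    using False grad_self[of v] by (simp add: lin_def sum.neutral)
  then have q: "q p = lin G l p + \<gamma>" for p by (simp add: q_def)
  have "lin G l p0 \<noteq> lin G l p0'" using nonconst q by simp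
  then have "lin G l (\<lambda>i. p0 i - p0' i) \<noteq> 0" unfolding lin_diff by simp
  then have "\<exists>i\<in>G. l i \<noteq> 0" by (rule lin_nonzeroD)
  moreover have "\<forall>p. q p = 0 \<longrightarrow> lin G l p = - \<gamma> \<or> lin G l p = - \<gamma>"
    by (simp add: q eq_neg_iff_add_eq_0)
  ultimately have ?A by blast
  then show ?thesis ..
next
  case True
  then obtain u1 j1 where j1: "j1 \<in> G" "grad u1 j1 \<noteq> 0" by blast
  show ?thesis
  proof (cases "\<forall>u. (\<exists>i\<in>G. grad u i \<noteq> 0) \<longrightarrow>
      (\<forall>c. \<exists>p p'. lin G (grad u) p = c \<and> lin G (grad u) p' = c \<and> q p \<noteq> q p')")
    case True
    \<comment> \<open>A component of the gradient that is not identically zero detects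
      \<open>grad u \<noteq> 0\<close>; it serves as both forms.\<close>
    define \<phi> where "\<phi> i = \<beta> i j1 + \<beta> j1 i" for i
    have \<phi>: "lin G \<phi> u = grad u j1" for u by (simp add: lin_def grad_def \<phi>_def)
    have "\<exists>i\<in>G. \<phi> i \<noteq> 0" using j1 \<phi> lin_nonzeroD[of G \<phi> u1] by simp
    moreover have "\<exists>i\<in>G. grad u i \<noteq> 0" if "lin G \<phi> u \<noteq> 0" for u using that j1 \<phi> by auto
    ultimately have ?B using True by (intro exI[of _ \<phi>]) blast
    then show ?thesis ..
  next
    case False
    then obtain u0 s c0 where s: "s \<in> G" "grad u0 s \<noteq> 0"
      and const: "\<And>p p'. lin G (grad u0) p = c0 \<Longrightarrow> lin G (grad u0) p' = c0 \<Longrightarrow> q p = q p'"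
      by blast
    define h where "h = grad u0"
    \<comment> \<open>A direction with \<open>h = 1\<close>: translation along \<open>p1\<close>
      moves any point onto \<open>h = c0\<close>, where \<open>q\<close> equals
      \<open>\<kappa>\<close>, and expanding \<open>q\<close> along this translation yields the
      factorisation \<open>F\<close>.\<close>
    define p1 where "p1 i = (if i = s then 1 / h s else 0)" for i
    have "lin G h p1 = (\<Sum>i\<in>G. if i = s then 1 else 0)"
      unfolding lin_def by (rule sum.cong) (use s in \<open>auto simp: p1_def h_def\<close>)
    then have hp1: "lin G h p1 = 1" using s finite_G by simp
    define \<kappa> where "\<kappa> = q (\<lambda>i. c0 * p1 i)"
    have on: "q p = \<kappa>" if "lin G h p = c0" for p
      unfolding \<kappa>_def using const[of p "\<lambda>i. c0 * p1 i"] that by (simp add: lin_cmult hp1 flip: h_def)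
    define \<psi> where "\<psi> j = grad p1 j - Q2 p1 * h j" for j
    define a where "a = - (lin G l p1 + Q2 p1 * c0)"
    have lin\<psi>: "lin G \<psi> p = lin G (grad p1) p - Q2 p1 * lin G h p" for p
      by (simp add: lin_def \<psi>_def left_diff_distrib sum_subtractf sum_distrib_left mult.assoc)
    have F: "q p = \<kappa> + (lin G h p - c0) * (lin G \<psi> p - a)" for p
    proof -
      define \<tau> where "\<tau> = lin G h p - c0"
      have "lin G h (\<lambda>i. p i + (- \<tau>) * p1 i) = c0"
        unfolding lin_add lin_cmult hp1 by (simp add: \<tau>_def)
      then have "\<kappa> = q (\<lambda>i. p i + (- \<tau>) * p1 i)" using on by simp
      also have "\<dots> = q p - \<tau> * (lin G (grad p1) p + lin G l p1) + \<tau>\<^sup>2 * Q2 p1"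
        unfolding q_add by simp
      finally have "q p = \<kappa> + \<tau> * (lin G (grad p1) p + lin G l p1 - \<tau> * Q2 p1)"
        by (simp add: algebra_simps power2_eq_square)
      also have "lin G (grad p1) p + lin G l p1 - \<tau> * Q2 p1 = lin G \<psi> p - a"
        unfolding lin\<psi> a_def \<tau>_def by (simp add: algebra_simps)
      finally show ?thesis by (simp add: \<tau>_def)
    qed
    have pol: "lin G (grad u) p = lin G h u * lin G \<psi> p + lin G h p * lin G \<psi> u" for u p
    proof -
      have z: "lin G f (\<lambda>_. 0) = 0" for f by (simp add: lin_def)
      show ?thesis unfolding polar F lin_add z by (simp add: algebra_simps)
    qed
    define m where "m = lin G \<psi> p1"
    show ?thesis
    proof (cases "\<forall>p. lin G \<psi> p = m * lin G h p")
      case True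
      \<comment> \<open>If \<open>m = 0\<close> then \<open>\<psi>\<close> vanishes identically, and
        with it the polar form, although \<open>grad u0\<close> takes the value 1 at
        \<open>p1\<close>.\<close>
      have "m \<noteq> 0"
      proof
        assume "m = 0"
        then have "lin G (grad u0) p1 = 0" unfolding pol using True by simp
        then show False using hp1 by (simp add: h_def)
      qed
      \<comment> \<open>As a polynomial in H = \<open>lin G h p\<close>, \<open>q\<close> is
        \<open>m * H\<^sup>2 + B * H + \<kappa> + a * c0\<close>; its complex roots are
        \<open>r1\<close> and \<open>r2\<close>.\<close>
      define B where "B = - (a + m * c0)"
      define D where "D = csqrt (B\<^sup>2 - 4 * m * (\<kappa> + a * c0))"
      define r1 where "r1 = (- B + D) / (2 * m)"
      define r2 where "r2 = (- B - D) / (2 * m)"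
      have D2: "D\<^sup>2 = B\<^sup>2 - 4 * m * (\<kappa> + a * c0)" by (simp add: D_def)
      have fac: "4 * m * (\<kappa> + (H - c0) * (m * H - a)) = (2 * m * H - (- B + D)) * (2 * m * H - (- B - D))" for H
      proof -
        have "(2 * m * H - (- B + D)) * (2 * m * H - (- B - D)) = (2 * m * H + B)\<^sup>2 - D\<^sup>2"
          by (simp add: power2_eq_square algebra_simps)
        also have "\<dots> = 4 * m * (\<kappa> + (H - c0) * (m * H - a))"
          unfolding D2 B_def by (simp add: power2_eq_square algebra_simps)
        finally show ?thesis ..
      qed
      have "lin G h p = r1 \<or> lin G h p = r2" if "q p = 0" for p
      proof -
        have "(2 * m * lin G h p - (- B + D)) * (2 * m * lin G h p - (- B - D)) = 0"
          unfolding fac[symmetric] using that F[of p] True by simp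
        then have "2 * m * lin G h p = - B + D \<or> 2 * m * lin G h p = - B - D" by auto
        then show ?thesis unfolding r1_def r2_def using \<open>m \<noteq> 0\<close> by (auto simp: field_simps)
      qed
      moreover have "\<exists>i\<in>G. h i \<noteq> 0" using s by (auto simp: h_def)
      ultimately have ?A by blast
      then show ?thesis ..
    next
      case False
      then obtain p2 where p2: "lin G \<psi> p2 \<noteq> m * lin G h p2" by blast
      define w where "w = lin G \<psi> p2 - m * lin G h p2"
      have w: "w \<noteq> 0" using p2 by (simp add: w_def)
      \<comment> \<open>\<open>e1\<close> and \<open>e2\<close> are dual to \<open>h\<close> and
        \<open>\<psi>\<close>. Below, \<open>P t\<close> runs through a line in the hyperplane where
        \<open>grad u\<close> takes the value \<open>c\<close>, parametrised by the value of
        \<open>h\<close>.\<close>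
      define e2 where "e2 i = (1 / w) * (p2 i - lin G h p2 * p1 i)" for i
      have e2: "lin G h e2 = 0" "lin G \<psi> e2 = 1"
        unfolding e2_def lin_cmult lin_diff using w by (simp_all add: hp1 w_def m_def[symmetric] algebra_simps)
      define e1 where "e1 i = p1 i - m * e2 i" for i
      have e1: "lin G h e1 = 1" "lin G \<psi> e1 = 0"
        unfolding e1_def lin_diff lin_cmult e2 by (simp_all add: hp1 m_def)
      have "(\<exists>i\<in>G. grad u i \<noteq> 0) \<and>
         (\<forall>c. \<exists>p p'. lin G (grad u) p = c \<and> lin G (grad u) p' = c \<and> q p \<noteq> q p')"
        if u: "lin G h u \<noteq> 0" "lin G \<psi> u \<noteq> 0" for u
      proof (intro conjI allI)
        have "lin G (grad u) e2 \<noteq> 0" unfolding pol e2 using u by simp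
        then show "\<exists>i\<in>G. grad u i \<noteq> 0" by (rule lin_nonzeroD)
        fix c
        define H where "H = lin G h u"
        define \<Psi> where "\<Psi> = lin G \<psi> u"
        have nz: "H \<noteq> 0" "\<Psi> \<noteq> 0" using u by (auto simp: H_def \<Psi>_def)
        define P where "P t = (\<lambda>i. t * e1 i + (c - \<Psi> * t) / H * e2 i)" for t
        have P: "lin G h (P t) = t" "lin G \<psi> (P t) = (c - \<Psi> * t) / H" for t
          unfolding P_def lin_add lin_cmult e1 e2 by simp_all
        have Pc: "lin G (grad u) (P t) = c" for t
          unfolding pol P H_def[symmetric] \<Psi>_def[symmetric] using nz by (simp add: field_simps)
        have qP: "q (P t) = \<kappa> + (t - c0) * ((c - \<Psi> * t) / H - a)" for t
          unfolding F P ..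
        define X where "X t = (c - \<Psi> * t) / H - a" for t
        have qX: "q (P t) = \<kappa> + (t - c0) * X t" for t unfolding qP X_def ..
        \<comment> \<open>Along the line \<open>q\<close> is quadratic in \<open>t\<close> with
          leading coefficient \<open>- \<Psi> / H\<close>. Equal values at these three points would
          make the nonconstant affine \<open>X\<close> vanish twice.\<close>
        have "\<not> (q (P (c0 + 1)) = q (P c0) \<and> q (P (c0 + 2)) = q (P c0))"
        proof
          assume *: "q (P (c0 + 1)) = q (P c0) \<and> q (P (c0 + 2)) = q (P c0)"
          then have "X (c0 + 1) = 0" "X (c0 + 2) = 0"
            unfolding qX by simp_all
          then have "c - \<Psi> * (c0 + 1) = c - \<Psi> * (c0 + 2)"
            using nz by (simp add: X_def field_simps)
          then show False using nz by simp
        qed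
        then show "\<exists>p p'. lin G (grad u) p = c \<and> lin G (grad u) p' = c \<and> q p \<noteq> q p'"
          using Pc by blast
      qed
      moreover have "\<exists>i\<in>G. h i \<noteq> 0" "\<exists>i\<in>G. \<psi> i \<noteq> 0"
        using lin_nonzeroD[of G h e1] lin_nonzeroD[of G \<psi> e2] e1 e2 by auto
      ultimately have ?B by blast
      then show ?thesis ..
    qed
  qed
qed

end

text \<open>In the second case the decoupled equation \<open>q (p + u) = q p\<close> cuts out a hyperplane on which \<open>q\<close> is still not
constant, so that no information is lost, unless \<open>u\<close> lies in one of two hyperplanes.\<close>

lemma quad_dichotomy:
  assumes "finite G" "quad G q" "q p0 \<noteq> q p0'"
  obtains (planes) \<phi>1 \<phi>2 a1 a2 where "\<exists>i\<in>G. \<phi>1 i \<noteq> 0" "\<exists>i\<in>G. \<phi>2 i \<noteq> 0"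
            "\<And>p. q p = 0 \<Longrightarrow> lin G \<phi>1 p = a1 \<or> lin G \<phi>2 p = a2"
  | (sections) \<phi>1 \<phi>2 where "\<exists>i\<in>G. \<phi>1 i \<noteq> 0" "\<exists>i\<in>G. \<phi>2 i \<noteq> 0"
      "\<And>u. lin G \<phi>1 u \<noteq> 0 \<Longrightarrow> lin G \<phi>2 u \<noteq> 0 \<Longrightarrow>
         \<exists>h \<kappa>. (\<exists>i\<in>G. h i \<noteq> 0) \<and> (\<forall>p. q (\<lambda>i. p i + u i) - q p = lin G h p - \<kappa>) \<and>
           (\<forall>c. \<exists>p p'. lin G h p = c \<and> lin G h p' = c \<and> q p \<noteq> q p')"
proof -
  obtain \<beta> l \<gamma> where q: "q = (\<lambda>p. (\<Sum>i\<in>G. \<Sum>j\<in>G. \<beta> i j * (p i * p j)) + lin G l p + \<gamma>)"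
    using assms(2) unfolding quad_def by blast
  interpret quadratic_polynomial G \<beta> l \<gamma> by unfold_locales (rule assms(1))
  have qq: "q = quadratic_polynomial.q G \<beta> l \<gamma>"
    by (simp add: fun_eq_iff q q_def Q2_def)
  have diff: "q (\<lambda>i. p i + u i) - q p = lin G (grad u) p - (q (\<lambda>_. 0) - q u)" for u p
    using polar[of u p] by (simp add: qq)
  note nc = assms(3)
  from sections_nonconstant[OF nc[unfolded qq]] show ?thesis
  proof (elim disjE exE conjE, goal_cases)
    case (1 \<phi>1 \<phi>2 a1 a2)
    show ?thesis by (rule planes[of \<phi>1 \<phi>2 a1 a2]) (use 1 qq in auto)
  next
    case (2 \<phi>1 \<phi>2)
    show ?thesis
    proof (rule sections[of \<phi>1 \<phi>2])
      fix u assume "lin G \<phi>1 u \<noteq> 0" "lin G \<phi>2 u \<noteq> 0"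
      then show "\<exists>h \<kappa>. (\<exists>i\<in>G. h i \<noteq> 0) \<and> (\<forall>p. q (\<lambda>i. p i + u i) - q p = lin G h p - \<kappa>) \<and>
           (\<forall>c. \<exists>p p'. lin G h p = c \<and> lin G h p' = c \<and> q p \<noteq> q p')"
        using 2(3) diff by (intro exI[of _ "grad u"] exI[of _ "q (\<lambda>_. 0) - q u"]) (simp add: qq)
    qed (use 2 in auto)
  qed
qed

section \<open>Quadratic polynomials in robustly independent linear forms\<close>

definition fv :: "('k \<Rightarrow> 'a \<Rightarrow> complex) \<Rightarrow> 'a set \<Rightarrow> ('a \<Rightarrow> complex) \<Rightarrow> 'k \<Rightarrow> complex" where
  "fv g U x = (\<lambda>s. \<Sum>j\<in>U. g s j * x j)"

definition mix :: "'a set \<Rightarrow> ('a \<Rightarrow> 'b) \<Rightarrow> ('a \<Rightarrow> 'b) \<Rightarrow> 'a \<Rightarrow> 'b" where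
  "mix Y y z = (\<lambda>i. if i \<in> Y then y i else z i)"

text \<open>The hypothesis of \<open>halasz\<close>; a power of two as the number of blocks allows
  repeated halving.\<close>

definition robust :: "nat \<Rightarrow> 'k set \<Rightarrow> ('k \<Rightarrow> 'a \<Rightarrow> complex) \<Rightarrow> 'a set \<Rightarrow> bool" where
  "robust t S g U \<longleftrightarrow> (\<exists>(I :: nat set) B. finite I \<and> card I = 2 ^ t \<and> disjoint_family_on B I \<and>
     (\<forall>i\<in>I. B i \<subseteq> U \<and> indep S g (B i)))"

lemma fv_mix:
  assumes "finite Y" "finite Z" "Y \<inter> Z = {}"
  shows "fv g (Y \<union> Z) (mix Y y z) s = fv g Y y s + fv g Z z s"
  unfolding fv_def mix_def by (rule sum_union_mix[OF assms])

lemma robust_halasz: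
  assumes "finite U" "finite S" "robust t S g U"
  shows "prb (signs 0 U) (\<lambda>x. \<forall>s\<in>S. fv g U x s = c s) \<le> decay t ^ card S"
proof -
  obtain I :: "nat set" and B where I: "finite I" "card I = 2 ^ t" "disjoint_family_on B I"
    "\<And>i. i \<in> I \<Longrightarrow> B i \<subseteq> U" "\<And>i. i \<in> I \<Longrightarrow> indep S g (B i)"
    using assms(3) unfolding robust_def by blast
  show ?thesis unfolding fv_def by (rule halasz[OF assms(1,2) I])
qed

lemma robust_mono:
  assumes "robust t S g U" "S' \<subseteq> S" "finite S"
  shows "robust t S' g U"
  using assms indep_subset[OF _ assms(2,3)] unfolding robust_def by meson

text \<open>Half of the blocks go to each side. The lost level costs only a constant factor, by
  \<open>decay_sq_Suc\<close>.\<close>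

lemma robust_split:
  assumes "finite U" "robust (Suc t) S g U"
  obtains Y Z where "U = Y \<union> Z" "Y \<inter> Z = {}" "finite Y" "finite Z" "robust t S g Y" "robust t S g Z"
proof -
  obtain I :: "nat set" and B where I: "finite I" "card I = 2 ^ Suc t" "disjoint_family_on B I"
    "\<And>i. i \<in> I \<Longrightarrow> B i \<subseteq> U" "\<And>i. i \<in> I \<Longrightarrow> indep S g (B i)"
    using assms(2) unfolding robust_def by blast
  obtain I1 I2 where II: "I = I1 \<union> I2" "I1 \<inter> I2 = {}" "card I1 = 2 ^ t" "card I2 = 2 ^ t"
    "finite I1" "finite I2"
    using card_split[OF I(1,2)] by metis
  define Z where "Z = (\<Union>i\<in>I1. B i)"
  define Y where "Y = U - Z"
  have Z: "Z \<subseteq> U" using I(4) II(1) by (auto simp: Z_def)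
  have BY: "B i \<subseteq> Y" if "i \<in> I2" for i
  proof -
    have "B i \<inter> B i' = {}" if "i' \<in> I1" for i'
      using disjoint_family_onD[OF I(3), of i i'] that \<open>i \<in> I2\<close> II by auto
    then show ?thesis using I(4)[of i] that II(1) by (auto simp: Y_def Z_def)
  qed
  have dis: "disjoint_family_on B I1" "disjoint_family_on B I2"
    using I(3) II(1) by (auto intro: disjoint_family_on_mono)
  have "robust t S g Z"
    unfolding robust_def using II I(5) dis(1) by (intro exI[of _ I1] exI[of _ B]) (auto simp: Z_def)
  moreover have "robust t S g Y"
    unfolding robust_def using II I(5) dis(2) BY by (intro exI[of _ I2] exI[of _ B]) blast
  moreover have "finite Y" "finite Z" using Z assms(1) by (auto simp: Y_def intro: finite_subset)
  ultimately show ?thesis using that[of Y Z] Z by (auto simp: Y_def)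
qed

text \<open>Exchanging row \<open>s0\<close> for a combination in which it has a nonzero coefficient
  is an invertible change of rows; \<open>\<nu>\<close> is the transformed coefficient
  vector.\<close>

lemma indep_replace:
  assumes ind: "indep (G \<union> L) g B" and fin: "finite G" "finite L" and disj: "G \<inter> L = {}"
    and s0: "s0 \<in> G" "\<phi> s0 \<noteq> 0"
  shows "indep (G \<union> L) (g(s0 := \<lambda>j. lin G \<phi> (\<lambda>s. g s j))) B"
    (is "indep _ ?g B")
  unfolding indep_def
proof (intro allI impI)
  fix \<mu> assume *: "\<forall>j\<in>B. (\<Sum>k\<in>G \<union> L. \<mu> k * ?g k j) = 0"
  define \<nu> where "\<nu> k = (if k \<in> G then (if k = s0 then 0 else \<mu> k) + \<mu> s0 * \<phi> k else \<mu> k)" for k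
  have eq: "(\<Sum>k\<in>G \<union> L. \<mu> k * ?g k j) = (\<Sum>k\<in>G \<union> L. \<nu> k * g k j)" for j
  proof -
    have "(\<Sum>k\<in>G. \<mu> k * ?g k j) = \<mu> s0 * lin G \<phi> (\<lambda>s. g s j) + (\<Sum>k\<in>G. (if k = s0 then 0 else \<mu> k) * g k j)"
    proof -
      have "(\<Sum>k\<in>G. \<mu> k * ?g k j)
        = \<mu> s0 * lin G \<phi> (\<lambda>s. g s j) + (\<Sum>k\<in>G - {s0}. \<mu> k * ?g k j)"
        using fin(1) s0(1) by (simp add: sum.remove)
      also have "(\<Sum>k\<in>G - {s0}. \<mu> k * ?g k j) = (\<Sum>k\<in>G - {s0}. (if k = s0 then 0 else \<mu> k) * g k j)"
        by (rule sum.cong) auto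
      also have "\<dots> = (\<Sum>k\<in>G. (if k = s0 then 0 else \<mu> k) * g k j)"
        using fin(1) s0(1) by (simp add: sum.remove[of G s0])
      finally show ?thesis .
    qed
    also have "\<dots> = (\<Sum>k\<in>G. \<nu> k * g k j)"
      by (simp add: \<nu>_def lin_def sum_distrib_left distrib_right sum.distrib mult.assoc)
    finally have "(\<Sum>k\<in>G. \<mu> k * ?g k j) = (\<Sum>k\<in>G. \<nu> k * g k j)" .
    moreover have "(\<Sum>k\<in>L. \<mu> k * ?g k j) = (\<Sum>k\<in>L. \<nu> k * g k j)"
      by (rule sum.cong) (use disj s0 in \<open>auto simp: \<nu>_def\<close>)
    ultimately show ?thesis using fin disj by (simp add: sum.union_disjoint)
  qed
  have \<nu>: "\<nu> k = 0" if "k \<in> G \<union> L" for k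
    by (rule indepD[OF ind]) (use * that in \<open>auto simp: eq[symmetric]\<close>)
  have "\<nu> s0 = \<mu> s0 * \<phi> s0" using s0 by (simp add: \<nu>_def)
  then have "\<mu> s0 = 0" using \<nu>[of s0] s0 by simp
  then have "\<nu> k = \<mu> k" for k by (auto simp: \<nu>_def)
  then show "\<forall>k\<in>G \<union> L. \<mu> k = 0" using \<nu> by simp
qed

lemma robust_replace:
  assumes "robust t (G \<union> L) g U" "finite G" "finite L" "G \<inter> L = {}" "s0 \<in> G" "\<phi> s0 \<noteq> 0"
  shows "robust t (G \<union> L) (g(s0 := \<lambda>j. lin G \<phi> (\<lambda>s. g s j))) U"
  using assms(1) indep_replace[where G = G and L = L and g = g and ?s0.0 = s0 and \<phi> = \<phi>, OF _ assms(2-6)]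
  unfolding robust_def by meson

lemma fv_replace:
  "fv (g(s0 := \<lambda>j. lin G \<phi> (\<lambda>s. g s j))) U x s = (if s = s0 then lin G \<phi> (fv g U x) else fv g U x s)"
proof -
  have "(\<Sum>j\<in>U. lin G \<phi> (\<lambda>s. g s j) * x j) = lin G \<phi> (fv g U x)"
    unfolding fv_def lin_def sum_distrib_left sum_distrib_right
    by (subst sum.swap) (simp add: mult.assoc)
  then show ?thesis by (simp add: fv_def)
qed

text \<open>The combination takes the place of a form of \<open>G\<close> that occurs in it, and the
  rest of \<open>G\<close> is discarded; \<open>card L + 1\<close> robust forms remain.\<close>

lemma robust_extra_form:
  assumes rob: "robust t (G \<union> L) g U" and fin: "finite U" "finite G" "finite L" and disj: "G \<inter> L = {}"
    and \<phi>: "\<exists>i\<in>G. \<phi> i \<noteq> 0"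
  shows "prb (signs 0 U) (\<lambda>x. (\<forall>s\<in>L. fv g U x s = c s) \<and> lin G \<phi> (fv g U x) = a) \<le> decay t ^ Suc (card L)"
proof -
  obtain s0 where s0: "s0 \<in> G" "\<phi> s0 \<noteq> 0" using \<phi> by blast
  let ?g = "g(s0 := \<lambda>j. lin G \<phi> (\<lambda>s. g s j))"
  have s0L: "s0 \<notin> L" using s0 disj by auto
  have rob': "robust t (insert s0 L) ?g U"
    by (rule robust_mono[OF robust_replace[where ?s0.0 = s0 and \<phi> = \<phi>, OF rob]]) (use fin disj s0 in auto)
  have "prb (signs 0 U) (\<lambda>x. (\<forall>s\<in>L. fv g U x s = c s) \<and> lin G \<phi> (fv g U x) = a)
      = prb (signs 0 U) (\<lambda>x. \<forall>s\<in>insert s0 L. fv ?g U x s = (c(s0 := a)) s)"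
    by (rule prb_cong) (use s0L in \<open>auto simp: fv_replace\<close>)
  also have "\<dots> \<le> decay t ^ card (insert s0 L)"
    by (rule robust_halasz) (use fin rob' in auto)
  finally show ?thesis using s0L fin by simp
qed

text \<open>\<open>N\<close> is the agreement of \<open>z\<close> and \<open>z'\<close> forced by
  the old linear equations; \<open>Bad\<close> collects the pairs for which subtracting the two
  quadratic equations yields no useful new form. On those the weaker bound \<open>p2\<close> is
  compensated by their small probability \<open>\<rho>\<close>.\<close>

lemma signs_decouple:
  assumes fin: "finite Y" "finite Z" "Y \<inter> Z = {}"
    and step: "\<And>z z'. prb (signs 0 Y) (\<lambda>y. Ev (mix Y y z) \<and> Ev (mix Y y z'))
         \<le> (if N z z' then if Bad z z' then p2 else p1 else 0)"
    and N: "\<And>z'. prb (signs 0 Z) (\<lambda>z. N z z') \<le> \<alpha>"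
    and bad: "\<And>z'. prb (signs 0 Z) (\<lambda>z. N z z' \<and> Bad z z') \<le> \<rho>"
    and nonneg: "p1 \<ge> 0" "p2 \<ge> 0"
  shows "(prb (signs 0 (Y \<union> Z)) Ev)\<^sup>2 \<le> p1 * \<alpha> + p2 * \<rho>"
proof -
  let ?Y = "signs 0 Y" and ?Z = "signs 0 Z"
  have \<alpha>\<rho>: "\<alpha> \<ge> 0" "\<rho> \<ge> 0" using N[of undefined] bad[of undefined]
    by (auto intro: order_trans[OF measure_nonneg])
  let ?E = "\<lambda>(z, z') y. Ev (mix Y y z) \<and> Ev (mix Y y z')"
  have part: "prb (pair_pmf (pair_pmf ?Z ?Z) ?Y) (\<lambda>(w, y). R (fst w) (snd w) \<and> ?E w y) \<le> p * r"
    if "\<And>z z'. R z z' \<Longrightarrow> prb ?Y (\<lambda>y. Ev (mix Y y z) \<and> Ev (mix Y y z')) \<le> p"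
      "\<And>z'. prb ?Z (\<lambda>z. R z z') \<le> r" "p \<ge> 0" "r \<ge> 0" for R p r
  proof -
    have "prb (pair_pmf (pair_pmf ?Z ?Z) ?Y) (\<lambda>(w, y). R (fst w) (snd w) \<and> ?E w y)
        \<le> p * prb (pair_pmf ?Z ?Z) (\<lambda>w. R (fst w) (snd w))"
      by (rule prb_pair_split) (use that in auto)
    also have "prb (pair_pmf ?Z ?Z) (\<lambda>w. R (fst w) (snd w)) = prb (pair_pmf ?Z ?Z) (\<lambda>(z, z'). R z z')"
      by (simp add: case_prod_unfold)
    also have "p * \<dots> \<le> p * r"
      by (intro mult_left_mono prb_pair_le') (use that in auto)
    finally show ?thesis .
  qed
  have "prb (signs 0 (Y \<union> Z)) Ev = prb (pair_pmf ?Y ?Z) (\<lambda>(y, z). Ev (mix Y y z))"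
    unfolding mix_def by (rule prb_signs_union[OF fin])
  then have "(prb (signs 0 (Y \<union> Z)) Ev)\<^sup>2
      \<le> prb (pair_pmf (pair_pmf ?Z ?Z) ?Y) (\<lambda>((z, z'), y). Ev (mix Y y z) \<and> Ev (mix Y y z'))"
    using prb_decouple[of ?Y ?Z "\<lambda>y z. Ev (mix Y y z)"] by simp
  also have "\<dots> \<le> prb (pair_pmf (pair_pmf ?Z ?Z) ?Y)
     (\<lambda>v. ((\<lambda>(w, y). (N (fst w) (snd w) \<and> \<not> Bad (fst w) (snd w)) \<and> ?E w y) v \<or>
          (\<lambda>(w, y). (N (fst w) (snd w) \<and> Bad (fst w) (snd w)) \<and> ?E w y) v) \<or>
          (\<lambda>(w, y). \<not> N (fst w) (snd w) \<and> ?E w y) v)"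
    by (rule prb_mono) auto
  also have "\<dots> \<le> (p1 * \<alpha> + p2 * \<rho>) + 0 * 1"
  proof (rule order_trans[OF prb_disj add_mono], rule order_trans[OF prb_disj add_mono])
    show "prb (pair_pmf (pair_pmf ?Z ?Z) ?Y)
      (\<lambda>(w, y). (N (fst w) (snd w) \<and> \<not> Bad (fst w) (snd w)) \<and> ?E w y) \<le> p1 * \<alpha>"
    proof (rule part)
      show "prb ?Z (\<lambda>z. N z z' \<and> \<not> Bad z z') \<le> \<alpha>" for z'
        by (rule order_trans[OF prb_mono N[of z']]) auto
      show "prb ?Y (\<lambda>y. Ev (mix Y y z) \<and> Ev (mix Y y z')) \<le> p1" if "N z z' \<and> \<not> Bad z z'" for z z'
        using step[of z z'] that by simp
    qed (use nonneg \<alpha>\<rho> in auto)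
    show "prb (pair_pmf (pair_pmf ?Z ?Z) ?Y)
      (\<lambda>(w, y). (N (fst w) (snd w) \<and> Bad (fst w) (snd w)) \<and> ?E w y) \<le> p2 * \<rho>"
    proof (rule part)
      show "prb ?Y (\<lambda>y. Ev (mix Y y z) \<and> Ev (mix Y y z')) \<le> p2" if "N z z' \<and> Bad z z'" for z z'
        using step[of z z'] that by simp
    qed (use nonneg \<alpha>\<rho> bad in auto)
    show "prb (pair_pmf (pair_pmf ?Z ?Z) ?Y) (\<lambda>(w, y). \<not> N (fst w) (snd w) \<and> ?E w y) \<le> 0 * 1"
    proof (rule part)
      show "prb ?Y (\<lambda>y. Ev (mix Y y z) \<and> Ev (mix Y y z')) \<le> 0" if "\<not> N z z'" for z z'
        using step[of z z'] that by simp
    qed auto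
  qed
  finally show ?thesis by simp
qed

lemma decay_sq_Suc: "(decay t)\<^sup>2 = 2 * (decay (Suc t))\<^sup>2"
  by (simp add: decay_def)

text \<open>The quadratic equation costs as much as one more linear form. Decoupling yields a
  hyperplane in the values of \<open>G\<close> on which \<open>q\<close> is still nonconstant, so
  one form moves from \<open>G\<close> to \<open>L\<close> and \<open>d\<close> drops. Good pairs
  contribute the exponent (k + 2) + k and bad pairs (k + 1) + (k + 1); both are twice the target, so
  the square root loses nothing.\<close>

theorem quadric_anticoncentration:
  "\<exists>C\<ge>1. \<forall>t (U :: 'a set) (G :: 'k set) L g c q p0 p0'.
     finite U \<longrightarrow> finite G \<longrightarrow> finite L \<longrightarrow> G \<inter> L = {} \<longrightarrow> card G = d \<longrightarrow> card L = k \<longrightarrow>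
     quad G q \<longrightarrow> q p0 \<noteq> q p0' \<longrightarrow> robust t (G \<union> L) g U \<longrightarrow>
     prb (signs 0 U) (\<lambda>x. (\<forall>s\<in>L. fv g U x s = c s) \<and> q (fv g U x) = 0) \<le> C * decay t ^ Suc k"
proof (induction d arbitrary: k)
  case 0
  have False if "quad G q" "q p0 \<noteq> q p0'" "finite G" "card G = 0" for G :: "'k set" and q p0 p0'
    using quad_cong_val[OF that(1), of p0 p0'] that by auto
  then show ?case by (intro exI[of _ 1]) blast
next
  case (Suc d)
  obtain C' where C': "C' \<ge> 1" and IH: "\<And>t (U :: 'a set) (G :: 'k set) L g c q p0 p0'.
     finite U \<Longrightarrow> finite G \<Longrightarrow> finite L \<Longrightarrow> G \<inter> L = {} \<Longrightarrow> card G = d \<Longrightarrow> card L = Suc k \<Longrightarrow>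
     quad G q \<Longrightarrow> q p0 \<noteq> q p0' \<Longrightarrow> robust t (G \<union> L) g U \<Longrightarrow>
     prb (signs 0 U) (\<lambda>x. (\<forall>s\<in>L. fv g U x s = c s) \<and> q (fv g U x) = 0) \<le> C' * decay t ^ Suc (Suc k)"
    using Suc.IH[of "Suc k"] by blast
  \<comment> \<open>Chosen so that \<open>2 ^ Suc k * (C' + 2 * C) \<le> C * C\<close>, which closes
    the squared recursion.\<close>
  define C where "C = 2 ^ Suc k * (C' + 2)"
  have "(1::real) \<le> 2 ^ Suc k" by (rule one_le_power) simp
  then have "1 * 2 \<le> 2 ^ Suc k * (C' + 2)"
    by (rule mult_mono) (use C' in auto)
  then have C2: "C \<ge> 2" by (simp add: C_def)
  have main: "prb (signs 0 U) (\<lambda>x. (\<forall>s\<in>L. fv g U x s = c s) \<and> q (fv g U x) = 0) \<le> C * decay t ^ Suc k"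
    if asm: "finite U" "finite G" "finite L" "G \<inter> L = {}" "card G = Suc d" "card L = k"
     "quad G q" "q p0 \<noteq> q p0'" "robust t (G \<union> L) g U"
    for t and U :: "'a set" and G :: "'k set" and L g c q p0 p0'
    using asm
  \<comment> \<open>The inner induction serves the bad pairs, for which the same statement is used
    at level \<open>t\<close> after dropping the equation at \<open>z'\<close>.\<close>
  proof (induction t arbitrary: U g c q p0 p0')
    case 0
    have "prb (signs 0 U) (\<lambda>x. (\<forall>s\<in>L. fv g U x s = c s) \<and> q (fv g U x) = 0) \<le> 1" by simp
    also have "1 \<le> C * decay 0 ^ Suc k" using C2 by (simp add: decay_def)
    finally show ?case .
  next
    case (Suc t)
    note fin = Suc.prems(1-3) and disj = Suc.prems(4)
    let ?D = "decay t"
    show ?case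
    proof (rule quad_dichotomy[where q = q and ?p0.0 = p0 and p0' = p0', OF fin(2) Suc.prems(7,8)])
      fix \<phi>1 \<phi>2 a1 a2
      assume nz: "\<exists>i\<in>G. \<phi>1 i \<noteq> 0" "\<exists>i\<in>G. \<phi>2 i \<noteq> 0"
        and zero: "\<And>p. q p = 0 \<Longrightarrow> lin G \<phi>1 p = a1 \<or> lin G \<phi>2 p = a2"
      have "prb (signs 0 U) (\<lambda>x. (\<forall>s\<in>L. fv g U x s = c s) \<and> q (fv g U x) = 0)
         \<le> prb (signs 0 U) (\<lambda>x. ((\<forall>s\<in>L. fv g U x s = c s) \<and> lin G \<phi>1 (fv g U x) = a1) \<or>
            ((\<forall>s\<in>L. fv g U x s = c s) \<and> lin G \<phi>2 (fv g U x) = a2))"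
        by (rule prb_mono) (auto dest!: zero)
      also have "\<dots> \<le> decay (Suc t) ^ Suc (card L) + decay (Suc t) ^ Suc (card L)"
        by (rule order_trans[OF prb_disj add_mono]; rule robust_extra_form) (use Suc.prems nz in auto)
      also have "\<dots> = 2 * decay (Suc t) ^ Suc k" using Suc.prems by simp
      also have "\<dots> \<le> C * decay (Suc t) ^ Suc k"
        by (rule mult_right_mono) (use C2 in auto)
      finally show ?thesis .
    next
      fix \<phi>1 \<phi>2
      assume nz: "\<exists>i\<in>G. \<phi>1 i \<noteq> 0" "\<exists>i\<in>G. \<phi>2 i \<noteq> 0"
        and sec: "\<And>u. lin G \<phi>1 u \<noteq> 0 \<Longrightarrow> lin G \<phi>2 u \<noteq> 0 \<Longrightarrow>
         \<exists>h \<kappa>. (\<exists>i\<in>G. h i \<noteq> 0) \<and> (\<forall>p. q (\<lambda>i. p i + u i) - q p = lin G h p - \<kappa>) \<and>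
           (\<forall>c. \<exists>p p'. lin G h p = c \<and> lin G h p' = c \<and> q p \<noteq> q p')"
      obtain Y Z where YZ: "U = Y \<union> Z" "Y \<inter> Z = {}" "finite Y" "finite Z"
        "robust t (G \<union> L) g Y" "robust t (G \<union> L) g Z"
        using robust_split[OF fin(1) Suc.prems(9)] by metis
      define Ev where "Ev x \<longleftrightarrow> (\<forall>s\<in>L. fv g U x s = c s) \<and> q (fv g U x) = 0" for x
      define N where "N z z' \<longleftrightarrow> (\<forall>s\<in>L. fv g Z z s = fv g Z z' s)" for z z'
      define Bad where "Bad z z' \<longleftrightarrow> lin G \<phi>1 (\<lambda>i. fv g Z z i - fv g Z z' i) = 0 \<or>
        lin G \<phi>2 (\<lambda>i. fv g Z z i - fv g Z z' i) = 0" for z z'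
      have Ev: "Ev (mix Y y z) \<longleftrightarrow> (\<forall>s\<in>L. fv g Y y s + fv g Z z s = c s) \<and> q (\<lambda>s. fv g Y y s + fv g Z z s) = 0"
        for y z
        unfolding Ev_def YZ(1) by (simp add: fv_mix[OF YZ(3,4,2)] ext[OF fv_mix[OF YZ(3,4,2)]])
      have N: "prb (signs 0 Z) (\<lambda>z. N z z') \<le> ?D ^ k" for z'
        using robust_halasz[OF YZ(4) fin(3) robust_mono[OF YZ(6)], of "fv g Z z'"] fin Suc.prems(6)
        by (simp add: N_def)
      have bad: "prb (signs 0 Z) (\<lambda>z. N z z' \<and> Bad z z') \<le> 2 * ?D ^ Suc k" for z'
      proof -
        have "prb (signs 0 Z) (\<lambda>z. N z z' \<and> Bad z z')
          \<le> prb (signs 0 Z) (\<lambda>z. ((\<forall>s\<in>L. fv g Z z s = fv g Z z' s) \<and> lin G \<phi>1 (fv g Z z) = lin G \<phi>1 (fv g Z z')) \<or>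
             ((\<forall>s\<in>L. fv g Z z s = fv g Z z' s) \<and> lin G \<phi>2 (fv g Z z) = lin G \<phi>2 (fv g Z z')))"
          by (rule prb_mono) (auto simp: N_def Bad_def lin_diff)
        also have "\<dots> \<le> ?D ^ Suc (card L) + ?D ^ Suc (card L)"
          by (rule order_trans[OF prb_disj add_mono]; rule robust_extra_form)
             (use Suc.prems nz YZ in auto)
        finally show ?thesis using Suc.prems(6) by simp
      qed
      have step: "prb (signs 0 Y) (\<lambda>y. Ev (mix Y y z) \<and> Ev (mix Y y z'))
         \<le> (if N z z' then if Bad z z' then C * ?D ^ Suc k else C' * ?D ^ Suc (Suc k) else 0)" for z z'
      proof -
        consider "\<not> N z z'" | "N z z'" "Bad z z'" | "N z z'" "\<not> Bad z z'" by blast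
        then show ?thesis
        proof cases
          case 1
          have "\<not> (Ev (mix Y y z) \<and> Ev (mix Y y z'))" for y
          proof
            assume ev: "Ev (mix Y y z) \<and> Ev (mix Y y z')"
            have "fv g Z z s = fv g Z z' s" if "s \<in> L" for s
            proof -
              have "fv g Y y s + fv g Z z s = c s" "fv g Y y s + fv g Z z' s = c s"
                using ev that unfolding Ev by auto
              then show ?thesis by (metis add_left_imp_eq)
            qed
            then show False using 1 unfolding N_def by simp
          qed
          then have "{y. Ev (mix Y y z) \<and> Ev (mix Y y z')} = {}" by blast
          then show ?thesis using 1 by (simp only: measure_empty if_False)
        next
          case 2
          have q': "quad G (\<lambda>p. q (\<lambda>s. p s + fv g Z z s))"
            using quad_shift[OF fin(2) Suc.prems(7)] .
          have "prb (signs 0 Y) (\<lambda>y. Ev (mix Y y z) \<and> Ev (mix Y y z'))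
            \<le> prb (signs 0 Y) (\<lambda>y. (\<forall>s\<in>L. fv g Y y s = c s - fv g Z z s) \<and> q (\<lambda>s. fv g Y y s + fv g Z z s) = 0)"
            by (rule prb_mono) (auto simp: Ev algebra_simps)
          also have "\<dots> \<le> C * ?D ^ Suc k"
            by (rule Suc.IH[where U = Y and q = "\<lambda>p. q (\<lambda>s. p s + fv g Z z s)"
                and ?p0.0 = "\<lambda>s. p0 s - fv g Z z s" and p0' = "\<lambda>s. p0' s - fv g Z z s"])
               (use YZ Suc.prems q' in auto)
          finally show ?thesis using 2 by simp
        next
          case 3
          define u where "u i = fv g Z z i - fv g Z z' i" for i
          obtain h \<kappa> where h: "\<exists>i\<in>G. h i \<noteq> 0"
            and h\<kappa>: "\<And>p. q (\<lambda>i. p i + u i) - q p = lin G h p - \<kappa>"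
            and hnc: "\<And>c. \<exists>p p'. lin G h p = c \<and> lin G h p' = c \<and> q p \<noteq> q p'"
            using sec[of u] 3 unfolding Bad_def u_def by blast
          obtain s0 where s0: "s0 \<in> G" "h s0 \<noteq> 0" using h by blast
          obtain P P' where P: "lin G h P = \<kappa>" "lin G h P' = \<kappa>" "q P \<noteq> q P'" using hnc by blast
          define G' where "G' = G - {s0}"
          define L' where "L' = insert s0 L"
          define g' where "g' = g(s0 := \<lambda>j. lin G h (\<lambda>s. g s j))"
          define c0 where "c0 = \<kappa> - lin G h (fv g Z z')"
          define c' where "c' s = (if s = s0 then c0 else c s - fv g Z z' s)" for s
          \<comment> \<open>On the hyperplane the coordinate \<open>s0\<close> is a function of the
            others, so \<open>q\<close> becomes a quadratic polynomial in \<open>G'\<close>. The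
            values at \<open>z'\<close> are added back because \<open>q\<close> is evaluated on
            \<open>y\<close> and \<open>z'\<close> together.\<close>
          define \<alpha> where "\<alpha> s p = (if s = s0 then (c0 - lin G' h p) / h s0 + fv g Z z' s0 else p s + fv g Z z' s)"
            for s and p :: "'k \<Rightarrow> complex"
          define q' where "q' p = q (\<lambda>s. \<alpha> s p)" for p
          have s0L: "s0 \<notin> L" using s0 disj by auto
          have fG': "finite G'" "finite L'" "G' \<inter> L' = {}" "card G' = d" "card L' = Suc k" "G' \<union> L' = G \<union> L"
            using fin disj s0 s0L Suc.prems(5,6) by (auto simp: G'_def L'_def)
          have aff: "aff G' (\<alpha> s)" if "s \<in> G" for s
          proof (cases "s = s0")
            case True
            show ?thesis
            proof (rule affI)
              fix p :: "'k \<Rightarrow> complex"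
              have "lin G' (\<lambda>i. - h i / h s0) p = - (lin G' h p / h s0)"
                by (simp add: lin_def sum_divide_distrib sum_negf)
              then show "\<alpha> s p = lin G' (\<lambda>i. - h i / h s0) p + (c0 / h s0 + fv g Z z' s0)"
                using True by (simp add: \<alpha>_def diff_divide_distrib)
            qed
          next
            case False
            then show ?thesis
              using aff_coord[OF fG'(1), of s "fv g Z z' s"] that by (simp add: \<alpha>_def[abs_def] G'_def)
          qed
          have quad': "quad G' q'"
            unfolding q'_def by (rule quad_subst[OF fin(2) Suc.prems(7) aff])
          have q'P: "q' (\<lambda>s. p s - fv g Z z' s) = q p" if "lin G h p = \<kappa>" for p
            unfolding q'_def
          proof (rule quad_cong_val[OF Suc.prems(7)])
            fix s assume "s \<in> G"
            have "lin G h (\<lambda>s. p s - fv g Z z' s) = c0" unfolding lin_diff that c0_def ..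
            then have "c0 - lin G' h (\<lambda>s. p s - fv g Z z' s) = h s0 * (p s0 - fv g Z z' s0)"
              using lin_remove[OF fin(2) s0(1), of h "\<lambda>s. p s - fv g Z z' s"]
              by (metis add_diff_cancel_right' G'_def)
            then show "\<alpha> s (\<lambda>s. p s - fv g Z z' s) = p s"
              using s0 by (simp add: \<alpha>_def)
          qed
          have nc: "q' (\<lambda>s. P s - fv g Z z' s) \<noteq> q' (\<lambda>s. P' s - fv g Z z' s)"
            using q'P P by simp
          have rob: "robust t (G' \<union> L') g' Y"
            unfolding fG'(6) g'_def 
            by (rule robust_replace[where \<phi> = h, OF YZ(5) fin(2,3) disj s0])
          have "prb (signs 0 Y) (\<lambda>y. Ev (mix Y y z) \<and> Ev (mix Y y z'))
            \<le> prb (signs 0 Y) (\<lambda>y. (\<forall>s\<in>L'. fv g' Y y s = c' s) \<and> q' (fv g' Y y) = 0)"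
          proof (rule prb_mono)
            fix y assume ev: "Ev (mix Y y z) \<and> Ev (mix Y y z')"
            define p where "p s = fv g Y y s + fv g Z z' s" for s
            have qp: "q p = 0" using ev unfolding Ev p_def by simp
            have "q (\<lambda>i. p i + u i) = 0" using ev unfolding Ev p_def u_def by simp
            then have lp: "lin G h p = \<kappa>" using h\<kappa>[of p] qp by simp
            then have "lin G h (fv g Y y) + lin G h (fv g Z z') = \<kappa>"
              unfolding p_def lin_add .
            then have ly: "lin G h (fv g Y y) = c0" by (simp add: c0_def algebra_simps)
            have "fv g' Y y s = c' s" if "s \<in> L'" for s
            proof (cases "s = s0")
              case True
              then show ?thesis unfolding g'_def fv_replace c'_def using ly by simp
            next
              case False
              then have "fv g Y y s + fv g Z z' s = c s" using ev that unfolding Ev L'_def by simp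
              then show ?thesis unfolding g'_def fv_replace c'_def using False by (simp add: algebra_simps)
            qed
            moreover have "q' (fv g' Y y) = q' (\<lambda>s. p s - fv g Z z' s)"
              by (rule quad_cong_val[OF quad']) (simp add: G'_def g'_def fv_replace p_def)
            ultimately show "(\<forall>s\<in>L'. fv g' Y y s = c' s) \<and> q' (fv g' Y y) = 0"
              using q'P[OF lp] qp by simp
          qed
          also have "\<dots> \<le> C' * ?D ^ Suc (Suc k)"
            by (rule IH[where q = q' and c = c' and g = g' and ?p0.0 = "\<lambda>s. P s - fv g Z z' s" and p0' = "\<lambda>s. P' s - fv g Z z' s",
                OF YZ(3) fG'(1-5) quad' nc rob])
          finally show ?thesis using 3 by simp
        qed
      qed
      have "(prb (signs 0 U) Ev)\<^sup>2 \<le> C' * ?D ^ Suc (Suc k) * ?D ^ k + C * ?D ^ Suc k * (2 * ?D ^ Suc k)"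
        unfolding YZ(1) by (rule signs_decouple[OF YZ(3,4,2) step N bad]) (use C' C2 in auto)
      also have "\<dots> = (C' + 2 * C) * (?D\<^sup>2) ^ Suc k"
        by (simp add: algebra_simps power2_eq_square power_mult_distrib flip: power_add)
      also have "\<dots> = 2 ^ Suc k * (C' + 2 * C) * ((decay (Suc t))\<^sup>2) ^ Suc k"
        unfolding decay_sq_Suc[of t] power_mult_distrib by simp
      also have "\<dots> \<le> C * C * ((decay (Suc t))\<^sup>2) ^ Suc k"
      proof (rule mult_right_mono)
        have "C' + 2 * C \<le> C * (C' + 2)"
          using mult_right_mono[of 1 C C'] C2 C' by (simp add: algebra_simps)
        then have "2 ^ Suc k * (C' + 2 * C) \<le> 2 ^ Suc k * (C * (C' + 2))"
          by (rule mult_left_mono) simp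
        also have "\<dots> = C * C" by (simp add: C_def mult_ac)
        finally show "2 ^ Suc k * (C' + 2 * C) \<le> C * C" .
      qed simp
      also have "\<dots> = (C * decay (Suc t) ^ Suc k)\<^sup>2"
        by (simp add: power2_eq_square power_mult_distrib mult_ac)
      finally have "prb (signs 0 U) Ev \<le> C * decay (Suc t) ^ Suc k"
        by (rule power2_le_imp_le) (use C2 in auto)
      then show ?thesis unfolding Ev_def .
    qed
  qed
  show ?case
    by (intro exI[of _ C] conjI allI impI main) (use C2 in auto)
qed

section \<open>Sparse digraphs and forms of bounded rank\<close>

text \<open>Greedy packing: if a disjoint family of small sets cannot be extended, its union meets
  every set with \<open>P\<close>.\<close>

lemma disjoint_or_cover:
  assumes "finite V" and shrink: "\<And>B. B \<subseteq> V \<Longrightarrow> P B \<Longrightarrow> \<exists>B'\<subseteq>B. P B' \<and> card B' \<le> K"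
  shows "(\<exists>F :: nat \<Rightarrow> 'a set. disjoint_family_on F {..<M} \<and> (\<forall>i<M. F i \<subseteq> V \<and> P (F i) \<and> card (F i) \<le> K)) \<or>
         (\<exists>S\<subseteq>V. card S \<le> M * K \<and> (\<forall>B\<subseteq>V - S. \<not> P B))"
proof (induction M)
  case 0
  show ?case by (auto simp: disjoint_family_on_def)
next
  case (Suc M)
  then show ?case
  proof
    assume "\<exists>S\<subseteq>V. card S \<le> M * K \<and> (\<forall>B\<subseteq>V - S. \<not> P B)"
    then show ?thesis by (metis le_add2 le_trans mult_Suc)
  next
    assume "\<exists>F :: nat \<Rightarrow> 'a set. disjoint_family_on F {..<M} \<and> (\<forall>i<M. F i \<subseteq> V \<and> P (F i) \<and> card (F i) \<le> K)"
    then obtain F :: "nat \<Rightarrow> 'a set" where F: "disjoint_family_on F {..<M}"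
      "\<And>i. i < M \<Longrightarrow> F i \<subseteq> V \<and> P (F i) \<and> card (F i) \<le> K" by blast
    define S where "S = (\<Union>i<M. F i)"
    have S: "S \<subseteq> V" using F(2) by (auto simp: S_def)
    have "card S \<le> (\<Sum>i<M. card (F i))" unfolding S_def by (rule card_UN_le) simp
    also have "\<dots> \<le> (\<Sum>i<M. K)" by (rule sum_mono) (use F in auto)
    finally have cS: "card S \<le> Suc M * K" by simp
    show ?thesis
    proof (cases "\<exists>B\<subseteq>V - S. P B")
      case False
      then show ?thesis using S cS by blast
    next
      case True
      then obtain B where B: "B \<subseteq> V - S" "P B" "card B \<le> K" using shrink by (meson Diff_subset order_trans)
      define F' where "F' = F(M := B)"
      have "disjoint_family_on F' {..<Suc M}"
        unfolding disjoint_family_on_def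
      proof (intro ballI impI)
        fix m n assume *: "m \<in> {..<Suc M}" "n \<in> {..<Suc M}" "m \<noteq> n"
        have "F i \<inter> B = {}" if "i < M" for i using B(1) that by (auto simp: S_def)
        then show "F' m \<inter> F' n = {}"
          using * disjoint_family_onD[OF F(1), of m n] by (auto simp: F'_def less_Suc_eq)
      qed
      moreover have "\<forall>i<Suc M. F' i \<subseteq> V \<and> P (F' i) \<and> card (F' i) \<le> K"
        using F(2) B by (auto simp: F'_def less_Suc_eq)
      ultimately show ?thesis by blast
    qed
  qed
qed

lemma card_disjoint_hits:
  assumes "disjoint_family_on F I" "finite W" "finite I"
  shows "card {e\<in>I. F e \<inter> W \<noteq> {}} \<le> card W"
proof -
  define E where "E = {e\<in>I. F e \<inter> W \<noteq> {}}"
  define f where "f e = (SOME w. w \<in> F e \<inter> W)" for e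
  have f: "f e \<in> F e \<inter> W" if "e \<in> E" for e
    unfolding f_def by (rule someI_ex) (use that in \<open>auto simp: E_def\<close>)
  have "inj_on f E"
  proof (rule inj_onI)
    fix x y assume *: "x \<in> E" "y \<in> E" "f x = f y"
    then have "F x \<inter> F y \<noteq> {}" using f[of x] f[of y] by auto
    then show "x = y" using disjoint_family_onD[OF assms(1), of x y] * by (auto simp: E_def)
  qed
  then have "card E \<le> card W" by (rule card_inj_on_le) (use f assms in auto)
  then show ?thesis by (simp add: E_def)
qed

text \<open>In-degrees average at most \<open>d\<close>, so some vertex has at most
  \<open>2 * d\<close> neighbours in both directions together. Keep it, delete those neighbours, and
  recurse.\<close>

lemma sparse_digraph_independent:
  assumes "finite X" "\<And>x. x \<in> X \<Longrightarrow> card {y\<in>X. R x y} \<le> d"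
  shows "\<exists>Y\<subseteq>X. card X \<le> (2 * d + 1) * card Y \<and> (\<forall>x\<in>Y. \<forall>y\<in>Y. x \<noteq> y \<longrightarrow> \<not> R x y)"
  using assms
proof (induction X rule: finite_psubset_induct)
  case (psubset X)
  show ?case
  proof (cases "X = {}")
    case False
    have "(\<Sum>x\<in>X. card {y\<in>X. R y x}) = (\<Sum>y\<in>X. card {x\<in>X. R y x})"
      unfolding card_eq_sum sum.inter_filter[OF psubset.hyps(1)] by (rule sum.swap)
    also have "\<dots> \<le> (\<Sum>y\<in>X. d)" by (rule sum_mono) (use psubset.prems in auto)
    finally have tot: "(\<Sum>x\<in>X. card {y\<in>X. R y x}) \<le> (\<Sum>x\<in>X. d)" .
    have "\<exists>x\<in>X. card {y\<in>X. R y x} \<le> d"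
    proof (rule ccontr)
      assume "\<not> ?thesis"
      then have "(\<Sum>x\<in>X. d) < (\<Sum>x\<in>X. card {y\<in>X. R y x})"
        by (intro sum_strict_mono) (use psubset.hyps False in auto)
      then show False using tot by simp
    qed
    then obtain x where x: "x \<in> X" "card {y\<in>X. R y x} \<le> d" by blast
    define W where "W = {x} \<union> ({y\<in>X. R x y} \<union> {y\<in>X. R y x})"
    have "card W \<le> card {x} + (card {y\<in>X. R x y} + card {y\<in>X. R y x})"
      unfolding W_def by (intro order_trans[OF card_Un_le] add_left_mono card_Un_le)
    then have W: "card W \<le> 2 * d + 1" using x psubset.prems[of x] by simp
    have Wsub: "W \<subseteq> X" using x by (auto simp: W_def)
    have "X - W \<subset> X" using x by (auto simp: W_def)
    moreover have "card {y\<in>X - W. R z y} \<le> d" if "z \<in> X - W" for z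
      by (rule order_trans[OF card_mono psubset.prems[of z]]) (use that psubset.hyps in auto)
    ultimately obtain Y where Y: "Y \<subseteq> X - W" "card (X - W) \<le> (2 * d + 1) * card Y"
      "\<forall>x\<in>Y. \<forall>y\<in>Y. x \<noteq> y \<longrightarrow> \<not> R x y"
      using psubset.IH[of "X - W"] by blast
    have finY: "finite Y" using Y(1) psubset.hyps by (meson finite_Diff finite_subset)
    have "x \<notin> Y" using Y(1) by (auto simp: W_def)
    then have cY: "card (insert x Y) = Suc (card Y)" using finY by simp
    have "card X = card W + card (X - W)"
      using Wsub psubset.hyps by (metis card_Diff_subset card_mono finite_subset le_add_diff_inverse)
    also have "\<dots> \<le> (2 * d + 1) * card (insert x Y)" unfolding cY using W Y(2) by simp
    finally have "card X \<le> (2 * d + 1) * card (insert x Y)" .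
    moreover have "\<forall>u\<in>insert x Y. \<forall>v\<in>insert x Y. u \<noteq> v \<longrightarrow> \<not> R u v"
    proof (intro ballI impI)
      fix u v assume uv: "u \<in> insert x Y" "v \<in> insert x Y" "u \<noteq> v"
      have "\<not> R x y \<and> \<not> R y x" if "y \<in> Y" for y using Y(1) that by (auto simp: W_def)
      then show "\<not> R u v" using uv Y(3) by auto
    qed
    moreover have "insert x Y \<subseteq> X" using x Y(1) by auto
    ultimately show ?thesis by (intro exI[of _ "insert x Y"]) blast
  qed auto
qed

text \<open>First \<open>T\<close> disjoint nonzero entries are found whose two ends do not
  conflict; then conflicts between different edges are removed. An edge excludes at most
  \<open>2 * D\<close> others, so a fraction \<open>1 / (4 * D + 1)\<close> of the edges
  survives.\<close>

lemma sparse_avoiding_matching: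
  fixes A :: "nat \<Rightarrow> nat \<Rightarrow> complex"
  assumes fin: "finite V" "V \<noteq> {}"
    and S: "\<And>j. j \<in> V \<Longrightarrow> finite (S j) \<and> card (S j) \<le> D"
    and deg: "\<And>i. i \<in> V \<Longrightarrow> \<rho> \<le> card {j\<in>V. j \<noteq> i \<and> A i j \<noteq> 0}"
    and \<rho>: "4 * T + 2 * D < \<rho>"
  shows "\<exists>F (Y :: nat set). finite Y \<and> disjoint_family_on F Y \<and>
     (\<forall>e\<in>Y. \<exists>i\<in>V. \<exists>j\<in>V. i \<noteq> j \<and> F e = {i, j} \<and> A i j \<noteq> 0) \<and> T \<le> (4 * D + 1) * card Y \<and>
     (\<forall>u\<in>\<Union>(F ` Y). \<forall>v\<in>\<Union>(F ` Y). u \<noteq> v \<longrightarrow> u \<notin> S v)"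
proof -
  define H where "H u v \<longleftrightarrow> u \<noteq> v \<and> A u v \<noteq> 0 \<and> u \<notin> S v \<and> v \<notin> S u" for u v
  define P where "P B \<longleftrightarrow> (\<exists>u\<in>V. \<exists>v\<in>V. B = {u, v} \<and> H u v)" for B
  have shr: "\<exists>B'\<subseteq>B. P B' \<and> card B' \<le> 2" if "B \<subseteq> V" "P B" for B
    using that by (intro exI[of _ B]) (auto simp: P_def card_insert_if)
  have "\<exists>F :: nat \<Rightarrow> nat set. disjoint_family_on F {..<T} \<and> (\<forall>i<T. F i \<subseteq> V \<and> P (F i) \<and> card (F i) \<le> 2)"
  proof (rule ccontr)
    assume "\<not> ?thesis"
    then obtain X where X: "X \<subseteq> V" "card X \<le> T * 2" "\<And>B. B \<subseteq> V - X \<Longrightarrow> \<not> P B"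
      using disjoint_or_cover[where P = P and K = 2 and M = T, OF fin(1) shr] by blast
    have finX: "finite X" using X(1) fin(1) by (rule finite_subset)
    define E where "E = {(u, v). u \<in> V \<and> v \<in> V \<and> H u v}"
    define E1 where "E1 = (SIGMA v:V. S v)"
    define E0 where "E0 = (SIGMA i:V. {j\<in>V. j \<noteq> i \<and> A i j \<noteq> 0})"
    have finE1: "finite E1" unfolding E1_def using fin(1) S by auto
    have EX: "E \<subseteq> X \<times> V \<union> V \<times> X"
    proof (clarsimp simp: E_def)
      fix u v assume uv: "u \<in> V" "v \<in> V" "H u v" "v \<notin> X"
      show "u \<in> X"
      proof (rule ccontr)
        assume "u \<notin> X"
        then have "{u, v} \<subseteq> V - X" using uv by auto
        moreover have "P {u, v}" using uv by (auto simp: P_def)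
        ultimately show False using X(3) by blast
      qed
    qed
    have finE: "finite E" using EX by (rule finite_subset) (use finX fin in auto)
    have cE: "card E \<le> 4 * T * card V"
    proof -
      have "card E \<le> card (X \<times> V \<union> V \<times> X)" by (rule card_mono[OF _ EX]) (use finX fin in auto)
      also have "\<dots> \<le> card (X \<times> V) + card (V \<times> X)" by (rule card_Un_le)
      also have "\<dots> = 2 * card X * card V" by (simp add: card_cartesian_product)
      also have "\<dots> \<le> 4 * T * card V" using X(2) by (intro mult_right_mono) auto
      finally show ?thesis .
    qed
    have cE1: "card E1 \<le> D * card V"
    proof -
      have "card E1 = (\<Sum>v\<in>V. card (S v))" unfolding E1_def using fin S by (intro card_SigmaI) auto
      also have "\<dots> \<le> (\<Sum>v\<in>V. D)" by (rule sum_mono) (use S in auto)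
      finally show ?thesis by (simp add: mult.commute)
    qed
    \<comment> \<open>Double count of off-diagonal nonzero entries: at most
      \<open>4 * T * card V\<close> meet the cover \<open>X\<close>, and at most
      \<open>2 * D * card V\<close> involve an exceptional set in one of the two orders.\<close>
    have "\<rho> * card V = (\<Sum>v\<in>V. \<rho>)" by simp
    also have "\<dots> \<le> (\<Sum>i\<in>V. card {j\<in>V. j \<noteq> i \<and> A i j \<noteq> 0})" by (rule sum_mono) (rule deg)
    also have "\<dots> = card E0" unfolding E0_def using fin by (intro card_SigmaI[symmetric]) auto
    also have "\<dots> \<le> card (E \<union> (E1 \<union> E1\<inverse>))"
      by (rule card_mono) (use finE finE1 in \<open>auto simp: E0_def E_def E1_def H_def\<close>)
    also have "\<dots> \<le> card E + (card E1 + card (E1\<inverse>))"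
      by (intro order_trans[OF card_Un_le] add_left_mono card_Un_le)
    also have "card (E1\<inverse>) = card E1" by simp
    finally have "\<rho> * card V \<le> (4 * T + 2 * D) * card V"
      using cE cE1 by (simp add: algebra_simps)
    moreover have "card V > 0" using fin by (simp add: card_gt_0_iff)
    ultimately have "\<rho> \<le> 4 * T + 2 * D" by simp
    then show False using \<rho> by simp
  qed
  then obtain F :: "nat \<Rightarrow> nat set" where F: "disjoint_family_on F {..<T}" "\<And>i. i < T \<Longrightarrow> P (F i)" by blast
  \<comment> \<open>Conflicts between edges; those inside one edge are already excluded by
    \<open>H\<close>.\<close>
  define R where "R e e' \<longleftrightarrow> (\<exists>u\<in>F e. \<exists>v\<in>F e'. v \<in> S u)" for e e'
  have out: "card {e'\<in>{..<T}. R e e'} \<le> 2 * D" if "e \<in> {..<T}" for e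
  proof -
    have "\<exists>u\<in>V. \<exists>v\<in>V. F e = {u, v}" using F(2)[of e] that unfolding P_def by auto
    then obtain u v where uv: "F e = {u, v}" "u \<in> V" "v \<in> V" by blast
    have "{e'\<in>{..<T}. R e e'} = {e'\<in>{..<T}. F e' \<inter> (S u \<union> S v) \<noteq> {}}"
      by (auto simp: R_def uv)
    also have "card \<dots> \<le> card (S u \<union> S v)"
      by (rule card_disjoint_hits[OF F(1)]) (use S uv in auto)
    also have "\<dots> \<le> card (S u) + card (S v)" by (rule card_Un_le)
    also have "\<dots> \<le> 2 * D" using S[of u] S[of v] uv by simp
    finally show ?thesis .
  qed
  obtain Y where Y: "Y \<subseteq> {..<T}" "card {..<T} \<le> (2 * (2 * D) + 1) * card Y"
    "\<forall>x\<in>Y. \<forall>y\<in>Y. x \<noteq> y \<longrightarrow> \<not> R x y"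
    using sparse_digraph_independent[of "{..<T}" R "2 * D", OF _ out] by auto
  have "u \<notin> S v" if "e \<in> Y" "e' \<in> Y" "u \<in> F e" "v \<in> F e'" "u \<noteq> v" for u v e e'
  proof (cases "e = e'")
    case True
    have "P (F e)" using F(2) Y(1) that by auto
    then show ?thesis using True that unfolding P_def H_def by auto
  next
    case False
    then show ?thesis using Y(3) that by (auto simp: R_def)
  qed
  moreover have "\<forall>e\<in>Y. \<exists>i\<in>V. \<exists>j\<in>V. i \<noteq> j \<and> F e = {i, j} \<and> A i j \<noteq> 0"
  proof
    fix e assume "e \<in> Y"
    then have "P (F e)" using F(2) Y(1) by auto
    then show "\<exists>i\<in>V. \<exists>j\<in>V. i \<noteq> j \<and> F e = {i, j} \<and> A i j \<noteq> 0"
      unfolding P_def H_def by blast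
  qed
  moreover have "disjoint_family_on F Y" using Y(1) F(1) by (rule disjoint_family_on_mono)
  ultimately show ?thesis using Y finite_subset[OF Y(1)] by (intro exI[of _ F] exI[of _ Y]) auto
qed

definition diff2 :: "(('k \<Rightarrow> complex) \<Rightarrow> complex) \<Rightarrow> ('k \<Rightarrow> complex) \<Rightarrow> ('k \<Rightarrow> complex) \<Rightarrow> complex" where
  "diff2 q u v = q (\<lambda>i. u i + v i) - q u - q v + q (\<lambda>_. 0)"

text \<open>The second difference is the polar form and therefore does not depend on the base point
  \<open>e\<close>; frozen variables only move the base point.\<close>

lemma quad_diff2_shift:
  assumes "finite G" "quad G q"
  shows "q (\<lambda>i. u i + v i + e i) - q (\<lambda>i. u i + e i) - q (\<lambda>i. v i + e i) + q e = diff2 q u v"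
proof -
  obtain \<beta> l \<gamma> where q: "q = (\<lambda>p. (\<Sum>i\<in>G. \<Sum>j\<in>G. \<beta> i j * (p i * p j)) + lin G l p + \<gamma>)"
    using assms(2) unfolding quad_def by blast
  interpret quadratic_polynomial G \<beta> l \<gamma> by unfold_locales (rule assms(1))
  have qq: "q = quadratic_polynomial.q G \<beta> l \<gamma>"
    by (simp add: fun_eq_iff q q_def Q2_def)
  have "lin G (grad u) (\<lambda>i. v i + e i) = q (\<lambda>i. u i + v i + e i) - q (\<lambda>i. v i + e i) - q u + q (\<lambda>_. 0)"
    using polar[of u "\<lambda>i. v i + e i"] by (simp add: qq add_ac)
  moreover have "lin G (grad u) e = q (\<lambda>i. u i + e i) - q e - q u + q (\<lambda>_. 0)"
    using polar[of u e] by (simp add: qq add_ac)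
  moreover have "lin G (grad u) v = diff2 q u v"
    using polar[of u v] by (simp add: qq diff2_def add_ac)
  ultimately show ?thesis unfolding lin_add by (simp add: algebra_simps)
qed

text \<open>Here the forms may be dependent. If they are not robust, deleting at most
  \<open>2 ^ t * d\<close> variables makes them dependent, and one is expressed by the others.
  Second differences between surviving columns do not change, so the richness condition is
  inherited; its allowance pays for every elimination because
  \<open>(d - 1) * (d - 1) + d \<le> d * d\<close> for positive \<open>d\<close>.\<close>

theorem quad_forms_anticoncentration:
  "\<exists>C\<ge>1. \<forall>t (U :: 'a set) (G :: 'k set) g q.
     finite U \<longrightarrow> finite G \<longrightarrow> card G = d \<longrightarrow> quad G q \<longrightarrow>
     (\<forall>S\<subseteq>U. card S \<le> d * d * 2 ^ t \<longrightarrow>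
        (\<exists>i\<in>U - S. \<exists>j\<in>U - S. diff2 q (\<lambda>s. g s i) (\<lambda>s. g s j) \<noteq> 0)) \<longrightarrow>
     prb (signs 0 U) (\<lambda>x. q (fv g U x) = 0) \<le> C * decay t"
proof (induction d rule: less_induct)
  case (less d)
  obtain C1 where C1: "C1 \<ge> 1" and robust_case: "\<And>t (U :: 'a set) (G :: 'k set) L g c q p0 p0'.
     finite U \<Longrightarrow> finite G \<Longrightarrow> finite L \<Longrightarrow> G \<inter> L = {} \<Longrightarrow> card G = d \<Longrightarrow> card L = 0 \<Longrightarrow>
     quad G q \<Longrightarrow> q p0 \<noteq> q p0' \<Longrightarrow> robust t (G \<union> L) g U \<Longrightarrow>
     prb (signs 0 U) (\<lambda>x. (\<forall>s\<in>L. fv g U x s = c s) \<and> q (fv g U x) = 0) \<le> C1 * decay t ^ Suc 0"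
    using quadric_anticoncentration[where d = d and k = 0 and ?'a = 'a and ?'k = 'k] by blast
  \<comment> \<open>For \<open>d = 0\<close> there is no form to eliminate, and any
    \<open>C2\<close> serves.\<close>
  have "\<exists>C2\<ge>1. d \<noteq> 0 \<longrightarrow> (\<forall>t (U :: 'a set) (G :: 'k set) g q.
     finite U \<longrightarrow> finite G \<longrightarrow> card G = d - 1 \<longrightarrow> quad G q \<longrightarrow>
     (\<forall>S\<subseteq>U. card S \<le> (d - 1) * (d - 1) * 2 ^ t \<longrightarrow>
        (\<exists>i\<in>U - S. \<exists>j\<in>U - S. diff2 q (\<lambda>s. g s i) (\<lambda>s. g s j) \<noteq> 0)) \<longrightarrow>
     prb (signs 0 U) (\<lambda>x. q (fv g U x) = 0) \<le> C2 * decay t)"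
    using less.IH[of "d - 1"] by (cases "d = 0") (auto intro: exI[of _ 1])
  then obtain C2 where C2: "C2 \<ge> 1" and IH0: "d \<noteq> 0 \<longrightarrow> (\<forall>t (U :: 'a set) (G :: 'k set) g q.
     finite U \<longrightarrow> finite G \<longrightarrow> card G = d - 1 \<longrightarrow> quad G q \<longrightarrow>
     (\<forall>S\<subseteq>U. card S \<le> (d - 1) * (d - 1) * 2 ^ t \<longrightarrow>
        (\<exists>i\<in>U - S. \<exists>j\<in>U - S. diff2 q (\<lambda>s. g s i) (\<lambda>s. g s j) \<noteq> 0)) \<longrightarrow>
     prb (signs 0 U) (\<lambda>x. q (fv g U x) = 0) \<le> C2 * decay t)"
    by auto
  note IH = IH0[rule_format]
  have main: "prb (signs 0 U) (\<lambda>x. q (fv g U x) = 0) \<le> (C1 + C2) * decay t"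
    if fin: "finite U" "finite G" and G: "card G = d" and q: "quad G q"
    and rich: "\<And>S. S \<subseteq> U \<Longrightarrow> card S \<le> d * d * 2 ^ t \<Longrightarrow>
        \<exists>i\<in>U - S. \<exists>j\<in>U - S. diff2 q (\<lambda>s. g s i) (\<lambda>s. g s j) \<noteq> 0"
    for t and U :: "'a set" and G :: "'k set" and g q
  proof (cases "robust t G g U")
    case True
    obtain i j where "diff2 q (\<lambda>s. g s i) (\<lambda>s. g s j) \<noteq> 0" using rich[of "{}"] by auto
    then have "\<exists>p0 p0'. q p0 \<noteq> q p0'" unfolding diff2_def by (metis add_cancel_left_left diff_add_cancel diff_self)
    then obtain p0 p0' where "q p0 \<noteq> q p0'" by blast
    then have "prb (signs 0 U) (\<lambda>x. (\<forall>s\<in>{}. fv g U x s = 0) \<and> q (fv g U x) = 0) \<le> C1 * decay t ^ Suc 0"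
      by (intro robust_case[where G = G and q = q and ?p0.0 = p0 and p0' = p0']) (use fin G q True in auto)
    also have "\<dots> \<le> (C1 + C2) * decay t" using C2 by (simp add: distrib_right)
    finally show ?thesis by simp
  next
    case False
    have shr: "\<exists>B'\<subseteq>B. indep G g B' \<and> card B' \<le> d" if "B \<subseteq> U" "indep G g B" for B
      using indep_shrink[OF fin(2) that(2)] G by auto
    have "\<not> (\<exists>F :: nat \<Rightarrow> 'a set. disjoint_family_on F {..<2 ^ t} \<and> (\<forall>i<2 ^ t. F i \<subseteq> U \<and> indep G g (F i) \<and> card (F i) \<le> d))"
    proof
      assume "\<exists>F :: nat \<Rightarrow> 'a set. disjoint_family_on F {..<2 ^ t} \<and> (\<forall>i<2 ^ t. F i \<subseteq> U \<and> indep G g (F i) \<and> card (F i) \<le> d)"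
      then obtain F :: "nat \<Rightarrow> 'a set" where "disjoint_family_on F {..<2 ^ t}"
        "\<forall>i<2 ^ t. F i \<subseteq> U \<and> indep G g (F i)" by blast
      then have "robust t G g U" unfolding robust_def by (intro exI[of _ "{..<2 ^ t}"] exI[of _ F]) auto
      then show False using False by simp
    qed
    then obtain S1 where S1: "S1 \<subseteq> U" "card S1 \<le> 2 ^ t * d" and no: "\<And>B. B \<subseteq> U - S1 \<Longrightarrow> \<not> indep G g B"
      using disjoint_or_cover[where P = "indep G g" and K = d and M = "2 ^ t", OF fin(1) shr] by blast
    define U1 where "U1 = U - S1"
    have U1: "U1 \<subseteq> U" "finite U1" using fin by (auto simp: U1_def)
    have "\<not> indep G g U1" using no by (simp add: U1_def)
    then obtain \<mu> s0 where s0: "s0 \<in> G" "\<mu> s0 \<noteq> 0" and \<mu>: "\<And>j. j \<in> U1 \<Longrightarrow> (\<Sum>k\<in>G. \<mu> k * g k j) = 0"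
      unfolding indep_def by blast
    define G' where "G' = G - {s0}"
    have d: "d \<noteq> 0" "card G' = d - 1" "finite G'" using s0 G fin card_gt_0_iff[of G] by (auto simp: G'_def)
    define \<nu> where "\<nu> k = - \<mu> k / \<mu> s0" for k
    have g0: "g s0 j = lin G' \<nu> (\<lambda>s. g s j)" if "j \<in> U1" for j
    proof -
      have "\<mu> s0 * g s0 j + lin G' \<mu> (\<lambda>s. g s j) = 0"
        using \<mu>[OF that] s0 fin by (simp add: G'_def lin_def sum.remove)
      then have a: "lin G' \<mu> (\<lambda>s. g s j) = - (\<mu> s0 * g s0 j)"
        by (simp add: eq_neg_iff_add_eq_0 add.commute)
      have "lin G' \<nu> (\<lambda>s. g s j) = - lin G' \<mu> (\<lambda>s. g s j) / \<mu> s0"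
        by (simp add: lin_def \<nu>_def sum_divide_distrib sum_negf)
      then show ?thesis unfolding a using s0 by simp
    qed
    \<comment> \<open>\<open>L\<close> rebuilds the eliminated value from the remaining ones; it
      fixes every vector of values that comes from variables in \<open>U1\<close>.\<close>
    define L where "L p s = (if s = s0 then lin G' \<nu> p else p s)" for p :: "'k \<Rightarrow> complex" and s
    have Ladd: "L (\<lambda>i. u i + v i) s = L u s + L v s" for u v s by (simp add: L_def lin_add)
    have L0: "L (\<lambda>_. 0) s = 0" for s by (simp add: L_def lin_def)
    have Lcol: "L (\<lambda>s. g s j) = (\<lambda>s. g s j)" if "j \<in> U1" for j
      using g0[OF that] by (auto simp: L_def)
    have Lfv: "L (fv g U1 x) = fv g U1 x" for x
    proof
      fix s
      have "lin G' \<nu> (fv g U1 x) = (\<Sum>j\<in>U1. lin G' \<nu> (\<lambda>s. g s j) * x j)"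
        unfolding fv_def lin_def sum_distrib_left sum_distrib_right
        by (subst sum.swap) (simp add: mult.assoc)
      also have "\<dots> = fv g U1 x s0" unfolding fv_def by (rule sum.cong) (simp_all add: g0)
      finally show "L (fv g U1 x) s = fv g U1 x s" by (simp add: L_def)
    qed
    show ?thesis
    proof (rule signs_subset_bound[OF fin(1) U1(1)])
      fix y :: "'a \<Rightarrow> complex"
      define e where "e = fv g (U - U1) y"
      define q1 where "q1 p = q (\<lambda>s. L p s + e s)" for p
      have fvU: "fv g U (\<lambda>i. if i \<in> U1 then x i else y i) = (\<lambda>s. fv g U1 x s + e s)" for x
      proof
        fix s
        show "fv g U (\<lambda>i. if i \<in> U1 then x i else y i) s = fv g U1 x s + e s"
          using fv_mix[of U1 "U - U1" g x y s] U1 fin by (simp add: mix_def e_def Un_absorb1)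
      qed
      have aff: "aff G' (\<lambda>p. L p s + e s)" if "s \<in> G" for s
      proof (cases "s = s0")
        case True
        then show ?thesis by (intro affI[where l = \<nu> and \<gamma> = "e s"]) (simp add: L_def)
      next
        case False
        then show ?thesis using aff_coord[OF d(3), of s "e s"] that by (simp add: L_def[abs_def] G'_def)
      qed
      have q1: "quad G' q1" unfolding q1_def by (rule quad_subst[OF fin(2) q aff])
      have dd: "diff2 q1 (\<lambda>s. g s i) (\<lambda>s. g s j) = diff2 q (\<lambda>s. g s i) (\<lambda>s. g s j)"
        if "i \<in> U1" "j \<in> U1" for i j
      proof -
        have "diff2 q1 (\<lambda>s. g s i) (\<lambda>s. g s j)
            = q (\<lambda>s. g s i + g s j + e s) - q (\<lambda>s. g s i + e s) - q (\<lambda>s. g s j + e s) + q e"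
          unfolding diff2_def q1_def Ladd L0 Lcol[OF that(1)] Lcol[OF that(2)] by simp
        also have "\<dots> = diff2 q (\<lambda>s. g s i) (\<lambda>s. g s j)"
          by (rule quad_diff2_shift[OF fin(2) q])
        finally show ?thesis .
      qed
      have rich': "\<exists>i\<in>U1 - S. \<exists>j\<in>U1 - S. diff2 q1 (\<lambda>s. g s i) (\<lambda>s. g s j) \<noteq> 0"
        if S: "S \<subseteq> U1" "card S \<le> (d - 1) * (d - 1) * 2 ^ t" for S
      proof -
        obtain d' where d': "d = Suc d'" using d(1) not0_implies_Suc by blast
        have "card (S \<union> S1) \<le> card S + card S1" by (rule card_Un_le)
        also have "\<dots> \<le> d' * d' * 2 ^ t + 2 ^ t * Suc d'" using S S1 by (simp add: d')
        also have "\<dots> \<le> d * d * 2 ^ t" by (simp add: d' algebra_simps)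
        finally obtain i j where ij: "i \<in> U - (S \<union> S1)" "j \<in> U - (S \<union> S1)" "diff2 q (\<lambda>s. g s i) (\<lambda>s. g s j) \<noteq> 0"
          using rich[of "S \<union> S1"] S S1 U1 by blast
        then have "i \<in> U1 - S" "j \<in> U1 - S" by (auto simp: U1_def)
        then show ?thesis using dd[of i j] ij(3) by (intro bexI[of _ i] bexI[of _ j]) auto
      qed
      have "prb (signs 0 U1) (\<lambda>x. q (fv g U (\<lambda>i. if i \<in> U1 then x i else y i)) = 0)
          = prb (signs 0 U1) (\<lambda>x. q1 (fv g U1 x) = 0)"
        unfolding fvU q1_def Lfv ..
      also have "\<dots> \<le> C2 * decay t"
        by (rule IH[OF d(1) U1(2) d(3,2) q1 rich'])
      also have "\<dots> \<le> (C1 + C2) * decay t" using C1 by (intro mult_right_mono) auto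
      finally show "prb (signs 0 U1) (\<lambda>x. q (fv g U (\<lambda>i. if i \<in> U1 then x i else y i)) = 0) \<le> (C1 + C2) * decay t" .
    qed (use C1 C2 in auto)
  qed
  show ?case
    by (intro exI[of _ "C1 + C2"] conjI allI impI main) (use C1 C2 in auto)
qed

section \<open>Polynomials given by a symmetric matrix of coefficients\<close>

definition qpoly :: "('a \<Rightarrow> 'a \<Rightarrow> complex) \<Rightarrow> 'a set \<Rightarrow> ('a \<Rightarrow> complex) \<Rightarrow> complex \<Rightarrow> ('a \<Rightarrow> complex) \<Rightarrow> complex" where
  "qpoly A U l \<gamma> x = (\<Sum>i\<in>U. \<Sum>j\<in>U. A i j * (x i * x j)) + (\<Sum>i\<in>U. l i * x i) + \<gamma>"

text \<open>The two mixed sums agree by symmetry, whence the factor 2. With \<open>z\<close> frozen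
  the quadratic part in \<open>y\<close> keeps the matrix \<open>A\<close>; only the linear and
  constant terms depend on \<open>z\<close>.\<close>

lemma qpoly_mix:
  assumes fin: "finite Y" "finite Z" "Y \<inter> Z = {}" and sym: "\<And>i j. A i j = A j i"
  shows "qpoly A (Y \<union> Z) l \<gamma> (mix Y y z)
    = qpoly A Y (\<lambda>i. l i + 2 * (\<Sum>j\<in>Z. z j * A j i)) (qpoly A Z l \<gamma> z) y"
proof -
  let ?x = "mix Y y z"
  have two: "(\<Sum>i\<in>Y. 2 * X i * y i) = 2 * (\<Sum>i\<in>Y. X i * y i)" for X
    by (simp add: sum_distrib_left mult.assoc)
  have lins: "(\<Sum>i\<in>Y \<union> Z. f i * ?x i) = (\<Sum>i\<in>Y. f i * y i) + (\<Sum>i\<in>Z. f i * z i)" for f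
    unfolding mix_def by (rule sum_union_mix[OF fin])
  have inner: "(\<Sum>j\<in>Y \<union> Z. A i j * (?x i * ?x j)) = ((\<Sum>j\<in>Y. A i j * y j) + (\<Sum>j\<in>Z. A i j * z j)) * ?x i" for i
    unfolding lins[of "A i", symmetric] sum_distrib_right by (simp add: mult_ac)
  have "(\<Sum>i\<in>Y \<union> Z. \<Sum>j\<in>Y \<union> Z. A i j * (?x i * ?x j))
     = (\<Sum>i\<in>Y. ((\<Sum>j\<in>Y. A i j * y j) + (\<Sum>j\<in>Z. A i j * z j)) * y i)
     + (\<Sum>i\<in>Z. ((\<Sum>j\<in>Y. A i j * y j) + (\<Sum>j\<in>Z. A i j * z j)) * z i)"
    unfolding inner by (rule lins)
  also have "\<dots> = (\<Sum>i\<in>Y. \<Sum>j\<in>Y. A i j * (y i * y j)) + (\<Sum>i\<in>Y. \<Sum>j\<in>Z. A i j * (y i * z j))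
      + ((\<Sum>i\<in>Z. \<Sum>j\<in>Y. A i j * (z i * y j)) + (\<Sum>i\<in>Z. \<Sum>j\<in>Z. A i j * (z i * z j)))"
    by (simp add: distrib_left sum.distrib sum_distrib_left mult_ac)
  also have "(\<Sum>i\<in>Z. \<Sum>j\<in>Y. A i j * (z i * y j)) = (\<Sum>i\<in>Y. \<Sum>j\<in>Z. A i j * (y i * z j))"
    by (subst sum.swap) (simp add: sym mult_ac)
  also have "(\<Sum>i\<in>Y. \<Sum>j\<in>Z. A i j * (y i * z j)) = (\<Sum>i\<in>Y. (\<Sum>j\<in>Z. z j * A j i) * y i)"
    by (simp add: sum_distrib_left sym mult_ac)
  finally have "(\<Sum>i\<in>Y \<union> Z. \<Sum>j\<in>Y \<union> Z. A i j * (?x i * ?x j))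
     = (\<Sum>i\<in>Y. \<Sum>j\<in>Y. A i j * (y i * y j)) + (\<Sum>i\<in>Y. 2 * (\<Sum>j\<in>Z. z j * A j i) * y i)
      + (\<Sum>i\<in>Z. \<Sum>j\<in>Z. A i j * (z i * z j))"
    unfolding two by simp
  then show ?thesis
    unfolding qpoly_def lins by (simp add: distrib_right sum.distrib)
qed

lemma qpoly_restrict_bound:
  assumes "finite V" "U \<subseteq> V" "B \<ge> 0" and sym: "\<And>i j. A i j = A j i"
    and "\<And>l \<gamma>. prb (signs 0 U) (\<lambda>x. qpoly A U l \<gamma> x = 0) \<le> B"
  shows "prb (signs 0 V) (\<lambda>x. qpoly A V l \<gamma> x = 0) \<le> B"
proof (rule signs_subset_bound[OF assms(1-3)])
  fix y :: "'a \<Rightarrow> complex"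
  have V: "V = U \<union> (V - U)" using assms(2) by auto
  have "qpoly A V l \<gamma> (\<lambda>i. if i \<in> U then x i else y i)
      = qpoly A U (\<lambda>i. l i + 2 * (\<Sum>j\<in>V - U. y j * A j i)) (qpoly A (V - U) l \<gamma> y) x" for x
    using qpoly_mix[of U "V - U" A l \<gamma> x y] assms(1,2) sym
    by (simp add: mix_def Un_absorb1 finite_subset)
  then show "prb (signs 0 U) (\<lambda>x. qpoly A V l \<gamma> (\<lambda>i. if i \<in> U then x i else y i) = 0) \<le> B"
    using assms(5) by simp
qed

section \<open>Rank dichotomy and the low rank case\<close>

text \<open>Blocks have exactly \<open>card J\<close> columns, as \<open>indep_shrink\<close>
  provides; a fixed size gives a fixed probability of being monochromatic in a random
  colouring.\<close>

definition good :: "('a \<Rightarrow> 'a \<Rightarrow> complex) \<Rightarrow> 'a set \<Rightarrow> nat \<Rightarrow> 'a set \<Rightarrow> bool" where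
  "good A V T J \<longleftrightarrow> (\<exists>I :: nat \<Rightarrow> 'a set. disjoint_family_on I {..<T} \<and>
     (\<forall>i<T. I i \<subseteq> V \<and> card (I i) = card J \<and> indep J A (I i)))"

text \<open>A maximal set \<open>J0\<close> of columns that are independent on many disjoint blocks of rows spans every other column up to
few entries. The number of blocks required decreases geometrically with the size of the set, so that the rows deleted for
a larger set cannot meet all blocks of \<open>J0\<close>.\<close>

lemma good_blocks_or_low_rank:
  assumes finV: "finite V" and T0: "T0 \<ge> 1"
  shows "(\<exists>F :: nat \<Rightarrow> 'a set. disjoint_family_on F {..<M} \<and>
            (\<forall>i<M. F i \<subseteq> V \<and> card (F i) = K \<and> good A V T0 (F i))) \<or>
         (\<exists>D0 J0 c S. D0 \<subseteq> V \<and> J0 \<subseteq> V \<and> card D0 \<le> M * K \<and> card J0 < K \<and>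
            (\<forall>j\<in>V - D0 - J0. S j \<subseteq> V \<and> card (S j) \<le> T0 * (K + 1) ^ K \<and>
               (\<forall>i\<in>V - S j. A j i = (\<Sum>t\<in>J0. c j t * A t i))))"
    (is "?high \<or> ?low")
proof (cases ?high)
  case False
  define P where "P B \<longleftrightarrow> card B = K \<and> good A V T0 B" for B
  have shrP: "\<exists>B'\<subseteq>B. P B' \<and> card B' \<le> K" if "B \<subseteq> V" "P B" for B
    using that by (intro exI[of _ B]) (auto simp: P_def)
  have "\<not> (\<exists>F :: nat \<Rightarrow> 'a set. disjoint_family_on F {..<M} \<and> (\<forall>i<M. F i \<subseteq> V \<and> P (F i) \<and> card (F i) \<le> K))"
    using False unfolding P_def by blast
  then obtain D0 where D0: "D0 \<subseteq> V" "card D0 \<le> M * K" "\<And>B. B \<subseteq> V - D0 \<Longrightarrow> \<not> P B"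
    using disjoint_or_cover[where P = P and K = K and M = M, OF finV shrP] by blast
  \<comment> \<open>\<open>T K = T0\<close>, so \<open>Q K\<close> would contradict the choice of
    \<open>D0\<close>, while \<open>Q 0\<close> is trivial. A step where \<open>Q\<close> fails for
    the first time plays the part of maximality.\<close>
  define T where "T s = T0 * (K + 1) ^ (K - s)" for s
  define Q where "Q s \<longleftrightarrow> (\<exists>J\<subseteq>V - D0. card J = s \<and> good A V (T s) J)" for s
  have "Q 0" unfolding Q_def
    by (intro exI[of _ "{}"]) (auto simp: good_def indep_def disjoint_family_on_def intro!: exI[of _ "\<lambda>_. {}"])
  have "\<not> Q K" using D0(3) by (auto simp: Q_def P_def T_def)
  have "\<exists>s<K. Q s \<and> \<not> Q (Suc s)"
  proof (rule ccontr)
    assume *: "\<not> ?thesis"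
    have "s \<le> K \<longrightarrow> Q s" for s by (induction s) (use * \<open>Q 0\<close> in auto)
    then show False using \<open>\<not> Q K\<close> by simp
  qed
  then obtain s where s: "s < K" "Q s" "\<not> Q (Suc s)" by blast
  obtain J0 where J0: "J0 \<subseteq> V - D0" "card J0 = s" "good A V (T s) J0" using s(2) unfolding Q_def by blast
  have finJ0: "finite J0" using J0(1) finV by (meson finite_Diff finite_subset)
  obtain I :: "nat \<Rightarrow> 'a set" where I: "disjoint_family_on I {..<T s}" "\<And>i. i < T s \<Longrightarrow> I i \<subseteq> V \<and> indep J0 A (I i)"
    using J0(3) unfolding good_def by blast
  have Ts: "T s = T (Suc s) * (K + 1)"
  proof -
    have "K - s = Suc (K - Suc s)" using s(1) by simp
    then show ?thesis by (simp add: T_def algebra_simps)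
  qed
  have Tpos: "T (Suc s) > 0" using T0 by (simp add: T_def)
  have TsK: "T s \<le> T0 * (K + 1) ^ K" unfolding T_def by (intro mult_left_mono power_increasing) auto
  have "\<exists>S c. S \<subseteq> V \<and> card S \<le> T0 * (K + 1) ^ K \<and> (\<forall>i\<in>V - S. A j i = (\<Sum>t\<in>J0. c t * A t i))"
    if j: "j \<in> V - D0 - J0" for j
  proof -
    define J where "J = insert j J0"
    have cJ: "card J = Suc s" "finite J" using J0 j finJ0 by (auto simp: J_def)
    define R where "R B \<longleftrightarrow> indep J A B \<and> card B = Suc s" for B
    have shrR: "\<exists>B'\<subseteq>B. R B' \<and> card B' \<le> Suc s" if "B \<subseteq> V" "R B" for B
      using that by (intro exI[of _ B]) (auto simp: R_def)
    have "J \<subseteq> V - D0" using J0(1) j by (auto simp: J_def)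
    then have "\<not> good A V (T (Suc s)) J" using s(3) cJ unfolding Q_def by blast
    then have "\<not> (\<exists>F :: nat \<Rightarrow> 'a set. disjoint_family_on F {..<T (Suc s)} \<and>
       (\<forall>i<T (Suc s). F i \<subseteq> V \<and> R (F i) \<and> card (F i) \<le> Suc s))"
      unfolding good_def R_def cJ(1) by blast
    then obtain S where S: "S \<subseteq> V" "card S \<le> T (Suc s) * Suc s" "\<And>B. B \<subseteq> V - S \<Longrightarrow> \<not> R B"
      using disjoint_or_cover[where P = R and K = "Suc s" and M = "T (Suc s)", OF finV shrR] by blast
    have finS: "finite S" using S(1) finV by (rule finite_subset)
    have "T (Suc s) * Suc s < T s" unfolding Ts using s(1) Tpos by (intro mult_strict_left_mono) auto
    then have cS: "card S < T s" using S(2) by simp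
    have "\<not> indep J A (V - S)"
    proof
      assume "indep J A (V - S)"
      then obtain B where "B \<subseteq> V - S" "card B = card J" "indep J A B"
        using indep_shrink[OF cJ(2)] by blast
      then show False using S(3) cJ by (auto simp: R_def)
    qed
    then obtain \<mu> k0 where k0: "k0 \<in> J" "\<mu> k0 \<noteq> 0" and \<mu>: "\<And>i. i \<in> V - S \<Longrightarrow> (\<Sum>k\<in>J. \<mu> k * A k i) = 0"
      unfolding indep_def by blast
    have \<mu>': "\<mu> j * A j i + (\<Sum>k\<in>J0. \<mu> k * A k i) = 0" if "i \<in> V - S" for i
      using \<mu>[OF that] j finJ0 by (simp add: J_def)
    \<comment> \<open>Since \<open>card S < T s\<close>, some block of \<open>J0\<close> avoids
      \<open>S\<close>; a relation without \<open>j\<close> would contradict the independence of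
      \<open>J0\<close> there.\<close>
    have "\<mu> j \<noteq> 0"
    proof
      assume j0: "\<mu> j = 0"
      have "card {i\<in>{..<T s}. I i \<inter> S \<noteq> {}} < card {..<T s}"
        using card_disjoint_hits[OF I(1) finS] cS by simp
      then have "{i\<in>{..<T s}. I i \<inter> S \<noteq> {}} \<noteq> {..<T s}" by (metis less_irrefl)
      then obtain i where i: "i < T s" "I i \<inter> S = {}" by auto
      have "\<mu> k = 0" if "k \<in> J0" for k
      proof (rule indepD[where S = J0 and g = A and B = "I i"])
        show "indep J0 A (I i)" using I(2) i by blast
        fix b assume "b \<in> I i"
        then have "b \<in> V - S" using I(2) i by blast
        then show "(\<Sum>k\<in>J0. \<mu> k * A k b) = 0" using \<mu>'[of b] j0 by simp
      qed (rule that)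
      then show False using k0 j0 by (auto simp: J_def)
    qed
    have "A j i = (\<Sum>t\<in>J0. (- \<mu> t / \<mu> j) * A t i)" if "i \<in> V - S" for i
    proof -
      have "(\<Sum>k\<in>J0. \<mu> k * A k i) = - (\<mu> j * A j i)"
        using \<mu>'[OF that] by (simp add: eq_neg_iff_add_eq_0 add.commute)
      moreover have "(\<Sum>t\<in>J0. (- \<mu> t / \<mu> j) * A t i) = - (\<Sum>k\<in>J0. \<mu> k * A k i) / \<mu> j"
        by (simp add: sum_divide_distrib sum_negf)
      ultimately show ?thesis using \<open>\<mu> j \<noteq> 0\<close> by simp
    qed
    then show ?thesis using S(1) cS TsK by (intro exI[of _ S] exI[of _ "\<lambda>t. - \<mu> t / \<mu> j"]) auto
  qed
  then obtain S c where "\<forall>j\<in>V - D0 - J0. S j \<subseteq> V \<and> card (S j) \<le> T0 * (K + 1) ^ K \<and>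
      (\<forall>i\<in>V - S j. A j i = (\<Sum>t\<in>J0. c j t * A t i))"
    by metis
  then have ?low using D0 J0 s(1)
    by (intro exI[of _ D0] exI[of _ J0] exI[of _ c] exI[of _ S]) auto
  then show ?thesis ..
qed blast

text \<open>The diagonal of \<open>A\<close> need not match the low rank expression: it only contributes a constant, as \<open>x i * x i = 1\<close>.\<close>

lemma low_rank_anticoncentration_exact:
  "\<exists>C\<ge>1. \<forall>t (U :: 'a set) A J c F (Y :: nat set) l \<gamma>.
     finite U \<longrightarrow> finite J \<longrightarrow> card J = s \<longrightarrow> (\<forall>i j. A i j = A j i) \<longrightarrow>
     (\<forall>i\<in>U. \<forall>j\<in>U. i \<noteq> j \<longrightarrow> A j i = (\<Sum>t\<in>J. c j t * A t i)) \<longrightarrow>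
     finite Y \<longrightarrow> disjoint_family_on F Y \<longrightarrow> (\<forall>e\<in>Y. \<exists>i\<in>U. \<exists>j\<in>U. i \<noteq> j \<and> F e = {i, j} \<and> A i j \<noteq> 0) \<longrightarrow>
     (2 * s + 1) * (2 * s + 1) * 2 ^ t < card Y \<longrightarrow>
     prb (signs 0 U) (\<lambda>x. qpoly A U l \<gamma> x = 0) \<le> C * decay t"
proof -
  obtain C where C: "C \<ge> 1" and main: "\<forall>t (U :: 'a set) (G :: (nat \<times> 'a) set) g q.
     finite U \<longrightarrow> finite G \<longrightarrow> card G = 2 * s + 1 \<longrightarrow> quad G q \<longrightarrow>
     (\<forall>S\<subseteq>U. card S \<le> (2 * s + 1) * (2 * s + 1) * 2 ^ t \<longrightarrow>
        (\<exists>i\<in>U - S. \<exists>j\<in>U - S. diff2 q (\<lambda>s. g s i) (\<lambda>s. g s j) \<noteq> 0)) \<longrightarrow>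
     prb (signs 0 U) (\<lambda>x. q (fv g U x) = 0) \<le> C * decay t"
    using quad_forms_anticoncentration[where d = "2 * s + 1" and ?'a = 'a and ?'k = "nat \<times> 'a"] by blast
  show ?thesis
  proof (intro exI[of _ C] conjI C allI impI)
    fix t :: nat and U :: "'a set" and A :: "'a \<Rightarrow> 'a \<Rightarrow> complex" and J c F and Y :: "nat set" and l \<gamma>
    assume fin: "finite U" "finite J" and J: "card J = s" and sym: "\<forall>i j. A i j = A j i"
      and lr: "\<forall>i\<in>U. \<forall>j\<in>U. i \<noteq> j \<longrightarrow> A j i = (\<Sum>t\<in>J. c j t * A t i)"
      and F: "finite Y" "disjoint_family_on F Y" "\<forall>e\<in>Y. \<exists>i\<in>U. \<exists>j\<in>U. i \<noteq> j \<and> F e = {i, j} \<and> A i j \<noteq> 0"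
      and Y: "(2 * s + 1) * (2 * s + 1) * 2 ^ t < card Y"
    define B where "B j i = (\<Sum>t\<in>J. c j t * A t i)" for j i
    have lrB: "A j i = B j i" if "i \<in> U" "j \<in> U" "i \<noteq> j" for i j
      unfolding B_def using lr that by blast
    define \<gamma>0 where "\<gamma>0 = \<gamma> + (\<Sum>i\<in>U. A i i - B i i)"
    \<comment> \<open>One form for each row \<open>A t\<close>, one for each coefficient
      \<open>c _ t\<close>, and \<open>w\<close> for the linear part: \<open>2 * s + 1\<close> in
      all. The tag 2 keeps \<open>w\<close> apart from the others.\<close>
    define w :: "nat \<times> 'a" where "w = (2, undefined)"
    define G where "G = ({0, 1} \<times> J) \<union> {w}"
    define g where "g = (\<lambda>(k, t) i. if k = (0::nat) then A t i else if k = 1 then c i t else l i)"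
    define q where "q p = (\<Sum>t\<in>J. p (0, t) * p (1, t)) + p w + \<gamma>0" for p :: "nat \<times> 'a \<Rightarrow> complex"
    have G: "finite G" using fin by (simp add: G_def)
    have cG: "card G = 2 * s + 1"
      unfolding G_def using fin J by (subst card_Un_disjoint) (auto simp: w_def card_cartesian_product)
    have co: "aff G (\<lambda>p. p i)" if "i \<in> G" for i using aff_coord[OF G that, of 0] by simp
    have q: "quad G q"
      unfolding q_def by (intro quad_add quad_sum quad_mult quad_const fin co quad_aff) (auto simp: G_def)
    have d2: "diff2 q (\<lambda>s. g s i) (\<lambda>s. g s j) = B j i + B i j" for i j
      unfolding diff2_def q_def B_def
      by (simp add: g_def w_def algebra_simps sum.distrib)
    have val: "qpoly A U l \<gamma> x = q (fv g U x)" if x: "\<And>i. i \<in> U \<Longrightarrow> x i * x i = 1" for x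
    proof -
      have "(\<Sum>t\<in>J. fv g U x (0, t) * fv g U x (1, t)) = (\<Sum>t\<in>J. \<Sum>i\<in>U. \<Sum>j\<in>U. c j t * A t i * (x i * x j))"
        unfolding fv_def sum_product by (simp add: g_def mult_ac)
      also have "\<dots> = (\<Sum>i\<in>U. \<Sum>t\<in>J. \<Sum>j\<in>U. c j t * A t i * (x i * x j))" by (rule sum.swap)
      also have "\<dots> = (\<Sum>i\<in>U. \<Sum>j\<in>U. B j i * (x i * x j))"
        unfolding B_def sum_distrib_right by (intro sum.cong refl sum.swap)
      also have "\<dots> = (\<Sum>i\<in>U. (\<Sum>j\<in>U. A i j * (x i * x j)) - (A i i - B i i))"
      proof (rule sum.cong)
        fix i assume i: "i \<in> U"
        have "(\<Sum>j\<in>U - {i}. B j i * (x i * x j)) = (\<Sum>j\<in>U - {i}. A i j * (x i * x j))"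
        proof (rule sum.cong)
          fix j assume "j \<in> U - {i}"
          then have "A j i = B j i" using lrB[of i j] i by auto
          then show "B j i * (x i * x j) = A i j * (x i * x j)" using sym by metis
        qed simp
        then show "(\<Sum>j\<in>U. B j i * (x i * x j)) = (\<Sum>j\<in>U. A i j * (x i * x j)) - (A i i - B i i)"
          using i fin x[OF i] by (simp add: sum.remove)
      qed simp
      also have "\<dots> = (\<Sum>i\<in>U. \<Sum>j\<in>U. A i j * (x i * x j)) - (\<Sum>i\<in>U. A i i - B i i)"
        by (rule sum_subtractf)
      finally show ?thesis
        unfolding q_def \<gamma>0_def qpoly_def by (simp add: fv_def g_def w_def)
    qed
    have rich: "\<forall>S\<subseteq>U. card S \<le> (2 * s + 1) * (2 * s + 1) * 2 ^ t \<longrightarrow>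
        (\<exists>i\<in>U - S. \<exists>j\<in>U - S. diff2 q (\<lambda>s. g s i) (\<lambda>s. g s j) \<noteq> 0)"
    proof (intro allI impI)
      fix S assume S: "S \<subseteq> U" "card S \<le> (2 * s + 1) * (2 * s + 1) * 2 ^ t"
      have "card {e\<in>Y. F e \<inter> S \<noteq> {}} < card Y"
        using card_disjoint_hits[OF F(2) finite_subset[OF S(1) fin(1)] F(1)] S(2) Y by linarith
      then have "{e\<in>Y. F e \<inter> S \<noteq> {}} \<noteq> Y" by (metis less_irrefl)
      then obtain e where e: "e \<in> Y" "F e \<inter> S = {}" by blast
      then obtain i j where ij: "i \<in> U" "j \<in> U" "i \<noteq> j" "F e = {i, j}" "A i j \<noteq> 0" using F(3) by blast
      \<comment> \<open>Both orders enter the second difference, which is therefore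
        \<open>2 * A i j\<close> on an edge of the matching that avoids \<open>S\<close>.\<close>
      have "B j i = A i j" "B i j = A i j" using lrB[of i j] lrB[of j i] ij sym by metis+
      then have "diff2 q (\<lambda>s. g s i) (\<lambda>s. g s j) \<noteq> 0" unfolding d2 using ij(5) by simp
      then show "\<exists>i\<in>U - S. \<exists>j\<in>U - S. diff2 q (\<lambda>s. g s i) (\<lambda>s. g s j) \<noteq> 0"
      proof -
        assume d: "diff2 q (\<lambda>s. g s i) (\<lambda>s. g s j) \<noteq> 0"
        have "i \<in> U - S" "j \<in> U - S" using ij(1,2,4) e(2) by blast+
        then show ?thesis using d by blast
      qed
    qed
    have "prb (signs 0 U) (\<lambda>x. qpoly A U l \<gamma> x = 0) = prb (signs 0 U) (\<lambda>x. q (fv g U x) = 0)"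
    proof (rule prb_cong)
      fix x assume "x \<in> set_pmf (signs 0 U)"
      then have "x i * x i = 1" if "i \<in> U" for i using signs_0_values[OF fin(1) _ that] by fastforce
      then show "qpoly A U l \<gamma> x = 0 \<longleftrightarrow> q (fv g U x) = 0" using val by simp
    qed
    also have "\<dots> \<le> C * decay t"
      by (rule main[THEN spec, THEN spec, THEN spec, THEN spec, THEN spec, THEN mp, OF fin(1),
            THEN mp, OF G, THEN mp, OF cG, THEN mp, OF q, THEN mp, OF rich])
    finally show "prb (signs 0 U) (\<lambda>x. qpoly A U l \<gamma> x = 0) \<le> C * decay t" .
  qed
qed

text \<open>The constants for the finitely many ranks below \<open>K\<close> are absorbed into their
  sum.\<close>

lemma low_rank_anticoncentration:
  "\<exists>C\<ge>1. \<forall>t (U :: 'a set) A J c F (Y :: nat set) l \<gamma>.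
     finite U \<longrightarrow> finite J \<longrightarrow> card J < K \<longrightarrow> (\<forall>i j. A i j = A j i) \<longrightarrow>
     (\<forall>i\<in>U. \<forall>j\<in>U. i \<noteq> j \<longrightarrow> A j i = (\<Sum>t\<in>J. c j t * A t i)) \<longrightarrow>
     finite Y \<longrightarrow> disjoint_family_on F Y \<longrightarrow> (\<forall>e\<in>Y. \<exists>i\<in>U. \<exists>j\<in>U. i \<noteq> j \<and> F e = {i, j} \<and> A i j \<noteq> 0) \<longrightarrow>
     (2 * K) * (2 * K) * 2 ^ t < card Y \<longrightarrow>
     prb (signs 0 U) (\<lambda>x. qpoly A U l \<gamma> x = 0) \<le> C * decay t"
proof -
  define Bd where "Bd s C \<longleftrightarrow> (\<forall>t (U :: 'a set) A J c F (Y :: nat set) l \<gamma>.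
     finite U \<longrightarrow> finite J \<longrightarrow> card J = s \<longrightarrow> (\<forall>i j. A i j = A j i) \<longrightarrow>
     (\<forall>i\<in>U. \<forall>j\<in>U. i \<noteq> j \<longrightarrow> A j i = (\<Sum>t\<in>J. c j t * A t i)) \<longrightarrow>
     finite Y \<longrightarrow> disjoint_family_on F Y \<longrightarrow> (\<forall>e\<in>Y. \<exists>i\<in>U. \<exists>j\<in>U. i \<noteq> j \<and> F e = {i, j} \<and> A i j \<noteq> 0) \<longrightarrow>
     (2 * s + 1) * (2 * s + 1) * 2 ^ t < card Y \<longrightarrow>
     prb (signs 0 U) (\<lambda>x. qpoly A U l \<gamma> x = 0) \<le> C * decay t)" for s C
  have "\<exists>C\<ge>1. Bd s C" for s
    unfolding Bd_def by (rule low_rank_anticoncentration_exact)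
  then obtain C where C: "\<And>s. C s \<ge> (1::real)" and "\<And>s. Bd s (C s)" by metis
  note main = this(2)[unfolded Bd_def]
  define C' where "C' = (\<Sum>s<K. C s) + 1"
  have pos: "(\<Sum>s<K. C s) \<ge> 0" by (rule sum_nonneg) (use C in \<open>auto intro: order_trans[of 0 1]\<close>)
  have le: "C s \<le> C'" if "s < K" for s
  proof -
    have "C s \<le> (\<Sum>s<K. C s)"
      by (rule member_le_sum) (use that C in \<open>auto intro: order_trans[of 0 1]\<close>)
    then show ?thesis by (simp add: C'_def)
  qed
  show ?thesis
  proof (intro exI[of _ C'] conjI allI impI)
    show "C' \<ge> 1" using pos by (simp add: C'_def)
    fix t :: nat and U :: "'a set" and A :: "'a \<Rightarrow> 'a \<Rightarrow> complex" and J c F and Y :: "nat set" and l \<gamma>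
    assume a: "finite U" "finite J" and J: "card J < K" and b: "\<forall>i j. A i j = A j i"
      "\<forall>i\<in>U. \<forall>j\<in>U. i \<noteq> j \<longrightarrow> A j i = (\<Sum>t\<in>J. c j t * A t i)"
      "finite Y" "disjoint_family_on F Y" "\<forall>e\<in>Y. \<exists>i\<in>U. \<exists>j\<in>U. i \<noteq> j \<and> F e = {i, j} \<and> A i j \<noteq> 0"
      and Y: "(2 * K) * (2 * K) * 2 ^ t < card Y"
    have "(2 * card J + 1) * (2 * card J + 1) * 2 ^ t \<le> (2 * K) * (2 * K) * 2 ^ t"
      by (intro mult_right_mono mult_mono) (use J in auto)
    then have "(2 * card J + 1) * (2 * card J + 1) * 2 ^ t < card Y" using Y by (rule le_less_trans)
    then have "prb (signs 0 U) (\<lambda>x. qpoly A U l \<gamma> x = 0) \<le> C (card J) * decay t"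
      using main[of "card J"] a b by blast
    also have "\<dots> \<le> C' * decay t" using le[OF J] by (intro mult_right_mono) auto
    finally show "prb (signs 0 U) (\<lambda>x. qpoly A U l \<gamma> x = 0) \<le> C' * decay t" .
  qed
qed

text \<open>The variables are restricted to the ends of a matching that avoids the exceptional sets
  \<open>S j\<close>. There the relations hold for all off-diagonal entries, and the matching
  provides the nonzero entries that no small deletion destroys.\<close>

theorem low_rank_case:
  "\<exists>C\<ge>1. \<forall>t (V :: nat set) A D0 J0 c S D \<rho> T l \<gamma>.
     finite V \<longrightarrow> (\<forall>i j. A i j = A j i) \<longrightarrow> finite J0 \<longrightarrow> card J0 < K \<longrightarrow> V - D0 - J0 \<noteq> {} \<longrightarrow>
     (\<forall>j\<in>V - D0 - J0. S j \<subseteq> V \<and> card (S j) \<le> D \<and>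
               (\<forall>i\<in>V - S j. A j i = (\<Sum>t\<in>J0. c j t * A t i))) \<longrightarrow>
     (\<forall>i\<in>V - D0 - J0. \<rho> \<le> card {j\<in>V - D0 - J0. j \<noteq> i \<and> A i j \<noteq> 0}) \<longrightarrow>
     4 * T + 2 * D < \<rho> \<longrightarrow> (4 * D + 1) * ((2 * K) * (2 * K) * 2 ^ t) < T \<longrightarrow>
     prb (signs 0 V) (\<lambda>x. qpoly A V l \<gamma> x = 0) \<le> C * decay t"
proof -
  obtain C where C: "C \<ge> 1" and main: "\<forall>t (U :: nat set) A J c F (Y :: nat set) l \<gamma>.
     finite U \<longrightarrow> finite J \<longrightarrow> card J < K \<longrightarrow> (\<forall>i j. A i j = A j i) \<longrightarrow>
     (\<forall>i\<in>U. \<forall>j\<in>U. i \<noteq> j \<longrightarrow> A j i = (\<Sum>t\<in>J. c j t * A t i)) \<longrightarrow>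
     finite Y \<longrightarrow> disjoint_family_on F Y \<longrightarrow> (\<forall>e\<in>Y. \<exists>i\<in>U. \<exists>j\<in>U. i \<noteq> j \<and> F e = {i, j} \<and> A i j \<noteq> 0) \<longrightarrow>
     (2 * K) * (2 * K) * 2 ^ t < card Y \<longrightarrow>
     prb (signs 0 U) (\<lambda>x. qpoly A U l \<gamma> x = 0) \<le> C * decay t"
    using low_rank_anticoncentration[where K = K and ?'a = nat] by blast
  show ?thesis
  proof (intro exI[of _ C] conjI C allI impI)
    fix t :: nat and V :: "nat set" and A :: "nat \<Rightarrow> nat \<Rightarrow> complex" and D0 J0 c S D \<rho> T l \<gamma>
    assume fin: "finite V" and sym: "\<forall>i j. A i j = A j i" and J0: "finite J0" "card J0 < K"
      and ne: "V - D0 - J0 \<noteq> {}"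
      and S: "\<forall>j\<in>V - D0 - J0. S j \<subseteq> V \<and> card (S j) \<le> D \<and>
               (\<forall>i\<in>V - S j. A j i = (\<Sum>t\<in>J0. c j t * A t i))"
      and deg: "\<forall>i\<in>V - D0 - J0. \<rho> \<le> card {j\<in>V - D0 - J0. j \<noteq> i \<and> A i j \<noteq> 0}"
      and \<rho>: "4 * T + 2 * D < \<rho>" and T: "(4 * D + 1) * ((2 * K) * (2 * K) * 2 ^ t) < T"
    let ?W = "V - D0 - J0"
    have "\<exists>F (Y :: nat set). finite Y \<and> disjoint_family_on F Y \<and>
       (\<forall>e\<in>Y. \<exists>i\<in>?W. \<exists>j\<in>?W. i \<noteq> j \<and> F e = {i, j} \<and> A i j \<noteq> 0) \<and> T \<le> (4 * D + 1) * card Y \<and>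
       (\<forall>u\<in>\<Union>(F ` Y). \<forall>v\<in>\<Union>(F ` Y). u \<noteq> v \<longrightarrow> u \<notin> S v)"
    proof (rule sparse_avoiding_matching[OF _ ne _ _ \<rho>])
      show "finite (S j) \<and> card (S j) \<le> D" if "j \<in> ?W" for j
        using S that finite_subset[OF _ fin] by blast
    qed (use fin deg in auto)
    then obtain F and Y :: "nat set" where Y: "finite Y" "disjoint_family_on F Y"
       "\<forall>e\<in>Y. \<exists>i\<in>?W. \<exists>j\<in>?W. i \<noteq> j \<and> F e = {i, j} \<and> A i j \<noteq> 0" "T \<le> (4 * D + 1) * card Y"
       and av: "\<forall>u\<in>\<Union>(F ` Y). \<forall>v\<in>\<Union>(F ` Y). u \<noteq> v \<longrightarrow> u \<notin> S v" by blast
    define U where "U = \<Union>(F ` Y)"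
    have UW: "U \<subseteq> ?W"
    proof
      fix u assume "u \<in> U"
      then obtain e where "e \<in> Y" "u \<in> F e" by (auto simp: U_def)
      then show "u \<in> ?W" using Y(3) by fastforce
    qed
    have finU: "finite U" using UW fin by (meson finite_Diff finite_subset)
    have lr: "\<forall>i\<in>U. \<forall>j\<in>U. i \<noteq> j \<longrightarrow> A j i = (\<Sum>t\<in>J0. c j t * A t i)"
    proof (intro ballI impI)
      fix i j assume ij: "i \<in> U" "j \<in> U" "i \<noteq> j"
      then have "i \<in> V - S j" "j \<in> ?W" using av UW unfolding U_def[symmetric] by auto
      then show "A j i = (\<Sum>t\<in>J0. c j t * A t i)" using S by blast
    qed
    have edges: "\<forall>e\<in>Y. \<exists>i\<in>U. \<exists>j\<in>U. i \<noteq> j \<and> F e = {i, j} \<and> A i j \<noteq> 0"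
    proof
      fix e assume e: "e \<in> Y"
      then obtain i j where "i \<noteq> j" "F e = {i, j}" "A i j \<noteq> 0" using Y(3) by blast
      moreover have "i \<in> U" "j \<in> U" using e calculation(2) unfolding U_def by blast+
      ultimately show "\<exists>i\<in>U. \<exists>j\<in>U. i \<noteq> j \<and> F e = {i, j} \<and> A i j \<noteq> 0" by blast
    qed
    have "(4 * D + 1) * ((2 * K) * (2 * K) * 2 ^ t) < (4 * D + 1) * card Y" using T Y(4) by (rule less_le_trans)
    then have cY: "(2 * K) * (2 * K) * 2 ^ t < card Y" by (subst (asm) nat_mult_less_cancel1) auto
    show "prb (signs 0 V) (\<lambda>x. qpoly A V l \<gamma> x = 0) \<le> C * decay t"
    proof (rule qpoly_restrict_bound[OF fin])
      show "U \<subseteq> V" using UW by blast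
      show "prb (signs 0 U) (\<lambda>x. qpoly A U l \<gamma> x = 0) \<le> C * decay t" for l \<gamma>
        using main finU J0 sym lr Y(1,2) edges cY by blast
    qed (use C sym in auto)
  qed
qed

section \<open>Iterated decoupling in the high rank case\<close>

text \<open>Markov's inequality for the number of bad indices.\<close>

lemma prb_markov_half:
  assumes "finite G" "\<And>i. i \<in> G \<Longrightarrow> prb p (Bi i) \<le> \<theta>" "G \<noteq> {}"
  shows "prb p (\<lambda>z. card G \<le> 2 * card {i\<in>G. Bi i z}) \<le> 2 * \<theta>"
proof -
  have int: "integrable (measure_pmf p) (indicator X :: _ \<Rightarrow> real)" for X
    by (rule measure_pmf.integrable_const_bound[where B = 1]) auto
  let ?E = "{z. card G \<le> 2 * card {i\<in>G. Bi i z}}"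
  have cG: "real (card G) > 0" using assms by (simp add: card_gt_0_iff)
  have cnt: "real (card {i\<in>G. Bi i z}) = (\<Sum>i\<in>G. indicator {z. Bi i z} z)" for z
    using assms(1) by (simp add: indicator_def sum.If_cases Int_def)
  have "real (card G) * prb p (\<lambda>z. card G \<le> 2 * card {i\<in>G. Bi i z})
      = measure_pmf.expectation p (\<lambda>z. real (card G) * indicator ?E z)"
    by simp
  also have "\<dots> \<le> measure_pmf.expectation p (\<lambda>z. 2 * (\<Sum>i\<in>G. indicator {z. Bi i z} z))"
  proof (rule integral_mono)
    show "real (card G) * indicator ?E z \<le> 2 * (\<Sum>i\<in>G. indicator {z. Bi i z} z)" for z
      unfolding cnt[symmetric] by (auto simp: indicator_def)
  qed (auto intro!: int integrable_mult_right Bochner_Integration.integrable_sum)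
  also have "\<dots> = 2 * (\<Sum>i\<in>G. prb p (Bi i))"
    by (simp add: Bochner_Integration.integral_sum int)
  also have "\<dots> \<le> 2 * (\<Sum>i\<in>G. \<theta>)" by (intro mult_left_mono sum_mono assms) auto
  also have "\<dots> = real (card G) * (2 * \<theta>)" by simp
  finally show ?thesis using cG by (subst (asm) mult_le_cancel_left_pos)
qed

lemma indep_eliminate:
  assumes "indep J a B" "finite J" "j0 \<in> J"
  shows "indep (J - {j0}) (\<lambda>j i. a j i - r j * a j0 i) B"
  unfolding indep_def
proof (intro allI impI ballI)
  fix \<mu> k assume *: "\<forall>i\<in>B. (\<Sum>j\<in>J - {j0}. \<mu> j * (a j i - r j * a j0 i)) = 0" and k: "k \<in> J - {j0}"
  define \<nu> where "\<nu> = \<mu>(j0 := - (\<Sum>j\<in>J - {j0}. \<mu> j * r j))"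
  have "\<nu> k = 0"
  proof (rule indepD[OF assms(1)])
    fix i assume i: "i \<in> B"
    have "(\<Sum>j\<in>J. \<nu> j * a j i) = \<nu> j0 * a j0 i + (\<Sum>j\<in>J - {j0}. \<nu> j * a j i)"
      using assms by (simp add: sum.remove)
    also have "(\<Sum>j\<in>J - {j0}. \<nu> j * a j i) = (\<Sum>j\<in>J - {j0}. \<mu> j * a j i)"
      by (rule sum.cong) (auto simp: \<nu>_def)
    also have "\<nu> j0 * a j0 i = - (\<Sum>j\<in>J - {j0}. \<mu> j * (r j * a j0 i))"
      by (simp add: \<nu>_def sum_distrib_right mult.assoc)
    finally have "(\<Sum>j\<in>J. \<nu> j * a j i) = (\<Sum>j\<in>J - {j0}. \<mu> j * (a j i - r j * a j0 i))"
      by (simp add: right_diff_distrib sum_subtractf)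
    then show "(\<Sum>j\<in>J. \<nu> j * a j i) = 0" using * i by simp
  qed (use k in auto)
  then show "\<mu> k = 0" using k by (simp add: \<nu>_def)
qed

text \<open>The values must lie in an affine subspace with \<open>card S\<close> parameters
  \<open>\<kappa>\<close>. A parameter is eliminated by subtracting multiples of one equation
  \<open>j0\<close> with \<open>l s j0 \<noteq> 0\<close>, at the cost of that equation;
  \<open>robust_halasz\<close> applies to what remains.\<close>

lemma prb_span_hit:
  assumes "finite S" "finite J" "finite V" "robust T J a V"
  shows "prb (signs 0 V) (\<lambda>z. \<exists>\<kappa>. \<forall>j\<in>J. fv a V z j = h j + (\<Sum>s\<in>S. \<kappa> s * l s j))
          \<le> decay T ^ (card J - card S)"
  using assms
proof (induction S arbitrary: J a h l rule: finite_induct)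
  case empty
  then show ?case using robust_halasz[of V J T a h] by simp
next
  case (insert s S)
  show ?case
  proof (cases "\<exists>j0\<in>J. l s j0 \<noteq> 0")
    case False
    have "prb (signs 0 V) (\<lambda>z. \<exists>\<kappa>. \<forall>j\<in>J. fv a V z j = h j + (\<Sum>s\<in>insert s S. \<kappa> s * l s j))
        \<le> prb (signs 0 V) (\<lambda>z. \<exists>\<kappa>. \<forall>j\<in>J. fv a V z j = h j + (\<Sum>s\<in>S. \<kappa> s * l s j))"
      by (rule prb_mono) (use False insert.hyps in auto)
    also have "\<dots> \<le> decay T ^ (card J - card S)" using insert by blast
    also have "\<dots> \<le> decay T ^ (card J - card (insert s S))"
      by (rule power_decreasing) (use insert.hyps decay_le_1 in auto)
    finally show ?thesis .
  next
    case True
    then obtain j0 where j0: "j0 \<in> J" "l s j0 \<noteq> 0" by blast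
    define r where "r j = l s j / l s j0" for j
    define a' where "a' = (\<lambda>j i. a j i - r j * a j0 i)"
    define h' where "h' j = h j - r j * h j0" for j
    define l' where "l' t j = l t j - r j * l t j0" for t j
    have fva: "fv a' V z j = fv a V z j - r j * fv a V z j0" for z j
      by (simp add: fv_def a'_def left_diff_distrib sum_subtractf sum_distrib_left mult.assoc)
    have rob: "robust T (J - {j0}) a' V"
    proof -
      obtain I :: "nat set" and B where I: "finite I" "card I = 2 ^ T" "disjoint_family_on B I"
        "\<forall>i\<in>I. B i \<subseteq> V \<and> indep J a (B i)"
        using insert.prems(3) unfolding robust_def by blast
      then have "\<forall>i\<in>I. B i \<subseteq> V \<and> indep (J - {j0}) a' (B i)"
        using indep_eliminate[OF _ insert.prems(1) j0(1)] unfolding a'_def by blast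
      then show ?thesis unfolding robust_def using I by blast
    qed
    have "prb (signs 0 V) (\<lambda>z. \<exists>\<kappa>. \<forall>j\<in>J. fv a V z j = h j + (\<Sum>s\<in>insert s S. \<kappa> s * l s j))
        \<le> prb (signs 0 V) (\<lambda>z. \<exists>\<kappa>. \<forall>j\<in>J - {j0}. fv a' V z j = h' j + (\<Sum>s\<in>S. \<kappa> s * l' s j))"
    proof (rule prb_mono)
      fix z assume "\<exists>\<kappa>. \<forall>j\<in>J. fv a V z j = h j + (\<Sum>s\<in>insert s S. \<kappa> s * l s j)"
      then obtain \<kappa> where *: "\<And>j. j \<in> J \<Longrightarrow> fv a V z j = h j + (\<Sum>s\<in>insert s S. \<kappa> s * l s j)" by blast
      have "fv a' V z j = h' j + (\<Sum>s\<in>S. \<kappa> s * l' s j)" if "j \<in> J" for j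
      proof -
        have e1: "fv a V z j = h j + (\<kappa> s * l s j + (\<Sum>s\<in>S. \<kappa> s * l s j))"
          using *[OF that] insert.hyps by simp
        have e2: "fv a V z j0 = h j0 + (\<kappa> s * l s j0 + (\<Sum>s\<in>S. \<kappa> s * l s j0))"
          using *[OF j0(1)] insert.hyps by simp
        have "(\<Sum>s\<in>S. \<kappa> s * l' s j) = (\<Sum>s\<in>S. \<kappa> s * l s j) - r j * (\<Sum>s\<in>S. \<kappa> s * l s j0)"
          by (simp add: l'_def right_diff_distrib sum_subtractf sum_distrib_left mult.left_commute)
        moreover have lsj: "l s j = r j * l s j0" using j0(2) by (simp add: r_def)
        ultimately show ?thesis
          unfolding fva e1 e2 h'_def lsj by (simp add: algebra_simps)
      qed
      then show "\<exists>\<kappa>. \<forall>j\<in>J - {j0}. fv a' V z j = h' j + (\<Sum>s\<in>S. \<kappa> s * l' s j)" by blast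
    qed
    also have "\<dots> \<le> decay T ^ (card (J - {j0}) - card S)"
      by (rule insert.IH) (use insert.prems rob in auto)
    also have "card (J - {j0}) - card S = card J - card (insert s S)"
      using insert.hyps j0(1) insert.prems(1) by simp
    finally show ?thesis .
  qed
qed

text \<open>Level \<open>k\<close> of the tower decouples the variables in \<open>V k\<close> from those in the later sets. The blocks \<open>J b i\<close> witness that the
linear forms created so far remain independent on \<open>V b\<close>; each level may destroy half of them. By \<open>robJ\<close>, a given
block is destroyed with probability only \<open>decay T1 ^ (K - k)\<close>.\<close>

locale tower =
  fixes A :: "nat \<Rightarrow> nat \<Rightarrow> complex" and V :: "nat \<Rightarrow> nat set" and J :: "nat \<Rightarrow> nat \<Rightarrow> nat set"
    and T T1 K K0 :: nat and Bd :: "nat \<Rightarrow> real"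
  assumes sym: "\<And>i j. A i j = A j i"
    and finV: "\<And>b. b \<le> K0 \<Longrightarrow> finite (V b)"
    and disjV: "\<And>a b. a \<le> K0 \<Longrightarrow> b \<le> K0 \<Longrightarrow> a \<noteq> b \<Longrightarrow> V a \<inter> V b = {}"
    and K0T: "K0 \<le> T" and K0pos: "K0 \<ge> 1"
    and JV: "\<And>b i. 1 \<le> b \<Longrightarrow> b \<le> K0 \<Longrightarrow> i < 2 ^ T \<Longrightarrow> J b i \<subseteq> V b"
    and cardJ: "\<And>b i. 1 \<le> b \<Longrightarrow> b \<le> K0 \<Longrightarrow> i < 2 ^ T \<Longrightarrow> card (J b i) = K"
    and disjJ: "\<And>b. 1 \<le> b \<Longrightarrow> b \<le> K0 \<Longrightarrow> disjoint_family_on (J b) {..<2 ^ T}"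
    and robJ: "\<And>a b i. a < b \<Longrightarrow> b \<le> K0 \<Longrightarrow> i < 2 ^ T \<Longrightarrow> robust T1 (J b i) A (V a)"
    and Bd_nonneg: "\<And>k. Bd k \<ge> 0"
    and Bd_step: "\<And>k. k < K0 \<Longrightarrow> Bd (Suc k) * decay (T - k) ^ k + real K0 * (2 * decay T1 ^ (K - k)) \<le> (Bd k)\<^sup>2"
    and Bd_top: "decay (T - K0) ^ K0 \<le> Bd K0"
begin

definition W :: "nat \<Rightarrow> nat set" where
  "W k = (\<Union>b\<in>{k..K0}. V b)"

definition spread :: "nat \<Rightarrow> (nat \<Rightarrow> nat \<Rightarrow> complex) \<Rightarrow> nat \<Rightarrow> bool" where
  "spread k l b \<longleftrightarrow> (\<exists>G\<subseteq>{..<2 ^ T}. card G = 2 ^ (T - k) \<and> (\<forall>i\<in>G. indep {..<k} l (J b i)))"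

lemma finW: "finite (W k)"
  using finV by (auto simp: W_def)

lemma spread_robust:
  assumes "spread k l b" "1 \<le> b" "b \<le> K0"
  shows "robust (T - k) {..<k} l (V b)"
proof -
  obtain G where G: "G \<subseteq> {..<2 ^ T}" "card G = 2 ^ (T - k)" "\<forall>i\<in>G. indep {..<k} l (J b i)"
    using assms(1) unfolding spread_def by blast
  have "\<forall>i\<in>G. J b i \<subseteq> V b" using JV[OF assms(2,3)] G(1) by auto
  moreover have "disjoint_family_on (J b) G" using G(1) disjJ[OF assms(2,3)] by (rule disjoint_family_on_mono)
  moreover have "finite G" using G(1) by (rule finite_subset) simp
  ultimately show ?thesis unfolding robust_def using G(2,3) by blast
qed

text \<open>Level 0 carries no forms, so blocks are only needed in \<open>V b\<close> for
  \<open>b \<ge> 1\<close>.\<close>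

lemma stage_halasz:
  assumes "k \<le> K0" "k \<ge> 1 \<Longrightarrow> spread k l k"
  shows "prb (signs 0 (V k)) (\<lambda>x. \<forall>s<k. fv l (V k) x s = c s) \<le> decay (T - k) ^ k"
proof (cases "k = 0")
  case False
  then have "robust (T - k) {..<k} l (V k)" using spread_robust assms by simp
  then have "prb (signs 0 (V k)) (\<lambda>x. \<forall>s\<in>{..<k}. fv l (V k) x s = c s) \<le> decay (T - k) ^ card {..<k}"
    by (intro robust_halasz finV assms) auto
  then show ?thesis by (simp add: Ball_def)
qed simp

lemma not_indep_span:
  assumes "indep {..<k} l B" "\<not> indep {..<Suc k} (l(k := m)) B"
  shows "\<exists>\<kappa>. \<forall>j\<in>B. m j = (\<Sum>s<k. \<kappa> s * l s j)"
proof -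
  obtain \<mu> s0 where s0: "s0 < Suc k" "\<mu> s0 \<noteq> 0"
    and \<mu>0: "\<And>j. j \<in> B \<Longrightarrow> (\<Sum>s<Suc k. \<mu> s * (l(k := m)) s j) = 0"
    using assms(2) unfolding indep_def by auto
  have \<mu>: "(\<Sum>s<k. \<mu> s * l s j) + \<mu> k * m j = 0" if "j \<in> B" for j
  proof -
    have "(\<Sum>s<k. \<mu> s * (l(k := m)) s j) = (\<Sum>s<k. \<mu> s * l s j)" by (rule sum.cong) auto
    then show ?thesis using \<mu>0[OF that] by simp
  qed
  have "\<mu> k \<noteq> 0"
  proof
    assume k: "\<mu> k = 0"
    have "\<mu> s = 0" if "s < k" for s
      by (rule indepD[OF assms(1)]) (use \<mu> k that in auto)
    then show False using s0 k by (auto simp: less_Suc_eq)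
  qed
  have "m j = (\<Sum>s<k. (- \<mu> s / \<mu> k) * l s j)" if "j \<in> B" for j
  proof -
    have "(\<Sum>s<k. \<mu> s * l s j) = - (\<mu> k * m j)" using \<mu>[OF that] by (simp add: eq_neg_iff_add_eq_0)
    moreover have "(\<Sum>s<k. (- \<mu> s / \<mu> k) * l s j) = - (\<Sum>s<k. \<mu> s * l s j) / \<mu> k"
      by (simp add: sum_divide_distrib sum_negf)
    ultimately show ?thesis using \<open>\<mu> k \<noteq> 0\<close> by simp
  qed
  then show ?thesis by (intro exI[of _ "\<lambda>s. - \<mu> s / \<mu> k"] ballI)
qed

text \<open>What remains, in the later variables, of the difference of the equations for
  \<open>z\<close> and \<open>z'\<close>: the quadratic parts cancel, and the 2 is that of
  \<open>qpoly_mix\<close>.\<close>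

definition next_form :: "nat \<Rightarrow> (nat \<Rightarrow> complex) \<Rightarrow> (nat \<Rightarrow> complex) \<Rightarrow> nat \<Rightarrow> complex" where
  "next_form k z z' j = 2 * (\<Sum>i\<in>V k. (z i - z' i) * A i j)"

text \<open>A block is lost only if the new form, restricted to it, falls into the span of the
  \<open>k\<close> old forms. For fixed \<open>z'\<close> this confines \<open>K\<close> robust
  forms in \<open>z\<close> to an affine subspace with \<open>k\<close> parameters. Markov's
  inequality then bounds the chance of losing half of the blocks.\<close>

lemma prb_not_spread:
  assumes k: "k < b" "b \<le> K0" and sp: "spread k l b"
  shows "prb (signs 0 (V k)) (\<lambda>z. \<not> spread (Suc k) (l(k := next_form k z z')) b) \<le> 2 * decay T1 ^ (K - k)"
proof -
  obtain G where G: "G \<subseteq> {..<2 ^ T}" "card G = 2 ^ (T - k)" "\<forall>i\<in>G. indep {..<k} l (J b i)"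
    using sp unfolding spread_def by blast
  have finG: "finite G" using G(1) by (rule finite_subset) simp
  define Bi where "Bi i z \<longleftrightarrow> \<not> indep {..<Suc k} (l(k := next_form k z z')) (J b i)" for i z
  have Tk: "T - k = Suc (T - Suc k)" using k K0T by simp
  have Bi: "prb (signs 0 (V k)) (Bi i) \<le> decay T1 ^ (K - k)" if i: "i \<in> G" for i
  proof -
    have iT: "i < 2 ^ T" using i G(1) by auto
    have "J b i \<subseteq> V b" by (rule JV) (use k iT in auto)
    then have fJ: "finite (J b i)" by (rule finite_subset) (use finV k in auto)
    have "prb (signs 0 (V k)) (Bi i) \<le> prb (signs 0 (V k))
       (\<lambda>z. \<exists>\<kappa>. \<forall>j\<in>J b i. fv A (V k) z j = fv A (V k) z' j + (\<Sum>s\<in>{..<k}. \<kappa> s * l s j))"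
    proof (rule prb_mono)
      fix z assume "Bi i z"
      then obtain \<kappa> where \<kappa>: "\<And>j. j \<in> J b i \<Longrightarrow> next_form k z z' j = (\<Sum>s<k. \<kappa> s * l s j)"
        using not_indep_span[of k l "J b i" "next_form k z z'"] G(3) i unfolding Bi_def by blast
      have "fv A (V k) z j = fv A (V k) z' j + (\<Sum>s\<in>{..<k}. (\<kappa> s / 2) * l s j)" if "j \<in> J b i" for j
      proof -
        have "next_form k z z' j = 2 * (fv A (V k) z j - fv A (V k) z' j)"
          unfolding next_form_def fv_def by (simp add: sym[of _ j] right_diff_distrib left_diff_distrib sum_subtractf mult.commute)
        then have "2 * (fv A (V k) z j - fv A (V k) z' j) = (\<Sum>s<k. \<kappa> s * l s j)" using \<kappa>[OF that] by simp
        then have "fv A (V k) z j - fv A (V k) z' j = (\<Sum>s<k. \<kappa> s * l s j) / 2" by (simp add: field_simps)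
        also have "\<dots> = (\<Sum>s<k. (\<kappa> s / 2) * l s j)" by (simp add: sum_divide_distrib)
        finally show ?thesis by (simp add: algebra_simps)
      qed
      then show "\<exists>\<kappa>. \<forall>j\<in>J b i. fv A (V k) z j = fv A (V k) z' j + (\<Sum>s\<in>{..<k}. \<kappa> s * l s j)"
        by (intro exI[of _ "\<lambda>s. \<kappa> s / 2"]) blast
    qed
    also have "\<dots> \<le> decay T1 ^ (card (J b i) - card {..<k})"
      by (rule prb_span_hit) (use fJ finV k robJ iT in auto)
    also have "card (J b i) - card {..<k} = K - k" using cardJ[of b i] k iT by simp
    finally show ?thesis .
  qed
  have "prb (signs 0 (V k)) (\<lambda>z. \<not> spread (Suc k) (l(k := next_form k z z')) b)
      \<le> prb (signs 0 (V k)) (\<lambda>z. card G \<le> 2 * card {i\<in>G. Bi i z})"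
  proof (rule prb_mono)
    fix z assume ns: "\<not> spread (Suc k) (l(k := next_form k z z')) b"
    show "card G \<le> 2 * card {i\<in>G. Bi i z}"
    proof (rule ccontr)
      assume "\<not> ?thesis"
      moreover have "card G = card {i\<in>G. Bi i z} + card {i\<in>G. \<not> Bi i z}"
        using finG by (subst card_Un_disjoint[symmetric]) (auto intro: arg_cong[where f = card])
      ultimately have "2 ^ (T - Suc k) \<le> card {i\<in>G. \<not> Bi i z}" using G(2) Tk by simp
      then obtain G' where G': "G' \<subseteq> {i\<in>G. \<not> Bi i z}" "card G' = 2 ^ (T - Suc k)"
        using obtain_subset_with_card_n by metis
      have "spread (Suc k) (l(k := next_form k z z')) b"
        unfolding spread_def using G' G(1) by (intro exI[of _ G']) (auto simp: Bi_def)
      then show False using ns by simp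
    qed
  qed
  also have "\<dots> \<le> 2 * decay T1 ^ (K - k)"
    by (rule prb_markov_half) (use finG Bi G(2) in auto)
  finally show ?thesis .
qed

text \<open>At level \<open>k\<close>, \<open>V k\<close> plays the part of \<open>z\<close> and the
  later sets that of \<open>y\<close>. Good pairs replace \<open>k\<close> prescribed forms by
  \<open>k + 1\<close> and keep the quadratic equation; it is given up only at level
  \<open>K0\<close>, where the linear forms alone suffice.\<close>

theorem tower_bound:
  assumes "k \<le> K0" "\<And>b. k \<le> b \<Longrightarrow> 1 \<le> b \<Longrightarrow> b \<le> K0 \<Longrightarrow> spread k l b"
  shows "prb (signs 0 (W k)) (\<lambda>x. (\<forall>s<k. fv l (W k) x s = c s) \<and> qpoly A (W k) f \<gamma> x = 0) \<le> Bd k"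
  using assms
proof (induction "K0 - k" arbitrary: k l c f \<gamma>)
  case 0
  then have k: "k = K0" by simp
  have W: "W k = V k" by (simp add: W_def k)
  have "prb (signs 0 (W k)) (\<lambda>x. (\<forall>s<k. fv l (W k) x s = c s) \<and> qpoly A (W k) f \<gamma> x = 0)
     \<le> prb (signs 0 (V k)) (\<lambda>x. \<forall>s<k. fv l (V k) x s = c s)"
    unfolding W by (rule prb_mono) simp
  also have "\<dots> \<le> decay (T - k) ^ k"
    by (rule stage_halasz) (use 0 k in auto)
  also have "\<dots> \<le> Bd k" using Bd_top k by simp
  finally show ?case .
next
  case (Suc d)
  have k: "k < K0" using Suc.hyps(2) by simp
  let ?Y = "W (Suc k)" and ?Z = "V k"
  have WYZ: "W k = ?Y \<union> ?Z"
    unfolding W_def using k by (auto simp: atLeastAtMost_insertL[symmetric] Suc_le_eq le_eq_less_or_eq)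
  have fin: "finite ?Y" "finite ?Z" using finW finV k by auto
  have disj: "?Y \<inter> ?Z = {}" using disjV[of _ k] k by (fastforce simp: W_def)
  define Ev where "Ev x \<longleftrightarrow> (\<forall>s<k. fv l (W k) x s = c s) \<and> qpoly A (W k) f \<gamma> x = 0" for x
  define N where "N z z' \<longleftrightarrow> (\<forall>s<k. fv l ?Z z s = fv l ?Z z' s)" for z z'
  define Bad where "Bad z z' \<longleftrightarrow> (\<exists>b\<in>{Suc k..K0}. \<not> spread (Suc k) (l(k := next_form k z z')) b)" for z z'
  have Ev: "Ev (mix ?Y y z) \<longleftrightarrow> (\<forall>s<k. fv l ?Y y s + fv l ?Z z s = c s) \<and>
     qpoly A ?Y (\<lambda>i. f i + 2 * (\<Sum>j\<in>?Z. z j * A j i)) (qpoly A ?Z f \<gamma> z) y = 0" for y z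
    unfolding Ev_def WYZ fv_mix[OF fin disj] qpoly_mix[OF fin disj sym] ..
  have N: "prb (signs 0 ?Z) (\<lambda>z. N z z') \<le> decay (T - k) ^ k" for z'
    unfolding N_def by (rule stage_halasz) (use k Suc.prems in auto)
  have bad: "prb (signs 0 ?Z) (\<lambda>z. N z z' \<and> Bad z z') \<le> real K0 * (2 * decay T1 ^ (K - k))" for z'
  proof -
    \<comment> \<open>The agreement \<open>N\<close> is given up here: the exponent
      \<open>K - k\<close> alone makes the bad pairs negligible.\<close>
    have "prb (signs 0 ?Z) (\<lambda>z. N z z' \<and> Bad z z') \<le> prb (signs 0 ?Z) (\<lambda>z. Bad z z')"
      by (rule prb_mono) auto
    also have "\<dots> \<le> (\<Sum>b\<in>{Suc k..K0}. prb (signs 0 ?Z) (\<lambda>z. \<not> spread (Suc k) (l(k := next_form k z z')) b))"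
      unfolding Bad_def by (rule prb_Bex) simp
    also have "\<dots> \<le> (\<Sum>b\<in>{Suc k..K0}. 2 * decay T1 ^ (K - k))"
      by (intro sum_mono prb_not_spread Suc.prems(2)) auto
    also have "\<dots> \<le> real K0 * (2 * decay T1 ^ (K - k))"
      by (simp add: mult_right_mono)
    finally show ?thesis .
  qed
  have step: "prb (signs 0 ?Y) (\<lambda>y. Ev (mix ?Y y z) \<and> Ev (mix ?Y y z'))
     \<le> (if N z z' then if Bad z z' then 1 else Bd (Suc k) else 0)" for z z'
  proof -
    consider "\<not> N z z'" | "N z z'" "Bad z z'" | "N z z'" "\<not> Bad z z'" by blast
    then show ?thesis
    proof cases
      case 1
      have "\<not> (Ev (mix ?Y y z) \<and> Ev (mix ?Y y z'))" for y
      proof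
        assume ev: "Ev (mix ?Y y z) \<and> Ev (mix ?Y y z')"
        have "fv l ?Z z s = fv l ?Z z' s" if "s < k" for s
        proof -
          have "fv l ?Y y s + fv l ?Z z s = c s" "fv l ?Y y s + fv l ?Z z' s = c s"
            using ev that unfolding Ev by auto
          then show ?thesis by (metis add_left_imp_eq)
        qed
        then show False using 1 unfolding N_def by simp
      qed
      then have "{y. Ev (mix ?Y y z) \<and> Ev (mix ?Y y z')} = {}" by blast
      then show ?thesis using 1 by (simp only: measure_empty if_False)
    next
      case 2
      then show ?thesis by simp
    next
      case 3
      define l' where "l' = l(k := next_form k z z')"
      define c' where "c' s = (if s = k then qpoly A ?Z f \<gamma> z' - qpoly A ?Z f \<gamma> z else c s - fv l ?Z z s)" for s
      have sp: "spread (Suc k) l' b" if "Suc k \<le> b" "1 \<le> b" "b \<le> K0" for b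
        using 3 that unfolding Bad_def l'_def by auto
      have "prb (signs 0 ?Y) (\<lambda>y. Ev (mix ?Y y z) \<and> Ev (mix ?Y y z'))
        \<le> prb (signs 0 ?Y) (\<lambda>y. (\<forall>s<Suc k. fv l' ?Y y s = c' s) \<and>
            qpoly A ?Y (\<lambda>i. f i + 2 * (\<Sum>j\<in>?Z. z j * A j i)) (qpoly A ?Z f \<gamma> z) y = 0)"
      proof (rule prb_mono)
        fix y assume ev: "Ev (mix ?Y y z) \<and> Ev (mix ?Y y z')"
        have q: "qpoly A ?Y (\<lambda>i. f i + 2 * (\<Sum>j\<in>?Z. z j * A j i)) (qpoly A ?Z f \<gamma> z) y = 0"
          "qpoly A ?Y (\<lambda>i. f i + 2 * (\<Sum>j\<in>?Z. z' j * A j i)) (qpoly A ?Z f \<gamma> z') y = 0"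
          using ev unfolding Ev by auto
        have nf: "next_form k z z' i = (f i + 2 * (\<Sum>j\<in>?Z. z j * A j i)) - (f i + 2 * (\<Sum>j\<in>?Z. z' j * A j i))" for i
          unfolding next_form_def by (simp add: left_diff_distrib sum_subtractf)
        have "(\<Sum>i\<in>?Y. next_form k z z' i * y i) = (\<Sum>i\<in>?Y. (f i + 2 * (\<Sum>j\<in>?Z. z j * A j i)) * y i)
            - (\<Sum>i\<in>?Y. (f i + 2 * (\<Sum>j\<in>?Z. z' j * A j i)) * y i)"
          unfolding nf left_diff_distrib[of _ _ "y _"] by (rule sum_subtractf)
        also have "\<dots> = qpoly A ?Z f \<gamma> z' - qpoly A ?Z f \<gamma> z"
        proof -
          have cancel: "S1 - S2 = g2 - g1" if "a + S1 + g1 = 0" "a + S2 + g2 = 0" for a S1 S2 g1 g2 :: complex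
          proof -
            have "S1 - S2 = (a + S1 + g1) - (a + S2 + g2) + (g2 - g1)" by (simp add: algebra_simps)
            then show ?thesis using that by simp
          qed
          show ?thesis by (rule cancel[OF q[unfolded qpoly_def[of A ?Y]]])
        qed
        finally have "fv l' ?Y y k = c' k" by (simp add: l'_def c'_def fv_def)
        moreover have "fv l' ?Y y s = c' s" if "s < k" for s
        proof -
          have "fv l ?Y y s + fv l ?Z z s = c s" using ev that unfolding Ev by auto
          then have "fv l ?Y y s = c s - fv l ?Z z s" by (simp add: algebra_simps)
          then show ?thesis using that by (simp add: l'_def c'_def fv_def)
        qed
        ultimately have "\<forall>s<Suc k. fv l' ?Y y s = c' s" by (auto simp: less_Suc_eq)
        then show "(\<forall>s<Suc k. fv l' ?Y y s = c' s) \<and>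
            qpoly A ?Y (\<lambda>i. f i + 2 * (\<Sum>j\<in>?Z. z j * A j i)) (qpoly A ?Z f \<gamma> z) y = 0"
          using q(1) by blast
      qed
      also have "\<dots> \<le> Bd (Suc k)"
        by (rule Suc.hyps(1)) (use Suc.hyps(2) k sp in auto)
      finally show ?thesis using 3 by simp
    qed
  qed
  have "(prb (signs 0 (W k)) Ev)\<^sup>2 \<le> Bd (Suc k) * decay (T - k) ^ k + 1 * (real K0 * (2 * decay T1 ^ (K - k)))"
    unfolding WYZ by (rule signs_decouple[OF fin disj step N bad]) (use Bd_nonneg in auto)
  also have "\<dots> \<le> (Bd k)\<^sup>2" using Bd_step[OF k] by simp
  finally have "prb (signs 0 (W k)) Ev \<le> Bd k" by (rule power2_le_imp_le) (rule Bd_nonneg)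
  then show ?case unfolding Ev_def .
qed

corollary tower_anticoncentration: "prb (signs 0 (W 0)) (\<lambda>x. qpoly A (W 0) f \<gamma> x = 0) \<le> Bd 0"
proof -
  have "spread 0 (\<lambda>_ _. 0) b" for b
    unfolding spread_def by (intro exI[of _ "{..<2 ^ T}"]) (auto simp: indep_def)
  then show ?thesis using tower_bound[of 0 "\<lambda>_ _. 0" undefined f \<gamma>] by simp
qed

end

section \<open>Random partitions\<close>

lemma prb_Pi_union:
  assumes "finite U" "finite W" "U \<inter> W = {}"
  shows "prb (Pi_pmf (U \<union> W) d p) Q
    = prb (pair_pmf (Pi_pmf U d p) (Pi_pmf W d p)) (\<lambda>(x, y). Q (\<lambda>i. if i \<in> U then x i else y i))"
  unfolding Pi_pmf_union[OF assms] prb_map by (simp add: case_prod_unfold)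

text \<open>Disjoint blocks are coloured independently, and each is entirely of colour
  \<open>c\<close> with probability \<open>(1 / (K0 + 1)) ^ K\<close>.\<close>

lemma prb_no_monochromatic_block:
  fixes g :: nat and B :: "nat \<Rightarrow> 'a set"
  assumes "finite U" "disjoint_family_on B {..<g}" "\<And>h. h < g \<Longrightarrow> B h \<subseteq> U \<and> card (B h) = K" "c \<le> (K0::nat)"
  shows "prb (Pi_pmf U 0 (\<lambda>_. pmf_of_set {..K0})) (\<lambda>f. \<forall>h<g. \<exists>v\<in>B h. f v \<noteq> c)
      \<le> (1 - (1 / (real K0 + 1)) ^ K) ^ g"
  using assms
proof (induction g arbitrary: U)
  case 0
  then show ?case by simp
next
  case (Suc g)
  let ?p = "\<lambda>_ :: 'a. pmf_of_set {..K0}"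
  let ?\<theta> = "1 - (1 / (real K0 + 1)) ^ K"
  have \<theta>: "?\<theta> \<ge> 0" by (simp add: power_le_one)
  define X where "X = B g"
  have X: "X \<subseteq> U" "card X = K" using Suc.prems(3)[of g] by (auto simp: X_def)
  have finX: "finite X" using X(1) Suc.prems(1) by (rule finite_subset)
  have U: "X \<union> (U - X) = U" using X(1) by auto
  have disj: "B h \<inter> X = {}" if "h < g" for h
    using disjoint_family_onD[OF Suc.prems(2), of h g] that by (auto simp: X_def)
  have monoX: "prb (Pi_pmf X 0 ?p) (\<lambda>f. \<forall>v\<in>X. f v = c) = (1 / (real K0 + 1)) ^ K"
  proof -
    have "prb (Pi_pmf X 0 ?p) (\<lambda>f. \<forall>v\<in>X. f v = c) = measure_pmf.prob (Pi_pmf X 0 ?p) (Pi X (\<lambda>_. {c}))"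
      by (rule arg_cong[where f = "measure_pmf.prob _"]) auto
    also have "\<dots> = (\<Prod>x\<in>X. measure_pmf.prob (?p x) {c})" by (rule measure_Pi_pmf_Pi[OF finX])
    also have "\<dots> = (1 / (real K0 + 1)) ^ K"
      using Suc.prems(4) X(2) by (simp add: measure_pmf_single pmf_of_set add.commute)
    finally show ?thesis .
  qed
  have badX: "prb (Pi_pmf X 0 ?p) (\<lambda>f. \<exists>v\<in>X. f v \<noteq> c) = ?\<theta>"
  proof -
    have "{f. \<exists>v\<in>X. f v \<noteq> c} = UNIV - {f. \<forall>v\<in>X. f v = c}" by auto
    then show ?thesis using monoX measure_pmf.prob_compl[of "{f. \<forall>v\<in>X. f v = c}" "Pi_pmf X 0 ?p"] by simp
  qed
  have "prb (Pi_pmf U 0 ?p) (\<lambda>f. \<forall>h<Suc g. \<exists>v\<in>B h. f v \<noteq> c)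
      = prb (pair_pmf (Pi_pmf X 0 ?p) (Pi_pmf (U - X) 0 ?p))
         (\<lambda>(x, y). \<forall>h<Suc g. \<exists>v\<in>B h. (if v \<in> X then x v else y v) \<noteq> c)"
    using prb_Pi_union[of X "U - X" 0 ?p "\<lambda>f. \<forall>h<Suc g. \<exists>v\<in>B h. f v \<noteq> c"] finX Suc.prems(1)
    by (simp only: U finite_Diff) auto
  also have "\<dots> \<le> prb (pair_pmf (Pi_pmf X 0 ?p) (Pi_pmf (U - X) 0 ?p))
         (\<lambda>(x, y). (\<exists>v\<in>X. x v \<noteq> c) \<and> (\<forall>h<g. \<exists>v\<in>B h. y v \<noteq> c))"
  proof (rule prb_mono, clarify)
    fix x y assume *: "\<forall>h<Suc g. \<exists>v\<in>B h. (if v \<in> X then x v else y v) \<noteq> c"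
    have "\<exists>v\<in>X. x v \<noteq> c" using *[rule_format, of g] by (auto simp: X_def)
    moreover have "\<exists>v\<in>B h. y v \<noteq> c" if "h < g" for h
    proof -
      obtain v where "v \<in> B h" "(if v \<in> X then x v else y v) \<noteq> c" using * \<open>h < g\<close> by (meson less_SucI)
      then show ?thesis using disj[OF that] by (auto split: if_splits)
    qed
    ultimately show "(\<exists>v\<in>X. x v \<noteq> c) \<and> (\<forall>h<g. \<exists>v\<in>B h. y v \<noteq> c)" by blast
  qed
  also have "\<dots> \<le> ?\<theta> ^ g * prb (Pi_pmf X 0 ?p) (\<lambda>x. \<exists>v\<in>X. x v \<noteq> c)"
  proof (rule prb_pair_split)
    show "prb (Pi_pmf (U - X) 0 ?p) (\<lambda>y. \<forall>h<g. \<exists>v\<in>B h. y v \<noteq> c) \<le> ?\<theta> ^ g"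
    proof (rule Suc.IH)
      show "disjoint_family_on B {..<g}"
        using Suc.prems(2) by (rule disjoint_family_on_mono[rotated]) auto
      show "B h \<subseteq> U - X \<and> card (B h) = K" if "h < g" for h
        using Suc.prems(3)[of h] disj[OF that] that by auto
    qed (use Suc.prems in auto)
  qed (use \<theta> in simp)
  finally show ?case unfolding badX by (simp add: mult.commute)
qed

text \<open>Union bound over the requirements; some colouring in the support escapes every failure
  event.\<close>

lemma colouring_exists:
  fixes B :: "'w \<Rightarrow> nat \<Rightarrow> 'a set" and K0 :: nat
  assumes "finite V" "finite \<Omega>"
    and "\<And>\<omega>. \<omega> \<in> \<Omega> \<Longrightarrow> disjoint_family_on (B \<omega>) {..<g}"
    and "\<And>\<omega> h. \<omega> \<in> \<Omega> \<Longrightarrow> h < g \<Longrightarrow> B \<omega> h \<subseteq> V \<and> card (B \<omega> h) = K"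
    and "\<And>\<omega>. \<omega> \<in> \<Omega> \<Longrightarrow> c \<omega> \<le> K0"
    and small: "real (card \<Omega>) * (1 - (1 / (real K0 + 1)) ^ K) ^ g < 1"
  shows "\<exists>f. (\<forall>v. f v \<le> K0) \<and> (\<forall>\<omega>\<in>\<Omega>. \<exists>h<g. \<forall>v\<in>B \<omega> h. f v = c \<omega>)"
proof -
  let ?P = "Pi_pmf V 0 (\<lambda>_. pmf_of_set {..K0})"
  let ?\<theta> = "1 - (1 / (real K0 + 1)) ^ K"
  have "prb ?P (\<lambda>f. \<exists>\<omega>\<in>\<Omega>. \<forall>h<g. \<exists>v\<in>B \<omega> h. f v \<noteq> c \<omega>)
      \<le> (\<Sum>\<omega>\<in>\<Omega>. prb ?P (\<lambda>f. \<forall>h<g. \<exists>v\<in>B \<omega> h. f v \<noteq> c \<omega>))"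
    by (rule prb_Bex) (rule assms)
  also have "\<dots> \<le> (\<Sum>\<omega>\<in>\<Omega>. ?\<theta> ^ g)"
    by (intro sum_mono prb_no_monochromatic_block) (use assms in auto)
  also have "\<dots> < 1" using small by simp
  finally have "prb ?P (\<lambda>f. \<exists>\<omega>\<in>\<Omega>. \<forall>h<g. \<exists>v\<in>B \<omega> h. f v \<noteq> c \<omega>) < 1" .
  note lt = this
  have "\<not> set_pmf ?P \<subseteq> {f. \<exists>\<omega>\<in>\<Omega>. \<forall>h<g. \<exists>v\<in>B \<omega> h. f v \<noteq> c \<omega>}"
  proof
    let ?E = "{f. \<exists>\<omega>\<in>\<Omega>. \<forall>h<g. \<exists>v\<in>B \<omega> h. f v \<noteq> c \<omega>}"
    assume "set_pmf ?P \<subseteq> ?E"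
    then have "AE x in measure_pmf ?P. x \<in> ?E" by (auto simp: AE_measure_pmf_iff)
    then have "measure_pmf.prob ?P ?E = 1" by (subst measure_pmf.prob_eq_1) auto
    then show False using lt by simp
  qed
  then obtain f where f: "f \<in> set_pmf ?P" "\<forall>\<omega>\<in>\<Omega>. \<exists>h<g. \<forall>v\<in>B \<omega> h. f v = c \<omega>" by blast
  have "f v \<le> K0" for v
    using f(1) assms(1) by (cases "v \<in> V") (auto simp: set_Pi_pmf PiE_dflt_def)
  then show ?thesis using f(2) by blast
qed

section \<open>Exponents of the tower recursion\<close>

lemma decay_powr: "decay t ^ k = 2 powr (- (real t * real k / 2))"
proof -
  have "decay t = 2 powr (- (real t / 2))"
    unfolding decay_def
    by (simp add: powr_half_sqrt[symmetric] powr_powr powr_minus_divide powr_divide flip: powr_realpow)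
  then show ?thesis by (simp add: powr_power mult.commute)
qed

text \<open>The exponents satisfy \<open>2 * a k = k / 2 + a (Suc k)\<close> and
  \<open>a K0 = K0 / 2\<close>. In \<open>C\<close> the first summand pays for replacing
  \<open>T - k\<close> by \<open>T\<close>, the second for the bad pairs, and
  \<open>C * (first + second) = C\<^sup>2\<close> closes the recursion. By \<open>big\<close> the
  bad term is no larger than the main one.\<close>

lemma tower_recursion_bound:
  fixes K K0 T T1 :: nat
  assumes K0: "K0 \<le> T" "K0 \<le> K" and big: "2 * T * (K0 + 1) \<le> T1 * (K - K0)"
  defines "C \<equiv> 2 powr (real K0 * real K0 / 2) + 2 * real K0"
    and "a \<equiv> \<lambda>k. (real k + 1) / 2 - (1 / 2) ^ (K0 - k + 1)"
  defines "Bd \<equiv> \<lambda>k. C * 2 powr (- (real T * a k))"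
  shows "\<And>k. k < K0 \<Longrightarrow> Bd (Suc k) * decay (T - k) ^ k + real K0 * (2 * decay T1 ^ (K - k)) \<le> (Bd k)\<^sup>2"
    and "decay (T - K0) ^ K0 \<le> Bd K0"
proof -
  define c0 where "c0 = 2 powr (real K0 * real K0 / 2)"
  have c0: "c0 \<ge> 1" unfolding c0_def by (rule ge_one_powr_ge_zero) auto
  have C: "C = c0 + 2 * real K0" by (simp add: C_def c0_def)
  then have C1: "C \<ge> 1" using c0 by simp
  have dec: "decay (T - k) ^ k \<le> c0 * 2 powr (- (real T * real k / 2))" if "k \<le> K0" for k
  proof -
    have "decay (T - k) ^ k = 2 powr (real k * real k / 2) * 2 powr (- (real T * real k / 2))"
      unfolding decay_powr using that K0 by (simp add: of_nat_diff algebra_simps diff_divide_distrib flip: powr_add)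
    also have "\<dots> \<le> c0 * 2 powr (- (real T * real k / 2))"
      unfolding c0_def using that by (intro mult_right_mono powr_mono divide_right_mono mult_mono) auto
    finally show ?thesis .
  qed
  show "decay (T - K0) ^ K0 \<le> Bd K0"
  proof -
    have "decay (T - K0) ^ K0 \<le> c0 * 2 powr (- (real T * real K0 / 2))" using dec by simp
    also have "\<dots> \<le> C * 2 powr (- (real T * real K0 / 2))"
      by (intro mult_right_mono) (auto simp: C)
    also have "real T * real K0 / 2 = real T * a K0" by (simp add: a_def field_simps)
    finally show ?thesis by (simp add: Bd_def)
  qed
  fix k assume k: "k < K0"
  have a2: "2 * a k = real k / 2 + a (Suc k)"
  proof -
    have "K0 - k = Suc (K0 - Suc k)" using k by simp
    then show ?thesis by (simp add: a_def field_simps)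
  qed
  have E: "(2 powr (- (real T * a k)))\<^sup>2 = 2 powr (- (real T * (real k / 2 + a (Suc k))))"
    unfolding a2[symmetric] by (simp add: powr_power mult_ac)
  define y where "y = 2 powr (- (real T * (real k / 2 + a (Suc k))))"
  have y: "y \<ge> 0" by (simp add: y_def)
  have "Bd (Suc k) * decay (T - k) ^ k \<le> Bd (Suc k) * (c0 * 2 powr (- (real T * real k / 2)))"
    by (intro mult_left_mono dec) (use k C1 in \<open>auto simp: Bd_def\<close>)
  also have "\<dots> = C * c0 * y"
    by (simp add: Bd_def y_def powr_add[symmetric] algebra_simps)
  finally have first: "Bd (Suc k) * decay (T - k) ^ k \<le> C * c0 * y" .
  have "decay T1 ^ (K - k) \<le> y"
  proof -
    have "real T1 * real (K - k) \<ge> real T1 * real (K - K0)"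
      using k by (intro mult_left_mono) auto
    moreover have "real (2 * T * (K0 + 1)) \<le> real (T1 * (K - K0))" using big of_nat_le_iff by blast
    then have "2 * real T * (real K0 + 1) \<le> real T1 * real (K - K0)"
      by (simp add: distrib_left mult_ac)
    ultimately have "2 * real T * (real K0 + 1) \<le> real T1 * real (K - k)" by linarith
    moreover have "real k / 2 + a (Suc k) \<le> real K0 + 1"
    proof -
      have "(1 / 2 :: real) ^ (K0 - k + 1) \<ge> 0" by (rule zero_le_power) simp
      then have "a k \<le> (real k + 1) / 2" unfolding a_def by linarith
      then have "2 * a k \<le> real K0 + 1" using k by simp
      then show ?thesis unfolding a2 .
    qed
    then have "2 * real T * (real k / 2 + a (Suc k)) \<le> 2 * real T * (real K0 + 1)"
      by (intro mult_left_mono) auto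
    ultimately show ?thesis unfolding decay_powr y_def by (intro powr_mono) auto
  qed
  then have "real K0 * (2 * decay T1 ^ (K - k)) \<le> 2 * real K0 * y"
    using mult_left_mono[of "decay T1 ^ (K - k)" y "2 * real K0"] by (simp add: mult_ac)
  also have "\<dots> = 1 * (2 * real K0 * y)" by simp
  also have "\<dots> \<le> C * (2 * real K0 * y)" by (rule mult_right_mono) (use C1 y in auto)
  finally have "Bd (Suc k) * decay (T - k) ^ k + real K0 * (2 * decay T1 ^ (K - k)) \<le> C * c0 * y + C * (2 * real K0 * y)"
    using first by linarith
  also have "\<dots> = C * (c0 + 2 * real K0) * y" by (simp add: algebra_simps)
  also have "\<dots> = C\<^sup>2 * y" by (simp only: C[symmetric] power2_eq_square)
  also have "\<dots> = (Bd k)\<^sup>2" by (simp add: Bd_def power_mult_distrib E y_def)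
  finally show "Bd (Suc k) * decay (T - k) ^ k + real K0 * (2 * decay T1 ^ (K - k)) \<le> (Bd k)\<^sup>2" .
qed

text \<open>The colour classes become the sets \<open>V b\<close> of the tower. The sets
  \<open>F i\<close> are put into \<open>2 ^ T\<close> groups of \<open>g\<close> and the witness
  blocks of each \<open>F i\<close> into \<open>2 ^ T1\<close> groups of \<open>g\<close>; the
  colouring must offer a member of every colour in every group. The chosen sets of colour
  \<open>b\<close> then have witness blocks in all classes.\<close>

theorem high_rank_case:
  fixes A :: "nat \<Rightarrow> nat \<Rightarrow> complex" and V :: "nat set" and K K0 T T1 g :: nat
  assumes finV: "finite V" and sym: "\<And>i j. A i j = A j i"
    and K0: "1 \<le> K0" "K0 \<le> T" "K0 \<le> K" and big: "2 * T * (K0 + 1) \<le> T1 * (K - K0)"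
    and F: "disjoint_family_on F {..<2 ^ T * g}"
      "\<And>i. i < 2 ^ T * g \<Longrightarrow> F i \<subseteq> V \<and> card (F i) = K \<and> good A V (2 ^ T1 * g) (F i)"
    and small: "real ((2 ^ T + 2 ^ T * g * 2 ^ T1) * (K0 + 1)) * (1 - (1 / (real K0 + 1)) ^ K) ^ g < 1"
  shows "prb (signs 0 V) (\<lambda>x. qpoly A V l \<gamma> x = 0)
     \<le> (2 powr (real K0 * real K0 / 2) + 2 * real K0) * 2 powr (- (real T * (1 / 2 - (1 / 2) ^ (K0 + 1))))"
proof -
  let ?M = "2 ^ T * g"
  have "\<forall>i. \<exists>I :: nat \<Rightarrow> nat set. i < ?M \<longrightarrow> disjoint_family_on I {..<2 ^ T1 * g} \<and>
     (\<forall>m<2 ^ T1 * g. I m \<subseteq> V \<and> card (I m) = card (F i) \<and> indep (F i) A (I m))"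
    using F(2) unfolding good_def by blast
  then obtain I :: "nat \<Rightarrow> nat \<Rightarrow> nat set" where I0: "\<forall>i. i < ?M \<longrightarrow> disjoint_family_on (I i) {..<2 ^ T1 * g} \<and>
     (\<forall>m<2 ^ T1 * g. I i m \<subseteq> V \<and> card (I i m) = card (F i) \<and> indep (F i) A (I i m))"
    by (rule choice[THEN exE])
  have I: "disjoint_family_on (I i) {..<2 ^ T1 * g}"
    "\<And>m. m < 2 ^ T1 * g \<Longrightarrow> I i m \<subseteq> V \<and> card (I i m) = K \<and> indep (F i) A (I i m)" if "i < ?M" for i
    using I0 F(2) that by auto
  have idx: "r * g + h < N * g" if "r < N" "h < g" for r h N :: nat
  proof -
    have "r * g + h < Suc r * g" using that by simp
    also have "\<dots> \<le> N * g" using that by (intro mult_right_mono) auto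
    finally show ?thesis .
  qed
  have inj: "r = r' \<and> h = h'" if "r * g + h = r' * g + h'" "h < g" "h' < g" for r r' h h' :: nat
    using that by (metis add.commute div_mult_self1 div_less mod_mult_self1 mod_less add_0 not_less_zero)
  have sub: "disjoint_family_on (\<lambda>h. X (r * g + h)) {..<g}"
    if "disjoint_family_on X {..<N * g}" "r < N" for X :: "nat \<Rightarrow> nat set" and r N
    unfolding disjoint_family_on_def
    using disjoint_family_onD[OF that(1)] idx[OF that(2)] by auto
  \<comment> \<open>\<open>Inl (r, b)\<close> requests a set of colour \<open>b\<close> in group
    \<open>r\<close> of \<open>F\<close>; \<open>Inr (i, m, a)\<close> requests a witness block of
    colour \<open>a\<close> in group \<open>m\<close> for \<open>F i\<close>. All \<open>i\<close>
    are included since the choice among the \<open>F i\<close> depends on the colouring.\<close>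
  define \<Omega> :: "((nat \<times> nat) + (nat \<times> nat \<times> nat)) set"
    where "\<Omega> = ({..<2 ^ T} \<times> {..K0}) <+> ({..<?M} \<times> {..<2 ^ T1} \<times> {..K0})"
  define B :: "((nat \<times> nat) + (nat \<times> nat \<times> nat)) \<Rightarrow> nat \<Rightarrow> nat set"
    where "B = case_sum (\<lambda>(r, b) h. F (r * g + h)) (\<lambda>(i, m, a) h. I i (m * g + h))"
  define c :: "((nat \<times> nat) + (nat \<times> nat \<times> nat)) \<Rightarrow> nat"
    where "c = case_sum (\<lambda>(r, b). b) (\<lambda>(i, m, a). a)"
  have c\<Omega>: "card \<Omega> = (2 ^ T + 2 ^ T * g * 2 ^ T1) * (K0 + 1)"
    unfolding \<Omega>_def by (simp add: card_Plus card_cartesian_product algebra_simps)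
  have "\<exists>f. (\<forall>v. f v \<le> K0) \<and> (\<forall>\<omega>\<in>\<Omega>. \<exists>h<g. \<forall>v\<in>B \<omega> h. f v = c \<omega>)"
  proof (rule colouring_exists[OF finV])
    show "finite \<Omega>" by (simp add: \<Omega>_def)
    show "real (card \<Omega>) * (1 - (1 / (real K0 + 1)) ^ K) ^ g < 1" using small unfolding c\<Omega> .
    fix \<omega> assume \<omega>: "\<omega> \<in> \<Omega>"
    show "disjoint_family_on (B \<omega>) {..<g}"
      using \<omega> sub[OF F(1)] sub[OF I(1)] by (auto simp: \<Omega>_def B_def)
    show "c \<omega> \<le> K0" using \<omega> by (auto simp: \<Omega>_def c_def)
    fix h assume h: "h < g"
    have "F (r * g + h) \<subseteq> V \<and> card (F (r * g + h)) = K" if "r < 2 ^ T" for r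
      using F(2)[OF idx[OF that h]] by blast
    moreover have "I i (m * g + h) \<subseteq> V \<and> card (I i (m * g + h)) = K" if "i < ?M" "m < 2 ^ T1" for i m
      using I(2)[OF that(1) idx[OF that(2) h]] by blast
    ultimately show "B \<omega> h \<subseteq> V \<and> card (B \<omega> h) = K"
      using \<omega> by (cases \<omega>) (auto simp: \<Omega>_def B_def, blast+)
  qed
  then obtain f where f: "\<And>v. f v \<le> K0" "\<And>\<omega>. \<omega> \<in> \<Omega> \<Longrightarrow> \<exists>h<g. \<forall>v\<in>B \<omega> h. f v = c \<omega>" by blast
  have "\<exists>h<g. \<forall>v\<in>F (r * g + h). f v = b" if "r < 2 ^ T" "b \<le> K0" for r b
    using f(2)[of "Inl (r, b)"] that by (auto simp: \<Omega>_def B_def c_def)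
  then obtain H where H: "\<And>r b. r < 2 ^ T \<Longrightarrow> b \<le> K0 \<Longrightarrow> H r b < g \<and> (\<forall>v\<in>F (r * g + H r b). f v = b)"
    by metis
  have colI: "\<exists>h<g. \<forall>v\<in>I i (m * g + h). f v = a" if "i < ?M" "m < 2 ^ T1" "a \<le> K0" for i m a
    using f(2)[of "Inr (i, m, a)"] that by (auto simp: \<Omega>_def B_def c_def)
  define Vb where "Vb b = {v\<in>V. f v = b}" for b
  define J where "J b r = F (r * g + H r b)" for b r
  define C where "C = 2 powr (real K0 * real K0 / 2) + 2 * real K0"
  define a where "a k = (real k + 1) / 2 - (1 / 2) ^ (K0 - k + 1)" for k
  define Bd where "Bd k = C * 2 powr (- (real T * a k))" for k
  have JM: "r * g + H r b < ?M" if "r < 2 ^ T" "b \<le> K0" for r b using idx[OF that(1)] H[OF that] by blast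
  interpret tower A Vb J T T1 K K0 Bd
  proof
    show "A i j = A j i" for i j by (rule sym)
    show "finite (Vb b)" for b using finV by (simp add: Vb_def)
    show "Vb a \<inter> Vb b = {}" if "a \<noteq> b" for a b using that by (auto simp: Vb_def)
    show "K0 \<le> T" "K0 \<ge> 1" using K0 by auto
    show "J b i \<subseteq> Vb b" if "b \<le> K0" "i < 2 ^ T" for b i
      using F(2)[OF JM[OF that(2,1)]] H[OF that(2,1)] by (auto simp: J_def Vb_def)
    show "card (J b i) = K" if "b \<le> K0" "i < 2 ^ T" for b i
      using F(2)[OF JM[OF that(2,1)]] by (simp add: J_def)
    show "disjoint_family_on (J b) {..<2 ^ T}" if b: "b \<le> K0" for b
      unfolding disjoint_family_on_def
    proof (intro ballI impI)
      fix r r' assume rr: "r \<in> {..<2 ^ T}" "r' \<in> {..<2 ^ T}" "(r :: nat) \<noteq> r'"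
      have "r * g + H r b \<noteq> r' * g + H r' b"
        using inj[of r "H r b" r' "H r' b"] H[of r b] H[of r' b] rr b by auto
      then show "J b r \<inter> J b r' = {}"
        unfolding J_def using disjoint_family_onD[OF F(1)] JM rr b by auto
    qed
    show "robust T1 (J b i) A (Vb a)" if ab: "a < b" "b \<le> K0" "i < 2 ^ T" for a b i
    proof -
      let ?i = "i * g + H i b"
      have iM: "?i < ?M" using JM ab by simp
      have aK: "a \<le> K0" using ab by simp
      obtain h where h: "\<And>m. m < 2 ^ T1 \<Longrightarrow> h m < g \<and> (\<forall>v\<in>I ?i (m * g + h m). f v = a)"
        using colI[OF iM _ aK] by metis
      have "disjoint_family_on (\<lambda>m. I ?i (m * g + h m)) {..<2 ^ T1}"
        unfolding disjoint_family_on_def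
      proof (intro ballI impI)
        fix m m' assume mm: "m \<in> {..<2 ^ T1}" "m' \<in> {..<2 ^ T1}" "(m :: nat) \<noteq> m'"
        have "m * g + h m \<noteq> m' * g + h m'"
          using inj[of m "h m" m' "h m'"] h[of m] h[of m'] mm by auto
        then show "I ?i (m * g + h m) \<inter> I ?i (m' * g + h m') = {}"
          using disjoint_family_onD[OF I(1)[OF iM]] idx h mm by auto
      qed
      moreover have "I ?i (m * g + h m) \<subseteq> Vb a \<and> indep (J b i) A (I ?i (m * g + h m))" if "m < 2 ^ T1" for m
        using I(2)[OF iM idx[OF that, of "h m"]] h[OF that] by (auto simp: Vb_def J_def)
      ultimately show ?thesis
        unfolding robust_def by (intro exI[of _ "{..<2 ^ T1}"] exI[of _ "\<lambda>m. I ?i (m * g + h m)"]) auto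
    qed
    show "Bd k \<ge> 0" for k by (simp add: Bd_def C_def)
    show "Bd (Suc k) * decay (T - k) ^ k + real K0 * (2 * decay T1 ^ (K - k)) \<le> (Bd k)\<^sup>2" if "k < K0" for k
      using tower_recursion_bound(1)[OF K0(2,3) big that] unfolding Bd_def C_def a_def .
    show "decay (T - K0) ^ K0 \<le> Bd K0"
      using tower_recursion_bound(2)[OF K0(2,3) big] unfolding Bd_def C_def a_def .
  qed
  have "W 0 = V" using f(1) by (auto simp: W_def Vb_def)
  then have "prb (signs 0 V) (\<lambda>x. qpoly A V l \<gamma> x = 0) \<le> Bd 0"
    using tower_anticoncentration[of l \<gamma>] by simp
  then show ?thesis by (simp add: Bd_def C_def a_def)
qed

section \<open>Choice of parameters\<close>

text \<open>With \<open>\<phi>\<close> the root of order \<open>k + 1\<close> of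
  \<open>\<theta>\<close>, each of the \<open>k\<close> factors \<open>n\<close> is paired with one
  \<open>\<phi> ^ n\<close>, and one such factor is left over.\<close>

lemma exp_beats_power:
  fixes \<theta> c :: real
  assumes "0 < \<theta>" "\<theta> < 1"
  shows "\<exists>N. \<forall>n\<ge>N. c * real n ^ k * \<theta> ^ n < 1"
proof -
  define \<phi> where "\<phi> = root (Suc k) \<theta>"
  have "\<phi> ^ Suc k = \<theta>"
    unfolding \<phi>_def by (rule real_root_pow_pos) (use assms in auto)
  moreover have "0 < \<phi>" "\<phi> < 1"
    unfolding \<phi>_def using assms by (simp_all add: real_root_gt_zero real_root_lt_1_iff)
  ultimately have \<phi>: "\<phi> ^ Suc k = \<theta>" "0 < \<phi>" "\<phi> < 1" by blast+
  have "(\<lambda>n. (real n * \<phi> ^ n) ^ k * \<phi> ^ n) \<longlonglongrightarrow> 0 ^ k * 0"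
    by (intro tendsto_mult tendsto_power powser_times_n_limit_0 LIMSEQ_power_zero) (use \<phi> in auto)
  then have "(\<lambda>n. c * ((real n * \<phi> ^ n) ^ k * \<phi> ^ n)) \<longlonglongrightarrow> c * 0"
    by (intro tendsto_mult tendsto_const) simp
  then have "eventually (\<lambda>n. c * ((real n * \<phi> ^ n) ^ k * \<phi> ^ n) < 1) sequentially"
    by (rule order_tendstoD) simp
  moreover have "c * ((real n * \<phi> ^ n) ^ k * \<phi> ^ n) = c * real n ^ k * \<theta> ^ n" for n
  proof -
    have "(\<phi> ^ n) ^ k * \<phi> ^ n = \<theta> ^ n"
      unfolding \<phi>(1)[symmetric] by (simp add: power_mult[symmetric] power_add[symmetric] mult.commute power_mult_distrib)
    then show ?thesis by (simp add: power_mult_distrib mult.assoc)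
  qed
  ultimately show ?thesis by (simp add: eventually_sequentially)
qed

text \<open>With x = 2 ^ e and p = 2 ^ T the row size is p * x * x * x. Two factors x go to the
  witness blocks, \<open>2 ^ e\<close> groups of size x, and the third outgrows all constants; the
  bound itself is in terms of p.\<close>

theorem qpoly_anticoncentration:
  fixes \<delta> :: real
  assumes \<delta>: "0 < \<delta>" "\<delta> < 1 / 2"
  shows "\<exists>C q e0. C \<ge> 1 \<and> (q::nat) \<ge> 1 \<and> (\<forall>e\<ge>e0. \<forall>(V :: nat set) A l \<gamma>.
     finite V \<longrightarrow> V \<noteq> {} \<longrightarrow> (\<forall>i j. A i j = A j i) \<longrightarrow> (\<forall>i\<in>V. 2 ^ (q * e) \<le> card {j\<in>V. A i j \<noteq> 0}) \<longrightarrow>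
     prb (signs 0 V) (\<lambda>x. qpoly A V l \<gamma> x = 0) \<le> C * 2 powr (- (real q * real e * (1 / 2 - \<delta>))))"
proof -
  \<comment> \<open>\<open>K0\<close> levels lose at most \<open>\<delta> / 2\<close> in the
    exponent, and \<open>q \<ge> 3 / \<delta>\<close> lets the other half of \<open>\<delta>\<close>
    pay for using \<open>q - 3\<close> in place of \<open>q\<close>.\<close>
  obtain n0 where n0: "(1 / 2) ^ n0 < \<delta> / 2" using real_arch_pow_inv[of "\<delta> / 2" "1 / 2"] \<delta> by auto
  define K0 where "K0 = n0 + 1"
  have K0: "K0 \<ge> 1" by (simp add: K0_def)
  have "(1 / 2 :: real) ^ (K0 + 1) \<le> (1 / 2) ^ n0" unfolding K0_def by (rule power_decreasing) auto
  then have \<eta>: "(1 / 2 :: real) ^ (K0 + 1) \<le> \<delta> / 2" using n0 by simp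
  define q where "q = nat \<lceil>3 / \<delta>\<rceil> + 4"
  have q4: "q \<ge> 4" by (simp add: q_def)
  have "3 / \<delta> \<le> real q" unfolding q_def using real_nat_ceiling_ge[of "3 / \<delta>"] by linarith
  then have q\<delta>: "3 \<le> real q * \<delta>" using \<delta> by (simp add: field_simps)
  \<comment> \<open>Makes \<open>e * (K - K0)\<close> equal to \<open>2 * q * e * (K0 + 1)\<close>,
    as \<open>big\<close> in \<open>high_rank_case\<close> demands for
    \<open>T1 = e\<close>.\<close>
  define K where "K = K0 + 2 * q * (K0 + 1)"
  define \<theta> where "\<theta> = 1 - (1 / (real K0 + 1)) ^ K"
  have \<theta>: "0 < \<theta>" "\<theta> < 1"
  proof -
    have "(1 / (real K0 + 1)) ^ K < 1"
      by (subst power_less_one_iff) (use K0 in \<open>auto simp: K_def\<close>)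
    then show "0 < \<theta>" by (simp add: \<theta>_def)
    show "\<theta> < 1" by (simp add: \<theta>_def)
  qed
  obtain N where N: "\<And>n. n \<ge> N \<Longrightarrow> (2 * (real K0 + 1)) * real n ^ (q - 1) * \<theta> ^ n < 1"
    using exp_beats_power[OF \<theta>, of "2 * (real K0 + 1)" "q - 1"] by blast
  define L where "L = (K + 1) ^ K"
  \<comment> \<open>The sum of the coefficients in the estimate \<open>tot\<close>, all taken
    relative to \<open>p * x * x\<close>.\<close>
  define c1 where "c1 = 64 * K * K * L + 16 * K * K + 4 + 2 * L + 1 + K + K"
  define Ch where "Ch = 2 powr (real K0 * real K0 / 2) + 2 * real K0"
  obtain Cl where Cl: "Cl \<ge> 1" and lowrank: "\<forall>t (V :: nat set) A D0 J0 c S D \<rho> Tm l \<gamma>.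
     finite V \<longrightarrow> (\<forall>i j. A i j = A j i) \<longrightarrow> finite J0 \<longrightarrow> card J0 < K \<longrightarrow> V - D0 - J0 \<noteq> {} \<longrightarrow>
     (\<forall>j\<in>V - D0 - J0. S j \<subseteq> V \<and> card (S j) \<le> D \<and>
               (\<forall>i\<in>V - S j. A j i = (\<Sum>t\<in>J0. c j t * A t i))) \<longrightarrow>
     (\<forall>i\<in>V - D0 - J0. \<rho> \<le> card {j\<in>V - D0 - J0. j \<noteq> i \<and> A i j \<noteq> 0}) \<longrightarrow>
     4 * Tm + 2 * D < \<rho> \<longrightarrow> (4 * D + 1) * ((2 * K) * (2 * K) * 2 ^ t) < Tm \<longrightarrow>
     prb (signs 0 V) (\<lambda>x. qpoly A V l \<gamma> x = 0) \<le> Cl * decay t"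
    using low_rank_case[of K] by blast
  have Ch0: "Ch \<ge> 0" by (simp add: Ch_def)
  define C where "C = Ch + Cl"
  show ?thesis
  proof (rule exI[of _ C], rule exI[of _ q], rule exI[of _ "K0 + c1 + N"], intro conjI allI impI)
    show "C \<ge> 1" "q \<ge> 1" using Cl Ch0 q4 by (auto simp: C_def)
    fix e and V :: "nat set" and A :: "nat \<Rightarrow> nat \<Rightarrow> complex" and l \<gamma>
    assume e: "K0 + c1 + N \<le> e" and finV: "finite V" and neV: "V \<noteq> {}"
      and sym: "\<forall>i j. A i j = A j i" and row: "\<forall>i\<in>V. 2 ^ (q * e) \<le> card {j\<in>V. A i j \<noteq> 0}"
    define T where "T = (q - 3) * e"
    define x where "x = (2 :: nat) ^ e"
    define p where "p = (2 :: nat) ^ T"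
    have ex: "e < x" by (simp add: x_def)
    have p1: "p \<ge> 1" "x \<ge> 1" by (simp_all add: p_def x_def)
    have T3: "T + 3 * e = q * e" unfolding T_def using q4 by (simp flip: distrib_right)
    have T2: "T + 2 * e = (q - 1) * e"
    proof -
      have "q - 3 + 2 = q - 1" using q4 by simp
      then show ?thesis unfolding T_def by (metis distrib_right)
    qed
    have R: "2 ^ (q * e) = p * x * x * x"
      unfolding T3[symmetric] p_def x_def by (simp add: power_add numeral_3_eq_3)
    \<comment> \<open>Bounds the number of colouring requirements by a fixed power of
      \<open>x\<close>, to be beaten by \<open>\<theta> ^ x\<close>.\<close>
    have X: "p * x * x = x ^ (q - 1)"
    proof -
      have "p * x * x = 2 ^ (T + 2 * e)" by (simp add: p_def x_def power_add mult_2)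
      then show ?thesis unfolding T2 x_def by (simp add: power_mult mult.commute)
    qed
    have expo: "2 powr (- (real T * s)) \<le> 2 powr (- (real q * real e * (1 / 2 - \<delta>)))"
      if s: "s \<ge> 1 / 2 - \<delta> / 2" for s
    proof -
      have rT: "real T = (real q - 3) * real e" unfolding T_def using q4 by (simp add: of_nat_diff)
      have "real q * (1 / 2 - \<delta>) \<le> (real q - 3) * (1 / 2 - \<delta> / 2)" using q\<delta> \<delta> by (simp add: field_simps)
      also have "\<dots> \<le> (real q - 3) * s" by (rule mult_left_mono) (use s q4 in auto)
      finally have "real e * (real q * (1 / 2 - \<delta>)) \<le> real e * ((real q - 3) * s)" by (rule mult_left_mono) simp
      then show ?thesis unfolding rT by (intro powr_mono) (auto simp: mult_ac)
    qed
    consider (high) F where "disjoint_family_on F {..<p * x}"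
        "\<forall>i<p * x. F i \<subseteq> V \<and> card (F i) = K \<and> good A V (x * x) (F i)"
      | (low) D0 J0 c S where "D0 \<subseteq> V" "J0 \<subseteq> V" "card D0 \<le> p * x * K" "card J0 < K"
        "\<forall>j\<in>V - D0 - J0. S j \<subseteq> V \<and> card (S j) \<le> x * x * (K + 1) ^ K \<and>
               (\<forall>i\<in>V - S j. A j i = (\<Sum>t\<in>J0. c j t * A t i))"
    proof -
      have "1 \<le> x * x" using p1 by simp
      from good_blocks_or_low_rank[OF finV this, of "p * x" K A] show thesis
      proof (elim disjE exE conjE, goal_cases)
        case (1 F)
        then show ?thesis by (rule high)
      next
        case (2 D0 J0 c S)
        then show ?thesis by (rule low)
      qed
    qed
    then show "prb (signs 0 V) (\<lambda>x. qpoly A V l \<gamma> x = 0) \<le> C * 2 powr (- (real q * real e * (1 / 2 - \<delta>)))"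
    proof cases
      case high
      have sm: "real ((2 ^ T + 2 ^ T * x * 2 ^ e) * (K0 + 1)) * \<theta> ^ x < 1"
      proof -
        have "(p + p * x * x) * (K0 + 1) \<le> 2 * (K0 + 1) * x ^ (q - 1)"
        proof -
          have "p + p * x * x \<le> 2 * (p * x * x)" using p1 by simp
          then have "(p + p * x * x) * (K0 + 1) \<le> 2 * (p * x * x) * (K0 + 1)" by (rule mult_right_mono) simp
          then show ?thesis unfolding X[symmetric] by (simp only: mult_ac)
        qed
        then have "real ((p + p * x * x) * (K0 + 1)) \<le> real (2 * (K0 + 1) * x ^ (q - 1))" by (rule of_nat_mono)
        then have "real ((p + p * x * x) * (K0 + 1)) * \<theta> ^ x \<le> real (2 * (K0 + 1) * x ^ (q - 1)) * \<theta> ^ x"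
          by (rule mult_right_mono) (use \<theta> in simp)
        also have "\<dots> = 2 * (real K0 + 1) * real x ^ (q - 1) * \<theta> ^ x" by (simp add: algebra_simps)
        also have "\<dots> < 1" by (rule N) (use e ex in auto)
        finally show ?thesis by (simp add: p_def x_def)
      qed
      have "prb (signs 0 V) (\<lambda>x. qpoly A V l \<gamma> x = 0)
         \<le> Ch * 2 powr (- (real T * (1 / 2 - (1 / 2) ^ (K0 + 1))))"
        unfolding Ch_def
      proof (rule high_rank_case[where K = K and ?T1.0 = e and g = x and F = F, OF finV])
        show "real ((2 ^ T + 2 ^ T * x * 2 ^ e) * (K0 + 1)) * (1 - (1 / (real K0 + 1)) ^ K) ^ x < 1"
          using sm unfolding \<theta>_def .
        have "1 * e \<le> T" unfolding T_def by (intro mult_right_mono) (use q4 in auto)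
        then show "K0 \<le> T" using e by simp
        show "2 * T * (K0 + 1) \<le> e * (K - K0)"
        proof -
          have "T \<le> q * e" using T3 by simp
          then have "2 * T * (K0 + 1) \<le> 2 * (q * e) * (K0 + 1)" by (intro mult_right_mono mult_left_mono) auto
          also have "\<dots> = e * (K - K0)" by (simp add: K_def algebra_simps)
          finally show ?thesis .
        qed
      qed (use high sym K0 in \<open>auto simp: K_def p_def x_def \<theta>_def\<close>)
      also have "\<dots> \<le> Ch * 2 powr (- (real q * real e * (1 / 2 - \<delta>)))"
        by (intro mult_left_mono expo) (use \<eta> Ch0 in auto)
      also have "\<dots> \<le> C * 2 powr (- (real q * real e * (1 / 2 - \<delta>)))"
        by (intro mult_right_mono) (use Cl in \<open>auto simp: C_def\<close>)
      finally show ?thesis .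
    next
      case low
      define D where "D = x * x * L"
      define Tm where "Tm = (4 * D + 1) * ((2 * K) * (2 * K) * p) + 1"
      \<comment> \<open>The row size left after removing \<open>D0\<close>, \<open>J0\<close> and
        the diagonal entry.\<close>
      define \<rho> where "\<rho> = p * x * x * x - (1 + p * x * K + K)"
      have finD: "finite D0" "finite J0" using \<open>D0 \<subseteq> V\<close> \<open>J0 \<subseteq> V\<close> finV by (auto intro: finite_subset)
      define X where "X = p * x * x"
      have X1: "X \<ge> 1" "p \<le> X" "x * x \<le> X" "p * x \<le> X" using p1 by (auto simp: X_def)
      have tot: "4 * Tm + 2 * D + (1 + p * x * K + K) < p * x * x * x"
      proof -
        have "4 * Tm + 2 * D + (1 + p * x * K + K)
           = 64 * K * K * L * X + 16 * K * K * p + 4 * 1 + 2 * L * (x * x) + 1 * 1 + K * (p * x) + K * 1"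
          by (simp add: Tm_def D_def X_def algebra_simps)
        also have "\<dots> \<le> 64 * K * K * L * X + 16 * K * K * X + 4 * X + 2 * L * X + 1 * X + K * X + K * X"
          by (intro add_mono mult_left_mono order_refl X1) auto
        also have "\<dots> = c1 * X" by (simp add: c1_def algebra_simps)
        also have "\<dots> < x * X" using X1 e ex by simp
        also have "x * X = p * x * x * x" by (simp add: X_def)
        finally show ?thesis .
      qed
      have big: "card {j\<in>V. A i j \<noteq> 0} \<ge> p * x * x * x" if "i \<in> V" for i
        using row that unfolding R by blast
      have small: "card (D0 \<union> J0) \<le> p * x * K + K"
        using card_Un_le[of D0 J0] low(3,4) by simp
      have ne: "V - D0 - J0 \<noteq> {}"
      proof
        assume "V - D0 - J0 = {}"
        then have "V \<subseteq> D0 \<union> J0" by blast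
        obtain i where i: "i \<in> V" using neV by blast
        have "card {j\<in>V. A i j \<noteq> 0} \<le> card (D0 \<union> J0)"
          by (rule card_mono) (use finD \<open>V \<subseteq> D0 \<union> J0\<close> in auto)
        then show False using big[OF i] small tot by simp
      qed
      have deg: "\<rho> \<le> card {j\<in>V - D0 - J0. j \<noteq> i \<and> A i j \<noteq> 0}" if i: "i \<in> V - D0 - J0" for i
      proof -
        have "card {j\<in>V. A i j \<noteq> 0} \<le> card ({j\<in>V - D0 - J0. j \<noteq> i \<and> A i j \<noteq> 0} \<union> (insert i (D0 \<union> J0)))"
          by (rule card_mono) (use finD finV in auto)
        also have "\<dots> \<le> card {j\<in>V - D0 - J0. j \<noteq> i \<and> A i j \<noteq> 0} + card (insert i (D0 \<union> J0))"
          by (rule card_Un_le)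
        also have "card (insert i (D0 \<union> J0)) \<le> Suc (card (D0 \<union> J0))"
          using finD by (simp add: card_insert_if)
        finally show ?thesis using big[of i] i small unfolding \<rho>_def by simp
      qed
      have "prb (signs 0 V) (\<lambda>x. qpoly A V l \<gamma> x = 0) \<le> Cl * decay T"
      proof -
        have SP: "\<forall>j\<in>V - D0 - J0. S j \<subseteq> V \<and> card (S j) \<le> D \<and>
               (\<forall>i\<in>V - S j. A j i = (\<Sum>t\<in>J0. c j t * A t i))"
          using low(5) by (simp add: D_def L_def)
        have DEG: "\<forall>i\<in>V - D0 - J0. \<rho> \<le> card {j\<in>V - D0 - J0. j \<noteq> i \<and> A i j \<noteq> 0}" using deg by blast
        have n1: "4 * Tm + 2 * D < \<rho>" using tot unfolding \<rho>_def by simp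
        have n2: "(4 * D + 1) * ((2 * K) * (2 * K) * 2 ^ T) < Tm" by (simp add: Tm_def p_def)
        show ?thesis
          by (rule lowrank[THEN spec[of _ T], THEN spec[of _ V], THEN spec[of _ A], THEN spec[of _ D0],
                THEN spec[of _ J0], THEN spec[of _ c], THEN spec[of _ S], THEN spec[of _ D],
                THEN spec[of _ \<rho>], THEN spec[of _ Tm], THEN spec[of _ l], THEN spec[of _ \<gamma>],
                THEN mp, OF finV, THEN mp, OF sym, THEN mp, OF finD(2), THEN mp, OF low(4), THEN mp, OF ne,
                THEN mp, OF SP, THEN mp, OF DEG, THEN mp, OF n1, THEN mp, OF n2])
      qed
      also have "decay T = 2 powr (- (real T * (1 / 2)))" using decay_powr[of T 1] by simp
      also have "Cl * \<dots> \<le> Cl * 2 powr (- (real q * real e * (1 / 2 - \<delta>)))"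
        by (intro mult_left_mono expo) (use \<delta> Cl in auto)
      also have "\<dots> \<le> C * 2 powr (- (real q * real e * (1 / 2 - \<delta>)))"
        by (intro mult_right_mono) (use Ch0 in \<open>auto simp: C_def\<close>)
      finally show ?thesis .
    qed
  qed
qed

section \<open>From matrices to polynomials on index sets, and rounding of \<open>r\<close>\<close>

text \<open>Extension by zero, because symmetry is assumed for all pairs of indices.\<close>

definition entries :: "complex Matrix.mat \<Rightarrow> nat \<Rightarrow> nat \<Rightarrow> nat \<Rightarrow> complex" where
  "entries A n i j = (if i < n \<and> j < n then A $$ (i, j) else 0)"

lemma quadratic_form_vec:
  assumes "A \<in> carrier_mat n n"
  shows "quadratic_form A (Matrix.vec n x) = (\<Sum>i<n. \<Sum>j<n. entries A n i j * (x i * x j))"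
proof -
  have "quadratic_form A (Matrix.vec n x) = (\<Sum>i<n. x i * (\<Sum>j<n. A $$ (i, j) * x j))"
    using assms unfolding quadratic_form_def scalar_prod_def
    by (auto simp: scalar_prod_def atLeast0LessThan intro!: sum.cong)
  also have "\<dots> = (\<Sum>i<n. \<Sum>j<n. entries A n i j * (x i * x j))"
    by (auto simp: entries_def sum_distrib_left intro!: sum.cong)
  finally show ?thesis .
qed

lemma random_sign_vec_eq:
  assumes "A \<in> carrier_mat n n" "l \<in> carrier_vec n"
  shows "measure_pmf.prob (random_sign_vec n) {x. quadratic_form A x = linear_form l x + c}
    = prb (signs 0 {..<n}) (\<lambda>x. qpoly (entries A n) {..<n} (\<lambda>i. - l $ i) (- c) x = 0)"
proof -
  have "linear_form l (Matrix.vec n x) = (\<Sum>i<n. l $ i * x i)" for x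
    using assms(2) unfolding linear_form_def scalar_prod_def by (auto simp: atLeast0LessThan)
  then have "quadratic_form A (Matrix.vec n x) = linear_form l (Matrix.vec n x) + c \<longleftrightarrow>
      qpoly (entries A n) {..<n} (\<lambda>i. - l $ i) (- c) x = 0" for x
    unfolding quadratic_form_vec[OF assms(1)] qpoly_def by (simp add: sum_negf algebra_simps)
  then show ?thesis
    unfolding random_sign_vec_def prb_map signs_def rad.simps by simp
qed

theorem theorem6:
  fixes \<delta> :: real
  assumes "\<delta> > 0"
  shows "\<exists>C::real. \<forall>(n::nat) (r::real) A.
    n \<ge> 1 \<longrightarrow> r \<ge> exp (ln (real n) powr (1 / 4)) \<longrightarrow>
    A \<in> carrier_mat n n \<longrightarrow> transpose_mat A = A \<longrightarrow>
    (\<forall>i<n. real (card (row_support A i)) \<ge> r) \<longrightarrow>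
      (\<forall>l \<in> carrier_vec n.
        (SUP c. measure_pmf.prob (random_sign_vec n)
           {x. quadratic_form A x = linear_form l x + c}) \<le> C * r powr (- 1 / 2 + \<delta>)) \<and>
      (SUP c. measure_pmf.prob (random_sign_vec n)
         {x. quadratic_form A x = c}) \<le> C * r powr (- 1 / 2 + \<delta>)"
proof -
  have bound: "\<exists>C. \<forall>(n::nat) (r::real) A l \<gamma>. n \<ge> 1 \<longrightarrow> r \<ge> 1 \<longrightarrow> (\<forall>i j. A i j = A j i) \<longrightarrow>
      (\<forall>i<n. r \<le> real (card {j\<in>{..<n}. A i j \<noteq> 0})) \<longrightarrow>
      prb (signs 0 {..<n}) (\<lambda>x. qpoly A {..<n} l \<gamma> x = 0) \<le> C * r powr (- 1 / 2 + \<delta>)"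
  proof (cases "\<delta> < 1 / 2")
    case False
    \<comment> \<open>The exponent is nonnegative here, so the claimed bound is at least 1.\<close>
    then have "1 \<le> r powr (- 1 / 2 + \<delta>)" if "r \<ge> 1" for r using that by (intro ge_one_powr_ge_zero) auto
    then show ?thesis by (intro exI[of _ 1]) (auto intro: order_trans[OF measure_pmf.prob_le_1])
  next
    case True
    obtain C q e0 where C: "C \<ge> 1" and q: "(q::nat) \<ge> 1" and main: "\<forall>e\<ge>e0. \<forall>(V :: nat set) A l \<gamma>.
     finite V \<longrightarrow> V \<noteq> {} \<longrightarrow> (\<forall>i j. A i j = A j i) \<longrightarrow> (\<forall>i\<in>V. 2 ^ (q * e) \<le> card {j\<in>V. A i j \<noteq> 0}) \<longrightarrow>
     prb (signs 0 V) (\<lambda>x. qpoly A V l \<gamma> x = 0) \<le> C * 2 powr (- (real q * real e * (1 / 2 - \<delta>)))"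
      using qpoly_anticoncentration[OF assms True] by blast
    define s where "s = 1 / 2 - \<delta>"
    have s: "s > 0" using True by (simp add: s_def)
    \<comment> \<open>Rounding \<open>r\<close> down to \<open>2 ^ (q * e)\<close> loses at most
      \<open>2 powr (q * s)\<close>, and for \<open>e < e0\<close> this constant makes the bound
      trivial; the exponent \<open>e0 + 1\<close> covers both.\<close>
    define C' where "C' = C * 2 powr (real q * (real e0 + 1) * s)"
    have pow1: "2 powr (real q * (real e0 + 1) * s) \<ge> 1" using s by (intro ge_one_powr_ge_zero) auto
    have "prb (signs 0 {..<n}) (\<lambda>x. qpoly A {..<n} l \<gamma> x = 0) \<le> C' * r powr (- 1 / 2 + \<delta>)"
      if n: "n \<ge> 1" and r: "r \<ge> 1" and sym: "\<forall>i j. A i j = A j i"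
        and row: "\<forall>i<n. r \<le> real (card {j\<in>{..<n}. A i j \<noteq> 0})"
      for n :: nat and r :: real and A l \<gamma>
    proof -
      \<comment> \<open>The largest \<open>e\<close> with
        \<open>2 ^ (q * e) \<le> r\<close>.\<close>
      define e where "e = nat \<lfloor>log 2 r / real q\<rfloor>"
      have lg: "log 2 r \<ge> 0" using r by simp
      have e_le: "real e \<le> log 2 r / real q" unfolding e_def using lg q by (simp add: of_nat_nat)
      have e_gt: "log 2 r / real q < real e + 1" unfolding e_def using lg q by (simp add: of_nat_nat)
      have lower: "real q * real e \<le> log 2 r" using e_le q by (simp add: field_simps)
      have upper: "log 2 r \<le> real q * (real e + 1)" using e_gt q by (simp add: field_simps)
      have rp: "r powr (- 1 / 2 + \<delta>) = 2 powr (- (log 2 r * s))"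
      proof -
        have "r = 2 powr (log 2 r)" using r by simp
        then have "r powr (- s) = 2 powr (log 2 r * (- s))" by (metis powr_powr)
        moreover have "- 1 / 2 + \<delta> = - s" by (simp add: s_def)
        ultimately show ?thesis by simp
      qed
      show ?thesis
      proof (cases "e0 \<le> e")
        case True
        have "2 ^ (q * e) \<le> card {j\<in>{..<n}. A i j \<noteq> 0}" if "i < n" for i
        proof -
          have "(2::real) ^ (q * e) = 2 powr (real q * real e)" by (simp add: powr_realpow[symmetric])
          also have "\<dots> \<le> 2 powr (log 2 r)" using lower by (intro powr_mono) auto
          also have "\<dots> = r" using r by simp
          also have "\<dots> \<le> real (card {j\<in>{..<n}. A i j \<noteq> 0})" using row that by blast
          finally show ?thesis by (metis of_nat_le_iff of_nat_numeral of_nat_power)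
        qed
        then have "prb (signs 0 {..<n}) (\<lambda>x. qpoly A {..<n} l \<gamma> x = 0) \<le> C * 2 powr (- (real q * real e * s))"
          unfolding s_def
          by (intro main[THEN spec, THEN mp, OF True, THEN spec, THEN spec, THEN spec, THEN spec, THEN mp, THEN mp, THEN mp, THEN mp])
             (use n sym in \<open>auto simp: lessThan_empty_iff\<close>)
        also have "\<dots> \<le> C * (2 powr (real q * (real e0 + 1) * s) * 2 powr (- (log 2 r * s)))"
        proof (intro mult_left_mono)
          have "log 2 r * s \<le> real q * (real e + 1) * s" using upper s by (intro mult_right_mono) auto
          also have "\<dots> = real q * real e * s + real q * 1 * s" by (simp add: algebra_simps)
          finally have "log 2 r * s \<le> real q * real e * s + real q * 1 * s" .
          moreover have "real q * 1 * s \<le> real q * (real e0 + 1) * s" using s by (intro mult_right_mono mult_left_mono) auto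
          ultimately have "- (real q * real e * s) \<le> real q * (real e0 + 1) * s + - (log 2 r * s)" by linarith
          then show "2 powr (- (real q * real e * s)) \<le> 2 powr (real q * (real e0 + 1) * s) * 2 powr (- (log 2 r * s))"
            unfolding powr_add[symmetric] by (intro powr_mono) auto
        qed (use C in auto)
        finally show ?thesis unfolding C'_def rp by (simp only: mult.assoc mult_1)
      next
        case False
        have "log 2 r \<le> real q * (real e0 + 1)"
        proof -
          have "real q * (real e + 1) \<le> real q * (real e0 + 1)" using False by (intro mult_left_mono) auto
          then show ?thesis using upper by simp
        qed
        then have "1 \<le> 2 powr (real q * (real e0 + 1) * s) * 2 powr (- (log 2 r * s))"
          unfolding powr_add[symmetric] using s by (intro ge_one_powr_ge_zero) (auto intro: mult_right_mono)
        then have "1 * 1 \<le> C * (2 powr (real q * (real e0 + 1) * s) * 2 powr (- (log 2 r * s)))"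
          by (intro mult_mono) (use C in auto)
        then have "1 \<le> C' * r powr (- 1 / 2 + \<delta>)" unfolding C'_def rp by (simp only: mult.assoc mult_1)
        then show ?thesis by (rule order_trans[OF measure_pmf.prob_le_1])
      qed
    qed
    then show ?thesis by (intro exI[of _ C']) blast
  qed
  then obtain C where C: "\<forall>(n::nat) (r::real) A l \<gamma>. n \<ge> 1 \<longrightarrow> r \<ge> 1 \<longrightarrow> (\<forall>i j. A i j = A j i) \<longrightarrow>
      (\<forall>i<n. r \<le> real (card {j\<in>{..<n}. A i j \<noteq> 0})) \<longrightarrow>
      prb (signs 0 {..<n}) (\<lambda>x. qpoly A {..<n} l \<gamma> x = 0) \<le> C * r powr (- 1 / 2 + \<delta>)" by blast
  show ?thesis
  proof (intro exI[of _ C] allI impI)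
    fix n :: nat and r :: real and A
    assume n: "n \<ge> 1" and r: "r \<ge> exp (ln (real n) powr (1 / 4))" and A: "A \<in> carrier_mat n n"
      and At: "transpose_mat A = A" and row: "\<forall>i<n. real (card (row_support A i)) \<ge> r"
    have r1: "r \<ge> 1" using r by (rule order_trans[rotated]) simp
    have sym: "\<forall>i j. entries A n i j = entries A n j i"
    proof (intro allI)
      fix i j
      have "transpose_mat A $$ (i, j) = A $$ (j, i)" if "i < n" "j < n" using A that by simp
      then show "entries A n i j = entries A n j i" unfolding entries_def At by auto
    qed
    have rs: "row_support A i = {j\<in>{..<n}. entries A n i j \<noteq> 0}" if "i < n" for i
      using A that by (auto simp: row_support_def entries_def)
    have row': "\<forall>i<n. r \<le> real (card {j\<in>{..<n}. entries A n i j \<noteq> 0})" using row rs by simp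
    have key: "measure_pmf.prob (random_sign_vec n) {x. quadratic_form A x = linear_form l x + c}
        \<le> C * r powr (- 1 / 2 + \<delta>)" if "l \<in> carrier_vec n" for l c
      unfolding random_sign_vec_eq[OF A that]
      by (rule C[THEN spec, THEN spec, THEN spec, THEN spec, THEN spec, THEN mp, OF n, THEN mp, OF r1,
            THEN mp, OF sym, THEN mp, OF row'])
    have zero: "measure_pmf.prob (random_sign_vec n) {x. quadratic_form A x = c} \<le> C * r powr (- 1 / 2 + \<delta>)" for c
    proof -
      have "measure_pmf.prob (random_sign_vec n) {x. quadratic_form A x = c}
          = prb (random_sign_vec n) (\<lambda>x. quadratic_form A x = linear_form (0\<^sub>v n) x + c)"
        by (rule prb_cong) (auto simp: random_sign_vec_def linear_form_def)
      also have "\<dots> \<le> C * r powr (- 1 / 2 + \<delta>)" by (rule key) simp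
      finally show ?thesis .
    qed
    show "(\<forall>l \<in> carrier_vec n.
        (SUP c. measure_pmf.prob (random_sign_vec n)
           {x. quadratic_form A x = linear_form l x + c}) \<le> C * r powr (- 1 / 2 + \<delta>)) \<and>
      (SUP c. measure_pmf.prob (random_sign_vec n)
         {x. quadratic_form A x = c}) \<le> C * r powr (- 1 / 2 + \<delta>)"
      using key zero by (intro conjI ballI cSUP_least) auto
  qed
qed

end
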